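(* Let $X$ be a Banach space such that either $X$ is isomorphic to $c_0(X)$, or $X$ is isomorphic to $\ell_p(X)$ for some $1<p\le\infty$. Suppose moreover that $X$ contains no complemented copy of $\ell_1$. If $X$ has the uniform primary factorisation property, then $\ell_1(X)$ has the uniform primary factorisation property. In particular, in that case $\ell_1(X)$ is primary.
   Context: The scalar field $\mathbb{K}$ is $\mathbb{R}$ or $\mathbb{C}$. "Operator" means bounded linear map between Banach spaces; isomorphic means linearly homeomorphic. $X$ contains a complemented copy of $\ell_1$ if it has a complemented subspace isomorphic to $\ell_1$. For a Banach space $X$, $\ell_p(X)$ is the space of sequences $(x_n)_{n\in\mathbb{N}}$ in $X$ with $(\|x_n\|)_n\in\ell_p$, with norm $\|(\|x_n\|)_n\|_{\ell_p}$ (for $p=\infty$: bounded sequences, supremum norm); $c_0(X)$ is the space of sequences in $X$ with $\|x_n\|\to0$, with the supremum norm. An operator $S\colon Z\to W$ factors through an operator $T\colon X\to Y$ with constant $C$ if there are operators $V\colon Z\to X$, $U\colon Y\to W$ with $UTV=S$ and $\|U\|\|V\|\le C$. For $C\ge1$, a Banach space $X$ has the $C$-primary factorisation property ($C$-PFP) if for every operator $T\colon X\to X$ the identity $I_X$ factors through $T$ or through $I_X-T$ with constant $C$. $X$ has the uniform primary factorisation property (UPFP) if it has the $C$-PFP for some $C\ge1$. $X$ is primary if for every (bounded linear) projection $P\colon X\to X$, either $PX$ or $(I_X-P)X$ is isomorphic to $X$. *)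

theory Defs
  imports "HOL-Analysis.Analysis" "HOL-Library.Function_Algebras"
begin

text \<open>The scalar field: an isometric copy of \<open>\<real>\<close> or of \<open>\<complex>\<close>. One type class is used
  so that the real and the complex case are covered by the same statements.\<close>

class real_or_complex = real_normed_field +
  assumes real_or_complex:
    "(\<exists>f :: 'a \<Rightarrow> real. bij f \<and> (\<forall>x y. f (x + y) = f x + f y \<and> f (x * y) = f x * f y)
        \<and> (\<forall>x. norm (f x) = norm x)) \<or>
     (\<exists>f :: 'a \<Rightarrow> complex. bij f \<and> (\<forall>x y. f (x + y) = f x + f y \<and> f (x * y) = f x * f y)
        \<and> (\<forall>x. norm (f x) = norm x))"

instance real :: real_or_complex
  by standard (rule disjI1, rule exI[of _ "\<lambda>x. x"], simp add: bij_id[unfolded id_def])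

instance complex :: real_or_complex
  by standard (rule disjI2, rule exI[of _ "\<lambda>x. x"], simp add: bij_id[unfolded id_def])

text \<open>A Banach space over the scalar field is a type of class \<open>banach\<close> together with a
  multiplication by scalars that extends the real one and for which the norm is homogeneous.
  For real scalars, \<open>scl\<close> is necessarily \<open>scaleR\<close>.\<close>

definition banach_scaling :: "('k::real_or_complex \<Rightarrow> 'a::banach \<Rightarrow> 'a) \<Rightarrow> bool" where
  "banach_scaling scl \<longleftrightarrow>
     vector_space scl \<and>
     (\<forall>r x. scl (of_real r) x = r *\<^sub>R x) \<and>
     (\<forall>c x. norm (scl c x) = norm c * norm x)"

lemma banach_scaling_scaleR: "banach_scaling (scaleR :: real \<Rightarrow> 'a::banach \<Rightarrow> 'a)"
  by (auto simp: banach_scaling_def intro: real_vector.vector_space_axioms)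

text \<open>Sequence spaces over a Banach space depend on the exponent, and complemented subspaces
  on a projection, so neither is a type. Hence normed spaces are represented with an explicit
  carrier inside an additive group; addition is that of the group (pointwise on sequences).\<close>

record ('k, 'a) nspace =
  carrier :: "'a set"
  smult :: "'k \<Rightarrow> 'a \<Rightarrow> 'a"
  nrm :: "'a \<Rightarrow> real"

definition whole_space :: "('k \<Rightarrow> 'a::real_normed_vector \<Rightarrow> 'a) \<Rightarrow> ('k, 'a) nspace" where
  "whole_space scl = \<lparr>carrier = UNIV, smult = scl, nrm = norm\<rparr>"

definition scalar_space :: "('k::real_or_complex, 'k) nspace" where
  "scalar_space = whole_space (*)"

definition subspace_of :: "('k, 'a) nspace \<Rightarrow> 'a set \<Rightarrow> ('k, 'a) nspace" where
  "subspace_of X A = X\<lparr>carrier := A\<rparr>"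

text \<open>The space \<open>\<ell>\<^sub>p(X)\<close>, used for \<open>1 \<le> p \<le> \<infinity>\<close>.\<close>

definition lp :: "ereal \<Rightarrow> ('k, 'a) nspace \<Rightarrow> ('k, nat \<Rightarrow> 'a) nspace" where
  "lp p X =
    \<lparr>carrier = {x. (\<forall>n. x n \<in> carrier X) \<and>
        (if p = \<infinity> then bounded (range (\<lambda>n. nrm X (x n)))
         else summable (\<lambda>n. nrm X (x n) powr real_of_ereal p))},
     smult = (\<lambda>c x n. smult X c (x n)),
     nrm = (\<lambda>x. if p = \<infinity> then (SUP n. nrm X (x n))
         else (\<Sum>n. nrm X (x n) powr real_of_ereal p) powr (1 / real_of_ereal p))\<rparr>"

definition c0 :: "('k, 'a) nspace \<Rightarrow> ('k, nat \<Rightarrow> 'a) nspace" where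
  "c0 X =
    \<lparr>carrier = {x. (\<forall>n. x n \<in> carrier X) \<and> (\<lambda>n. nrm X (x n)) \<longlonglongrightarrow> 0},
     smult = (\<lambda>c x n. smult X c (x n)),
     nrm = (\<lambda>x. SUP n. nrm X (x n))\<rparr>"

text \<open>Bounded linear maps; the values of \<open>T\<close> outside the carrier are irrelevant.\<close>

definition operator ::
  "('k, 'a::ab_group_add) nspace \<Rightarrow> ('k, 'b::ab_group_add) nspace \<Rightarrow> ('a \<Rightarrow> 'b) \<Rightarrow> bool" where
  "operator X Y T \<longleftrightarrow>
     (\<forall>x\<in>carrier X. T x \<in> carrier Y) \<and>
     (\<forall>x\<in>carrier X. \<forall>y\<in>carrier X. T (x + y) = T x + T y) \<and>
     (\<forall>c. \<forall>x\<in>carrier X. T (smult X c x) = smult Y c (T x)) \<and>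
     (\<exists>B. \<forall>x\<in>carrier X. nrm Y (T x) \<le> B * nrm X x)"

text \<open>As for \<open>onorm\<close>, the quotient at \<open>x = 0\<close> is \<open>0 / 0 = 0\<close>.\<close>

definition opnorm :: "('k, 'a) nspace \<Rightarrow> ('k, 'b) nspace \<Rightarrow> ('a \<Rightarrow> 'b) \<Rightarrow> real" where
  "opnorm X Y T = (SUP x\<in>carrier X. nrm Y (T x) / nrm X x)"

definition isomorphic ::
  "('k, 'a::ab_group_add) nspace \<Rightarrow> ('k, 'b::ab_group_add) nspace \<Rightarrow> bool" where
  "isomorphic X Y \<longleftrightarrow>
     (\<exists>T S. operator X Y T \<and> operator Y X S \<and>
        (\<forall>x\<in>carrier X. S (T x) = x) \<and> (\<forall>y\<in>carrier Y. T (S y) = y))"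

definition projection :: "('k, 'a::ab_group_add) nspace \<Rightarrow> ('a \<Rightarrow> 'a) \<Rightarrow> bool" where
  "projection X P \<longleftrightarrow> operator X X P \<and> (\<forall>x\<in>carrier X. P (P x) = P x)"

text \<open>The complemented subspaces are the ranges of the bounded linear projections.\<close>

definition contains_complemented_l1 ::
  "('k::real_or_complex, 'a::ab_group_add) nspace \<Rightarrow> bool" where
  "contains_complemented_l1 X \<longleftrightarrow>
     (\<exists>P. projection X P \<and>
        isomorphic (subspace_of X (P ` carrier X)) (lp 1 (scalar_space :: ('k, 'k) nspace)))"

text \<open>\<open>S : Z \<rightarrow> W\<close> factors through \<open>T : X \<rightarrow> Y\<close> with constant \<open>C\<close>.\<close>

definition factors_through ::
  "('k, 'z::ab_group_add) nspace \<Rightarrow> ('k, 'w::ab_group_add) nspace \<Rightarrow> ('z \<Rightarrow> 'w) \<Rightarrow>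
   ('k, 'a::ab_group_add) nspace \<Rightarrow> ('k, 'b::ab_group_add) nspace \<Rightarrow> ('a \<Rightarrow> 'b) \<Rightarrow> real \<Rightarrow> bool" where
  "factors_through Z W S X Y T C \<longleftrightarrow>
     (\<exists>V U. operator Z X V \<and> operator Y W U \<and>
        (\<forall>z\<in>carrier Z. U (T (V z)) = S z) \<and>
        opnorm Y W U * opnorm Z X V \<le> C)"

definition pfp :: "real \<Rightarrow> ('k, 'a::ab_group_add) nspace \<Rightarrow> bool" where
  "pfp C X \<longleftrightarrow>
     (\<forall>T. operator X X T \<longrightarrow>
        factors_through X X (\<lambda>x. x) X X T C \<or>
        factors_through X X (\<lambda>x. x) X X (\<lambda>x. x - T x) C)"

definition upfp :: "('k, 'a::ab_group_add) nspace \<Rightarrow> bool" where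
  "upfp X \<longleftrightarrow> (\<exists>C\<ge>1. pfp C X)"

definition primary :: "('k, 'a::ab_group_add) nspace \<Rightarrow> bool" where
  "primary X \<longleftrightarrow>
     (\<forall>P. projection X P \<longrightarrow>
        isomorphic (subspace_of X (P ` carrier X)) X \<or>
        isomorphic (subspace_of X ((\<lambda>x. x - P x) ` carrier X)) X)"

end

theory Submission
  imports Defs
begin

text \<open>
  Let \<open>T\<close> be an operator on \<open>\<ell>\<^sub>1(X)\<close>, viewed as a matrix of operators \<open>T\<^sub>i\<^sub>j\<close> on \<open>X\<close>. By the
  factorisation property of \<open>X\<close>, after replacing \<open>T\<close> by \<open>I - T\<close> if necessary, the identity of \<open>X\<close>
  factors through \<open>T\<^sub>j\<^sub>j\<close> for infinitely many \<open>j\<close>, with one constant. Multiplying by the corresponding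
  diagonal operators makes these diagonal entries equal to the identity. If the rest of the matrix can
  be made small by passing to infinitely many indices and to suitable copies of \<open>X\<close> in the
  coordinates, then what remains is a perturbation of the identity of \<open>\<ell>\<^sub>1(X)\<close>, hence invertible, and
  the identity factors through \<open>T\<close>. The constant depends on \<open>X\<close> only, not on \<open>T\<close>.

  Below the diagonal this is a matter of choosing the indices sparse enough: as \<open>X\<close> has no complemented
  copy of \<open>\<ell>\<^sub>1\<close>, the tails of each column, an operator from \<open>X\<close> to \<open>\<ell>\<^sub>1(X)\<close>, tend to \<open>0\<close> in norm
  (\<open>tails_uniformly_small\<close>).

  Above the diagonal the entries of a row are only bounded, and here the isomorphism of \<open>X\<close> with
  \<open>c\<^sub>0(X)\<close> or \<open>\<ell>\<^sub>p(X)\<close> enters. Given \<open>n\<close> entries of one column, restrict them to \<open>n\<close> copies of \<open>X\<close>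
  that live on disjoint infinite sets of coordinates of \<open>\<ell>\<^sub>p(X)\<close>. If the norms all stayed above
  \<open>\<delta>\<close>, then a signed sum of \<open>n\<close> unit vectors, whose norm is of order \<open>n\<close> to the power \<open>1/p\<close>, would be
  mapped by the column to a vector of norm at least \<open>n \<delta>\<close>, which is impossible for large \<open>n\<close> as
  \<open>p > 1\<close> (\<open>splitting_family_of_isomorphic\<close>). Hence among sufficiently many candidate rows every later
  column has one with a small entry on some copy of \<open>X\<close>, and by the pigeonhole principle one row
  serves infinitely many columns. Iterating this selects the submatrix (\<open>select_nearly_diagonal\<close>), and
  \<open>factors_identity_ell1_of_diagonal\<close> carries out the argument of the first paragraph.

  Primariness follows by Pelczynski's decomposition method (\<open>decomposition\<close>): if the identity of
  \<open>Y = \<ell>\<^sub>1(X)\<close> factors through a projection \<open>P\<close>, then \<open>P Y\<close> contains a complemented copy of \<open>Y\<close>,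
  while \<open>Y\<close> is isomorphic to \<open>\<ell>\<^sub>1(Y)\<close>.

  The argument runs on types of class \<open>banach\<close>, with a type for \<open>\<ell>\<^sub>1(X)\<close>, and is transferred to the
  spaces with explicit carriers at the end.
\<close>

section \<open>The scalar field\<close>

lemma isometric_hom_complete:
  fixes g :: "'k::real_normed_field \<Rightarrow> 'b::{complete_space, real_normed_field}"
  assumes g: "bij g" "\<And>x y. g (x + y) = g x + g y" "\<And>x. norm (g x) = norm x"
    and X: "Cauchy (X :: nat \<Rightarrow> 'k)"
  shows "convergent X"
proof -
  have diff: "g (x - y) = g x - g y" for x y
    using g(2)[of "x - y" y] by simp
  have dist: "dist (g x) (g y) = dist x y" for x y
    by (simp add: dist_norm diff [symmetric] g(3))
  have "Cauchy (\<lambda>n. g (X n))"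
    using X unfolding Cauchy_def dist .
  then obtain L where L: "(\<lambda>n. g (X n)) \<longlonglongrightarrow> L"
    using Cauchy_convergent convergent_def by blast
  obtain l where l: "L = g l"
    using g(1) by (metis bij_pointE)
  have "X \<longlonglongrightarrow> l"
    using L unfolding l lim_sequentially dist .
  then show ?thesis
    by (rule convergentI)
qed

instance real_or_complex \<subseteq> banach
proof
  fix X :: "nat \<Rightarrow> 'a::real_or_complex"
  assume X: "Cauchy X"
  show "convergent X"
    using real_or_complex
  proof (elim disjE exE conjE)
    fix f :: "'a \<Rightarrow> real"
    assume "bij f" "\<forall>x y. f (x + y) = f x + f y \<and> f (x * y) = f x * f y" "\<forall>x. norm (f x) = norm x"
    then show ?thesis using isometric_hom_complete[of f X] X by blast
  next
    fix f :: "'a \<Rightarrow> complex"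
    assume "bij f" "\<forall>x y. f (x + y) = f x + f y \<and> f (x * y) = f x * f y" "\<forall>x. norm (f x) = norm x"
    then show ?thesis using isometric_hom_complete[of f X] X by blast
  qed
qed

text \<open>An isometric ring homomorphism fixes the real numbers: the image of \<open>r\<close> has distance
  \<open>\<bar>r\<bar>\<close> from \<open>0\<close> and \<open>\<bar>r - 1\<bar>\<close> from \<open>1\<close>, and the two circles touch only at \<open>r\<close>.\<close>

lemma isometric_hom_of_real:
  fixes g :: "'k::real_normed_field \<Rightarrow> complex"
  assumes g: "bij g" "\<And>x y. g (x + y) = g x + g y" "\<And>x y. g (x * y) = g x * g y"
    "\<And>x. norm (g x) = norm x"
  shows "g (of_real r) = of_real r"
proof -
  have diff: "g (x - y) = g x - g y" for x y
    using g(2)[of "x - y" y] by simp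
  have "g 1 * g 1 = g 1"
    using g(3)[of 1 1] by simp
  moreover have "g 1 \<noteq> 0"
    using g(4)[of 1] by auto
  ultimately have one: "g 1 = 1"
    by simp
  define z where "z = g (of_real r)"
  have a: "cmod z = \<bar>r\<bar>"
    using g(4)[of "of_real r"] by (simp add: z_def)
  have "z - 1 = g (of_real (r - 1))"
    by (simp add: z_def diff one)
  then have b: "cmod (z - 1) = \<bar>r - 1\<bar>"
    by (simp add: g(4) del: of_real_diff)
  have a': "(Re z)\<^sup>2 + (Im z)\<^sup>2 = r\<^sup>2"
    using a by (metis cmod_power2 power2_abs)
  have b': "(Re z - 1)\<^sup>2 + (Im z)\<^sup>2 = (r - 1)\<^sup>2"
    using b cmod_power2[of "z - 1"] by simp
  have "Re z = r"
    using a' b' by (simp add: power2_eq_square algebra_simps)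
  moreover from this have "Im z = 0"
    using a' by simp
  ultimately show ?thesis
    by (simp add: z_def complex_eq_iff)
qed

text \<open>The real and the complex case are told apart by the existence of a square root \<open>i\<close> of \<open>-1\<close>;
  complex scalars then have real and imaginary parts with respect to \<open>i\<close>.\<close>

lemma real_or_complex_cases:
  obtains (real) "\<And>c::'k::real_or_complex. \<exists>r. c = of_real r"
  | (complex) i :: "'k::real_or_complex" where "i * i = -1" "\<And>c::'k. \<exists>a b. c = of_real a + i * of_real b"
      "\<And>a b. (norm (of_real a + i * of_real b))\<^sup>2 = a\<^sup>2 + b\<^sup>2"
  using real_or_complex[where 'a = 'k]
proof (elim disjE exE conjE)
  fix f :: "'k \<Rightarrow> real"
  assume f: "bij f" "\<forall>x y. f (x + y) = f x + f y \<and> f (x * y) = f x * f y" "\<forall>x. norm (f x) = norm x"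
  have "c = of_real (f c) \<or> c = of_real (- f c)" for c
  proof -
    have "\<bar>f (of_real (f c))\<bar> = \<bar>f c\<bar>"
      using f(3) by simp
    then have "f (of_real (f c)) = f c \<or> f (of_real (f c)) = - f c"
      by linarith
    moreover have "f (- x) = - f x" for x
      using f(2)[rule_format, of x "- x"] f(3)[rule_format, of 0] by auto
    ultimately have "f (of_real (f c)) = f c \<or> f (of_real (f c)) = f (- c)"
      by simp
    then have "of_real (f c) = c \<or> of_real (f c) = - c"
      using f(1) by (meson bij_def injD)
    then show ?thesis
      by (metis add.inverse_inverse of_real_minus)
  qed
  then have "\<exists>r. c = of_real r" for c :: 'k
    by blast
  then show ?thesis
    by (rule real)
next
  fix f :: "'k \<Rightarrow> complex"
  assume f: "bij f" "\<forall>x y. f (x + y) = f x + f y \<and> f (x * y) = f x * f y" "\<forall>x. norm (f x) = norm x"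
  obtain i where i: "f i = \<i>"
    using f(1) by (metis bij_pointE)
  have re: "f (of_real r) = of_real r" for r
    using isometric_hom_of_real[of f] f by blast
  have lin: "f (of_real a + i * of_real b) = of_real a + \<i> * of_real b" for a b
    by (simp add: f(2) re i)
  have inj: "f x = f y \<Longrightarrow> x = y" for x y
    using f(1) by (meson bij_def injD)
  show ?thesis
  proof (rule complex[of i])
    have "f (i * i) = f (of_real (- 1))"
      unfolding re by (simp add: f(2) i)
    then show "i * i = - 1"
      using inj by fastforce
    show "\<exists>a b. c = of_real a + i * of_real b" for c
    proof (intro exI)
      show "c = of_real (Re (f c)) + i * of_real (Im (f c))"
        by (rule inj, subst lin) (simp add: complex_eq_iff)
    qed
    show "(norm (of_real a + i * of_real b))\<^sup>2 = a\<^sup>2 + b\<^sup>2" for a b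
    proof -
      have "norm (of_real a + i * of_real b) = cmod (of_real a + \<i> * of_real b)"
        using f(3) lin by metis
      then show ?thesis
        by (simp add: cmod_power2)
    qed
  qed
qed

section \<open>Norming functionals\<close>

text \<open>Homogeneity is required as an inequality for \<open>t > 0\<close> only. It implies the equation, by applying it
  to \<open>1/t\<close>, and it is the form that passes to infima.\<close>

definition sublinear :: "('b::real_vector \<Rightarrow> real) \<Rightarrow> bool" where
  "sublinear p \<longleftrightarrow> (\<forall>x y. p (x + y) \<le> p x + p y) \<and> (\<forall>t>0. \<forall>x. p (t *\<^sub>R x) \<le> t * p x)"

lemma sublinear_zero: "sublinear p \<Longrightarrow> p 0 = 0"
proof -
  assume p: "sublinear p"
  have "p ((1/2) *\<^sub>R 0) \<le> (1/2) * p 0" "p (2 *\<^sub>R 0) \<le> 2 * p 0"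
    using p unfolding sublinear_def by (meson half_gt_zero_iff zero_less_one zero_less_numeral)+
  then show ?thesis by simp
qed

lemma sublinear_minus: "sublinear p \<Longrightarrow> - p (- x) \<le> p x"
  using sublinear_zero[of p] unfolding sublinear_def by (smt (verit) add.right_inverse)

lemma sublinear_scaleR:
  assumes "sublinear p" "t \<ge> 0" shows "p (t *\<^sub>R x) = t * p x"
proof (cases "t = 0")
  case True then show ?thesis using sublinear_zero[OF assms(1)] by simp
next
  case False
  then have t: "t > 0" using assms by simp
  have "p ((1/t) *\<^sub>R (t *\<^sub>R x)) \<le> (1/t) * p (t *\<^sub>R x)"
    using assms t unfolding sublinear_def by (meson zero_less_divide_1_iff)
  then have "t * p x \<le> p (t *\<^sub>R x)"
    using t by (simp add: field_simps)
  moreover have "p (t *\<^sub>R x) \<le> t * p x"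
    using assms t unfolding sublinear_def by blast
  ultimately show ?thesis by simp
qed

text \<open>A sublinear functional can be pushed down in a prescribed direction: this is the largest
  sublinear functional below \<open>p\<close> whose value at \<open>- y\<close> is at most \<open>- p y\<close>. It turns out that
  this one construction drives both halves of the Hahn-Banach argument: applied to a minimal
  sublinear functional it shows linearity, applied to the norm it produces the norming value.\<close>

lemma sublinear_push_down:
  fixes p :: "'b::real_vector \<Rightarrow> real"
  assumes p: "sublinear p"
  obtains q where "sublinear q" "q \<le> p" "q (- y) \<le> - p y"
proof
  define q where "q x = (INF t\<in>{0..}. p (x + t *\<^sub>R y) - t * p y)" for x
  have below: "- p (- x) \<le> p (x + t *\<^sub>R y) - t * p y" if "t \<ge> 0" for x t
  proof -
    have "p (t *\<^sub>R y) \<le> p (x + t *\<^sub>R y) + p (- x)"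
      using p unfolding sublinear_def by (metis add.commute add_minus_cancel)
    then show ?thesis
      using sublinear_scaleR[OF p that] by simp
  qed
  have bdd: "bdd_below ((\<lambda>t. p (x + t *\<^sub>R y) - t * p y) ` {0..})" for x
    using below by (intro bdd_belowI2) auto
  have low: "q x \<le> p (x + t *\<^sub>R y) - t * p y" if "t \<ge> 0" for x t
    unfolding q_def using that by (intro cINF_lower bdd) auto
  have add: "q (x + x') \<le> q x + q x'" for x x'
  proof -
    have "q (x + x') - (p (x' + s *\<^sub>R y) - s * p y) \<le> p (x + t *\<^sub>R y) - t * p y"
      if "t \<ge> 0" "s \<ge> 0" for t s
    proof -
      have "q (x + x') \<le> p ((x + t *\<^sub>R y) + (x' + s *\<^sub>R y)) - (t + s) * p y"
        using low[of "t + s" "x + x'"] that by (simp add: algebra_simps)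
      also have "\<dots> \<le> p (x + t *\<^sub>R y) + p (x' + s *\<^sub>R y) - (t + s) * p y"
        using p unfolding sublinear_def by simp
      finally show ?thesis by (simp add: algebra_simps)
    qed
    then have "q (x + x') - (p (x' + s *\<^sub>R y) - s * p y) \<le> q x" if "s \<ge> 0" for s
      unfolding q_def[of x] using that by (intro cINF_greatest) auto
    then have "q (x + x') - q x \<le> p (x' + s *\<^sub>R y) - s * p y" if "s \<ge> 0" for s
      using that by (smt (verit))
    then have "q (x + x') - q x \<le> q x'"
      unfolding q_def[of x'] by (intro cINF_greatest) auto
    then show ?thesis by simp
  qed
  have hom: "q (s *\<^sub>R x) \<le> s * q x" if s: "s > 0" for s x
  proof -
    have "q (s *\<^sub>R x) / s \<le> p (x + t *\<^sub>R y) - t * p y" if "t \<ge> 0" for t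
    proof -
      have "q (s *\<^sub>R x) \<le> p (s *\<^sub>R (x + t *\<^sub>R y)) - (s * t) * p y"
        using low[of "s * t" "s *\<^sub>R x"] that s by (simp add: algebra_simps)
      also have "\<dots> = s * (p (x + t *\<^sub>R y) - t * p y)"
        using sublinear_scaleR[OF p, of s "x + t *\<^sub>R y"] s by (simp add: right_diff_distrib)
      finally show ?thesis using s by (simp add: field_simps)
    qed
    then have "q (s *\<^sub>R x) / s \<le> q x"
      unfolding q_def[of x] by (intro cINF_greatest) auto
    then show ?thesis using s by (simp add: field_simps)
  qed
  show "sublinear q"
    unfolding sublinear_def using add hom by blast
  show "q \<le> p"
    unfolding le_fun_def using low[of 0] by simp
  show "q (- y) \<le> - p y"
    using low[of 1 "- y"] sublinear_zero[OF p] by simp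
qed

text \<open>Zorn's lemma: the pointwise infimum of a chain of sublinear functionals below \<open>p0\<close> is finite,
  since each of them is bounded below by \<open>- p0 (- x)\<close>, and it is again sublinear.\<close>

lemma minimal_sublinear_below:
  fixes p0 :: "'b::real_vector \<Rightarrow> real"
  assumes p0: "sublinear p0"
  obtains f where "sublinear f" "f \<le> p0" "\<And>q. sublinear q \<Longrightarrow> q \<le> f \<Longrightarrow> q = f"
proof -
  define A where "A = {p. sublinear p \<and> p \<le> p0}"
  have "\<exists>m\<in>A. \<forall>a\<in>A. a \<le> m \<longrightarrow> a = m"
  proof (rule predicate_Zorn[where P = "\<lambda>a b. b \<le> a"])
    show "partial_order_on A (relation_of (\<lambda>a b. b \<le> a) A)"
      by (rule partial_order_on_relation_ofI) auto
    fix C assume C: "C \<in> Chains (relation_of (\<lambda>a b. b \<le> a) A)"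
    then have sub: "C \<subseteq> A" and tot: "\<And>a b. a \<in> C \<Longrightarrow> b \<in> C \<Longrightarrow> a \<le> b \<or> b \<le> a"
      unfolding Chains_def relation_of_def by auto
    show "\<exists>u\<in>A. \<forall>a\<in>C. u \<le> a"
    proof (cases "C = {}")
      case True
      then show ?thesis using p0 by (auto simp: A_def)
    next
      case False
      define u where "u x = (INF p\<in>C. p x)" for x
      have below: "- p0 (- x) \<le> p x" if "p \<in> C" for p x
      proof -
        have "sublinear p" "p (- x) \<le> p0 (- x)"
          using that sub by (auto simp: A_def le_fun_def)
        then show ?thesis using sublinear_minus[of p x] by linarith
      qed
      have bdd: "bdd_below ((\<lambda>p. p x) ` C)" for x
        using below by (intro bdd_belowI2)
      have low: "u x \<le> p x" if "p \<in> C" for p x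
        unfolding u_def by (intro cINF_lower bdd that)
      have sl: "sublinear p" if "p \<in> C" for p
        using that sub by (auto simp: A_def)
      have "u (x + y) \<le> u x + u y" for x y
      proof -
        have "u (x + y) \<le> p x + p' y" if pp: "p \<in> C" "p' \<in> C" for p p'
        proof -
          have *: "u (x + y) \<le> r x + r y" if "r \<in> C" for r
            using low[OF that] sl[OF that] unfolding sublinear_def by (meson order_trans)
          show ?thesis
            using tot[OF pp] *[OF pp(1)] *[OF pp(2)] unfolding le_fun_def by (smt (verit))
        qed
        then have "u (x + y) - p' y \<le> u x" if "p' \<in> C" for p'
          unfolding u_def[of x] using that False by (intro cINF_greatest) (auto simp: algebra_simps)
        then have "u (x + y) - u x \<le> u y"
          unfolding u_def[of y] using False by (intro cINF_greatest) (auto simp: algebra_simps)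
        then show ?thesis by simp
      qed
      moreover have "u (t *\<^sub>R x) \<le> t * u x" if t: "t > 0" for t x
      proof -
        have "u (t *\<^sub>R x) / t \<le> p x" if "p \<in> C" for p
          using low[OF that, of "t *\<^sub>R x"] sublinear_scaleR[OF sl[OF that], of t x] t
          by (simp add: field_simps)
        then have "u (t *\<^sub>R x) / t \<le> u x"
          unfolding u_def[of x] using False by (intro cINF_greatest) auto
        then show ?thesis using t by (simp add: field_simps)
      qed
      ultimately have "sublinear u"
        unfolding sublinear_def by blast
      moreover have "u \<le> p0"
      proof -
        obtain p where "p \<in> C" using False by blast
        then have "u \<le> p" "p \<le> p0" using low sub by (auto simp: A_def le_fun_def)
        then show ?thesis by (rule order_trans)
      qed
      ultimately show ?thesis
        using low by (auto simp: A_def le_fun_def)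
    qed
  qed
  then obtain m where m: "m \<in> A" "\<And>a. a \<in> A \<Longrightarrow> a \<le> m \<Longrightarrow> a = m"
    by blast
  show ?thesis
  proof (rule that[of m])
    show "sublinear m" "m \<le> p0" using m by (auto simp: A_def)
    show "q = m" if "sublinear q" "q \<le> m" for q
      using m that by (auto simp: A_def)
  qed
qed

text \<open>Push the norm down until its value at \<open>- x0\<close> is at most \<open>- norm x0\<close>, and take a minimal
  sublinear functional \<open>f\<close> below that. Minimality and one more push give \<open>f (- x) = - f x\<close>, and an odd
  sublinear functional is linear.\<close>

lemma real_norming_functional:
  fixes x0 :: "'b::real_normed_vector"
  obtains f :: "'b \<Rightarrow> real" where "linear f" "\<And>x. \<bar>f x\<bar> \<le> norm x" "f x0 = norm x0"
proof -
  have "sublinear (norm :: 'b \<Rightarrow> real)"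
    unfolding sublinear_def by (auto intro: norm_triangle_ineq)
  then obtain p0 :: "'b \<Rightarrow> real" where p0: "sublinear p0" "p0 \<le> norm" "p0 (- x0) \<le> - norm x0"
    by (rule sublinear_push_down)
  obtain f where f: "sublinear f" "f \<le> p0" "\<And>q. sublinear q \<Longrightarrow> q \<le> f \<Longrightarrow> q = f"
    using minimal_sublinear_below[OF p0(1)] by blast
  have le: "f x \<le> norm x" for x
    using f(2) p0(2) by (meson le_fun_def order_trans)
  have odd: "f (- x) = - f x" for x
  proof -
    obtain q where q: "sublinear q" "q \<le> f" "q (- x) \<le> - f x"
      using sublinear_push_down[OF f(1)] by blast
    then have "f (- x) \<le> - f x" using f(3) by metis
    then show ?thesis using sublinear_minus[OF f(1), of x] by linarith
  qed
  have sub: "f (x + y) \<le> f x + f y" for x y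
    using f(1) unfolding sublinear_def by blast
  have "linear f"
  proof (rule linearI)
    show "f (x + y) = f x + f y" for x y
      using sub[of x y] sub[of "- x" "- y"] odd[of "x + y"] odd[of x] odd[of y] by simp
    show "f (t *\<^sub>R x) = t *\<^sub>R f x" for t x
      using sublinear_scaleR[OF f(1), of t x] sublinear_scaleR[OF f(1), of "- t" "x"] odd[of "t *\<^sub>R x"]
      by (cases "t \<ge> 0") auto
  qed
  moreover have "\<bar>f x\<bar> \<le> norm x" for x
    using le[of x] le[of "- x"] odd[of x] by simp
  moreover have "f x0 = norm x0"
    using f(2) p0(3) odd[of x0] le[of x0] unfolding le_fun_def by (smt (verit))
  ultimately show ?thesis by (rule that)
qed

lemma banach_scaling_simps:
  assumes "banach_scaling scl"
  shows "scl c (x + y) = scl c x + scl c y" "scl (c + d) x = scl c x + scl d x"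
    "scl (c * d) x = scl c (scl d x)" "scl 1 x = x" "scl (of_real r) x = r *\<^sub>R x"
    "norm (scl c x) = norm c * norm x" "scl c 0 = 0" "scl c (x - y) = scl c x - scl c y"
proof -
  interpret vector_space scl using assms by (simp add: banach_scaling_def)
  show "scl c (x + y) = scl c x + scl c y" "scl (c + d) x = scl c x + scl d x"
    "scl (c * d) x = scl c (scl d x)" "scl 1 x = x" "scl (of_real r) x = r *\<^sub>R x"
    "norm (scl c x) = norm c * norm x" "scl c 0 = 0" "scl c (x - y) = scl c x - scl c y"
    using assms by (simp_all add: banach_scaling_def scale_right_distrib scale_left_distrib
        scale_right_diff_distrib)
qed

text \<open>The complex Hahn-Banach theorem follows from the real one by passing from a real
  functional \<open>g\<close> to \<open>x \<mapsto> g x - i g (i x)\<close>, whose modulus at \<open>x\<close> is the value of \<open>g\<close> at a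
  rotation of \<open>x\<close>.\<close>

lemma norming_functional:
  fixes scl :: "'k::real_or_complex \<Rightarrow> 'b::banach \<Rightarrow> 'b" and x0 :: 'b
  assumes scl: "banach_scaling scl"
  obtains f :: "'b \<Rightarrow> 'k" where "\<And>x y. f (x + y) = f x + f y" "\<And>c x. f (scl c x) = c * f x"
    "\<And>x. norm (f x) \<le> norm x" "f x0 = of_real (norm x0)"
proof -
  note s = banach_scaling_simps[OF scl]
  obtain g :: "'b \<Rightarrow> real" where g: "linear g" "\<And>x. \<bar>g x\<bar> \<le> norm x" "g x0 = norm x0"
    using real_norming_functional[of x0] by blast
  have ga: "g (x + y) = g x + g y" for x y using g(1) by (rule linear_add)
  have gs: "g (r *\<^sub>R x) = r * g x" for r x using linear_scale[OF g(1)] by simp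
  show ?thesis
  proof (cases rule: real_or_complex_cases[where 'k = 'k])
    case real
    show ?thesis
    proof (rule that[of "\<lambda>x. of_real (g x)"])
      show "of_real (g (scl c x)) = c * of_real (g x)" for c x
        using real[of c] by (auto simp: s gs)
    qed (use g in \<open>simp_all add: ga\<close>)
  next
    case (complex i)
    define F where "F x = of_real (g x) - i * of_real (g (scl i x))" for x
    have add: "F (x + y) = F x + F y" for x y
      by (simp add: F_def s ga algebra_simps)
    have sr: "F (r *\<^sub>R x) = of_real r * F x" for r x
    proof -
      have "scl i (r *\<^sub>R x) = r *\<^sub>R scl i x"
        by (simp flip: s(5) s(3) add: mult.commute)
      then show ?thesis by (simp add: F_def gs algebra_simps)
    qed
    have si: "F (scl i x) = i * F x" for x
    proof -
      have "scl i (scl i x) = (- 1) *\<^sub>R x"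
        using s(5)[of "-1" x] s(3)[of i i x] complex(1) by simp
      moreover have "i * (i * z) = - z" for z
        using complex(1) by (metis mult.assoc mult_minus1)
      ultimately show ?thesis
        using gs[of "-1" x] by (simp add: F_def right_diff_distrib)
    qed
    have hom: "F (scl c x) = c * F x" for c x
    proof -
      obtain a b where c: "c = of_real a + i * of_real b" using complex(2) by blast
      have "F (scl c x) = F (a *\<^sub>R x + scl i (b *\<^sub>R x))"
        unfolding c s(2) s(3) s(5) ..
      then show ?thesis by (simp add: c add sr si algebra_simps)
    qed
    have re: "(g x)\<^sup>2 + (g (scl i x))\<^sup>2 = (norm (F x))\<^sup>2" for x
      using complex(3)[of "g x" "- g (scl i x)"] by (simp add: F_def)
    \<comment> \<open>Rotate \<open>x\<close> by a unit scalar \<open>c\<close> such that \<open>F (c x) = \<bar>F x\<bar>\<close> is real and hence equal to \<open>g (c x)\<close>.\<close>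
    have norm: "norm (F x) \<le> norm x" for x
    proof (cases "F x = 0")
      case False
      define c where "c = of_real (norm (F x)) / F x"
      have nc: "norm c = 1" using False by (simp add: c_def norm_divide)
      have "F (scl c x) = of_real (norm (F x))"
        using False by (simp add: hom c_def)
      then have eq: "of_real (g (scl c x) - norm (F x)) = i * of_real (g (scl i (scl c x)))"
        unfolding F_def[of "scl c x"] by (simp add: algebra_simps)
      have "(of_real ((g (scl c x) - norm (F x))\<^sup>2) :: 'k) = i * i * of_real ((g (scl i (scl c x)))\<^sup>2)"
        using arg_cong[OF eq, of "\<lambda>z. z\<^sup>2"] by (simp add: power2_eq_square del: of_real_diff)
      then have "(of_real ((g (scl c x) - norm (F x))\<^sup>2) :: 'k) = of_real (- (g (scl i (scl c x)))\<^sup>2)"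
        by (simp add: complex(1) del: of_real_diff of_real_power)
      then have "(g (scl c x) - norm (F x))\<^sup>2 = - (g (scl i (scl c x)))\<^sup>2"
        using of_real_eq_iff by blast
      then have "(g (scl c x) - norm (F x))\<^sup>2 \<le> 0"
        by simp
      then have "g (scl c x) = norm (F x)"
        by simp
      then have "norm (F x) \<le> norm (scl c x)" using g(2)[of "scl c x"] by simp
      then show ?thesis by (simp add: s nc)
    qed simp
    \<comment> \<open>The real part of \<open>F x0\<close> already has the largest possible modulus, so the imaginary part vanishes.\<close>
    have "(g (scl i x0))\<^sup>2 \<le> 0"
      using re[of x0] norm[of x0] g(3) by (smt (verit) norm_ge_zero power_mono)
    then have "F x0 = of_real (norm x0)"
      by (simp add: F_def g(3))
    then show ?thesis
      using that[of F] add hom norm by blast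
  qed
qed

section \<open>The Banach space of absolutely summable sequences\<close>

text \<open>For a fixed exponent the sequence space can be a type, so that the notions and theorems
  about the classes of normed and Banach spaces apply to \<open>\<ell>\<^sub>1(X)\<close>.\<close>

typedef (overloaded) ('a::real_normed_vector) ell1 = "{x :: nat \<Rightarrow> 'a. summable (\<lambda>n. norm (x n))}"
  morphisms coord Abs_ell1
  by (rule exI[of _ "\<lambda>_. 0"]) simp

setup_lifting type_definition_ell1

lemma summable_norm_coord [simp, intro]: "summable (\<lambda>n. norm (coord x n))"
  using coord[of x] by simp

lemma ell1_eqI: "(\<And>n. coord x n = coord y n) \<Longrightarrow> x = y"
  by (metis coord_inject ext)

instantiation ell1 :: (real_normed_vector) real_normed_vector
begin

lift_definition zero_ell1 :: "'a ell1" is "\<lambda>_. 0" by simp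

lift_definition plus_ell1 :: "'a ell1 \<Rightarrow> 'a ell1 \<Rightarrow> 'a ell1" is "\<lambda>x y n. x n + y n"
  by (rule summable_comparison_test'[OF summable_add])
    (assumption, assumption, simp add: norm_triangle_ineq)

lift_definition uminus_ell1 :: "'a ell1 \<Rightarrow> 'a ell1" is "\<lambda>x n. - x n" by simp

lift_definition minus_ell1 :: "'a ell1 \<Rightarrow> 'a ell1 \<Rightarrow> 'a ell1" is "\<lambda>x y n. x n - y n"
  by (rule summable_comparison_test'[OF summable_add])
    (assumption, assumption, simp add: norm_triangle_ineq4)

lift_definition scaleR_ell1 :: "real \<Rightarrow> 'a ell1 \<Rightarrow> 'a ell1" is "\<lambda>r x n. r *\<^sub>R x n"
  by (simp add: summable_mult)

definition norm_ell1 :: "'a ell1 \<Rightarrow> real" where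
  "norm_ell1 x = (\<Sum>n. norm (coord x n))"

definition sgn_ell1 :: "'a ell1 \<Rightarrow> 'a ell1" where
  "sgn_ell1 x = scaleR (inverse (norm x)) x"

definition dist_ell1 :: "'a ell1 \<Rightarrow> 'a ell1 \<Rightarrow> real" where
  "dist_ell1 x y = norm (x - y)"

definition uniformity_ell1 :: "('a ell1 \<times> 'a ell1) filter" where
  "uniformity_ell1 = (INF e\<in>{0<..}. principal {(x, y). dist x y < e})"

definition open_ell1 :: "'a ell1 set \<Rightarrow> bool" where
  "open_ell1 U \<longleftrightarrow> (\<forall>x\<in>U. eventually (\<lambda>(x', y). x' = x \<longrightarrow> y \<in> U) uniformity)"

instance
proof
  fix x y z :: "'a ell1" and a b :: real
  show "x + y + z = x + (y + z)" "x + y = y + x" "0 + x = x" "- x + x = 0" "x - y = x + - y"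
    "a *\<^sub>R (x + y) = a *\<^sub>R x + a *\<^sub>R y" "(a + b) *\<^sub>R x = a *\<^sub>R x + b *\<^sub>R x"
    "a *\<^sub>R b *\<^sub>R x = (a * b) *\<^sub>R x" "1 *\<^sub>R x = x"
    by (transfer; simp add: algebra_simps)+
  show "dist x y = norm (x - y)" "sgn x = scaleR (inverse (norm x)) x"
    by (simp_all add: dist_ell1_def sgn_ell1_def)
  show "uniformity = (INF e\<in>{0<..}. principal {(x :: 'a ell1, y). dist x y < e})"
    by (rule uniformity_ell1_def)
  show "open U \<longleftrightarrow> (\<forall>x\<in>U. eventually (\<lambda>(x', y). x' = x \<longrightarrow> y \<in> U) uniformity)" for U :: "'a ell1 set"
    by (rule open_ell1_def)
  show "norm x = 0 \<longleftrightarrow> x = 0"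
  proof
    assume "norm x = 0"
    then have "\<forall>n. norm (coord x n) = 0"
      unfolding norm_ell1_def by (subst (asm) suminf_eq_zero_iff) auto
    then show "x = 0"
      by (intro ell1_eqI) (simp add: zero_ell1.rep_eq)
  qed (simp add: norm_ell1_def zero_ell1.rep_eq)
  show "norm (x + y) \<le> norm x + norm y"
    unfolding norm_ell1_def plus_ell1.rep_eq
    using summable_norm_coord[of "x + y"]
    by (subst suminf_add) (auto intro!: suminf_le summable_add norm_triangle_ineq
        simp: plus_ell1.rep_eq)
  show "norm (a *\<^sub>R x) = \<bar>a\<bar> * norm x"
    unfolding norm_ell1_def by (simp add: scaleR_ell1.rep_eq suminf_mult)
qed

end

lemmas coord_simps [simp] = zero_ell1.rep_eq plus_ell1.rep_eq uminus_ell1.rep_eq minus_ell1.rep_eq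
  scaleR_ell1.rep_eq

lemma norm_coord_le: "norm (coord x n) \<le> norm x"
  unfolding norm_ell1_def using sum_le_suminf[of "\<lambda>n. norm (coord x n)" "{n}"] by simp

lemma sum_norm_coord_le: "finite A \<Longrightarrow> (\<Sum>n\<in>A. norm (coord x n)) \<le> norm x"
  unfolding norm_ell1_def by (rule sum_le_suminf) auto

lemma bounded_linear_coord: "bounded_linear (\<lambda>x. coord x n)"
  by (rule bounded_linear_intro[of _ 1]) (simp_all add: norm_coord_le)

lemma norm_ell1_leI:
  assumes "\<And>N. (\<Sum>n<N. norm (coord x n)) \<le> B"
  shows "norm x \<le> B"
  unfolding norm_ell1_def by (rule suminf_le_const) (use assms in auto)

lemma Abs_ell1_bounded_sums:
  assumes "\<And>N. (\<Sum>n<N. norm (f n)) \<le> B"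
  shows "coord (Abs_ell1 f) = f" "norm (Abs_ell1 f) \<le> B"
proof -
  have "summable (\<lambda>n. norm (f n))"
    using assms by (rule summableI_nonneg_bounded[rotated]) simp
  then show 1: "coord (Abs_ell1 f) = f"
    by (simp add: Abs_ell1_inverse)
  show "norm (Abs_ell1 f) \<le> B"
    using assms by (intro norm_ell1_leI) (simp add: 1)
qed

instance ell1 :: (banach) banach
proof
  fix X :: "nat \<Rightarrow> 'a ell1"
  assume X: "Cauchy X"
  have "Cauchy (\<lambda>k. coord (X k) n)" for n
    by (rule bounded_linear.Cauchy[OF bounded_linear_coord X])
  then have "\<forall>n. \<exists>l. (\<lambda>k. coord (X k) n) \<longlonglongrightarrow> l"
    by (simp add: Cauchy_convergent_iff convergent_def)
  then obtain l where l: "\<And>n. (\<lambda>k. coord (X k) n) \<longlonglongrightarrow> l n"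
    by metis
  have close: "(\<Sum>n<N. norm (l n - coord (X k) n)) \<le> e"
    if M: "\<And>m k. m \<ge> M \<Longrightarrow> k \<ge> M \<Longrightarrow> norm (X m - X k) \<le> e" and k: "k \<ge> M" for N k M e
  proof (rule tendsto_upperbound)
    show "(\<lambda>m. \<Sum>n<N. norm (coord (X m) n - coord (X k) n)) \<longlonglongrightarrow> (\<Sum>n<N. norm (l n - coord (X k) n))"
      by (intro tendsto_intros l)
    show "\<forall>\<^sub>F m in sequentially. (\<Sum>n<N. norm (coord (X m) n - coord (X k) n)) \<le> e"
    proof (rule eventually_sequentiallyI)
      fix m assume m: "m \<ge> M"
      have "(\<Sum>n<N. norm (coord (X m) n - coord (X k) n)) \<le> norm (X m - X k)"
        using sum_norm_coord_le[of "{..<N}" "X m - X k"] by simp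
      then show "(\<Sum>n<N. norm (coord (X m) n - coord (X k) n)) \<le> e"
        using M[OF m k] by linarith
    qed
  qed simp
  have cau: "\<exists>M. \<forall>m\<ge>M. \<forall>k\<ge>M. norm (X m - X k) < e" if "e > 0" for e
    using X that by (rule CauchyD)
  obtain M1 where M1: "\<And>m k. m \<ge> M1 \<Longrightarrow> k \<ge> M1 \<Longrightarrow> norm (X m - X k) \<le> 1"
    using cau[of 1] by (auto intro: less_imp_le)
  have "(\<Sum>n<N. norm (l n)) \<le> 1 + norm (X M1)" for N
  proof -
    have "(\<Sum>n<N. norm (l n)) \<le> (\<Sum>n<N. norm (l n - coord (X M1) n) + norm (coord (X M1) n))"
      by (intro sum_mono) (metis diff_add_cancel norm_triangle_ineq)
    also have "\<dots> \<le> 1 + norm (X M1)"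
      using close[of M1 1 M1, OF M1 order_refl] sum_norm_coord_le[of "{..<N}" "X M1"]
      by (simp add: sum.distrib add_mono)
    finally show ?thesis .
  qed
  then have L: "coord (Abs_ell1 l) = l" by (rule Abs_ell1_bounded_sums)
  have "X \<longlonglongrightarrow> Abs_ell1 l"
  proof (rule LIMSEQ_I)
    fix r :: real assume r: "r > 0"
    then obtain M where M: "\<And>m k. m \<ge> M \<Longrightarrow> k \<ge> M \<Longrightarrow> norm (X m - X k) \<le> r / 2"
      using cau[of "r / 2"] by (auto intro: less_imp_le)
    have "norm (Abs_ell1 l - X k) \<le> r / 2" if "k \<ge> M" for k
      using close[of M "r / 2" k, OF M that] by (intro norm_ell1_leI) (simp add: L)
    then show "\<exists>no. \<forall>n\<ge>no. norm (X n - Abs_ell1 l) < r"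
      using r by (intro exI[of _ M]) (smt (verit) field_sum_of_halves norm_minus_commute)
  qed
  then show "convergent X" by (rule convergentI)
qed

lift_definition single :: "nat \<Rightarrow> 'a::real_normed_vector \<Rightarrow> 'a ell1"
  is "\<lambda>b u n. if n = b then u else 0"
proof -
  fix b :: nat and u :: 'a
  show "summable (\<lambda>n. norm (if n = b then u else 0))"
    by (rule summable_finite[of "{b}"]) auto
qed

lemma coord_single: "coord (single b u) n = (if n = b then u else 0)"
  by (simp add: single.rep_eq)

lemma norm_single [simp]: "norm (single b u) = norm u"
  unfolding norm_ell1_def coord_single by (subst suminf_finite[of "{b}"]) auto

lemma bounded_linear_single: "bounded_linear (single b)"
  by (rule bounded_linear_intro[of _ 1]) (auto intro!: ell1_eqI simp: coord_single)

lemma sums_single: "(\<lambda>b. single b (coord x b)) sums x"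
proof -
  have coord_sum: "coord (\<Sum>b<N. single b (coord x b)) n = (if n < N then coord x n else 0)" for N n
    by (induction N) (auto simp: coord_single less_Suc_eq)
  have "(\<lambda>N. norm (x - (\<Sum>b<N. single b (coord x b)))) \<longlonglongrightarrow> 0"
  proof -
    have "norm (x - (\<Sum>b<N. single b (coord x b))) = norm x - (\<Sum>n<N. norm (coord x n))" for N
    proof -
      have "norm (x - (\<Sum>b<N. single b (coord x b))) = (\<Sum>n. norm (coord x (n + N)))"
        unfolding norm_ell1_def
        using summable_norm_coord[of "x - (\<Sum>b<N. single b (coord x b))"]
        by (subst suminf_split_initial_segment[where k = N]) (auto simp: coord_sum)
      also have "\<dots> = norm x - (\<Sum>n<N. norm (coord x n))"
        unfolding norm_ell1_def by (rule suminf_minus_initial_segment) simp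
      finally show ?thesis .
    qed
    moreover have "(\<lambda>N. norm x - (\<Sum>n<N. norm (coord x n))) \<longlonglongrightarrow> norm x - norm x"
      unfolding norm_ell1_def by (intro tendsto_intros summable_LIMSEQ) simp
    ultimately show ?thesis by simp
  qed
  then have "(\<lambda>N. x - (\<Sum>b<N. single b (coord x b))) \<longlonglongrightarrow> 0"
    by (rule tendsto_norm_zero_cancel)
  then have "(\<lambda>N. x - (x - (\<Sum>b<N. single b (coord x b)))) \<longlonglongrightarrow> x - 0"
    by (intro tendsto_intros)
  then show ?thesis by (simp add: sums_def)
qed

text \<open>The norm of an operator on \<open>\<ell>\<^sub>1\<close> is the supremum of the norms of its columns; this is what
  makes \<open>\<ell>\<^sub>1\<close> easier than the other sequence spaces.\<close>

lemma norm_le_of_columns: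
  fixes T :: "'a::real_normed_vector ell1 \<Rightarrow> 'b::real_normed_vector"
  assumes T: "bounded_linear T" and B: "\<And>b u. norm (T (single b u)) \<le> B * norm u"
  shows "norm (T x) \<le> B * norm x"
proof -
  have "(\<lambda>b. T (single b (coord x b))) sums T x"
    using bounded_linear.sums[OF T sums_single] .
  moreover have "(\<lambda>b. B * norm (coord x b)) sums (B * norm x)"
    unfolding norm_ell1_def by (intro sums_mult summable_sums) simp
  moreover have "norm (\<Sum>b<N. T (single b (coord x b))) \<le> (\<Sum>b<N. B * norm (coord x b))" for N
    using B by (intro sum_norm_le)
  ultimately show ?thesis
    unfolding sums_def by (intro LIMSEQ_le[OF tendsto_norm]) auto
qed

lemma ell1_ext:
  fixes S T :: "'a::real_normed_vector ell1 \<Rightarrow> 'b::real_normed_vector"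
  assumes "bounded_linear S" "bounded_linear T" "\<And>b u. S (single b u) = T (single b u)"
  shows "S x = T x"
  using norm_le_of_columns[of "\<lambda>x. S x - T x" 0 x] bounded_linear_sub[OF assms(1,2)] assms(3) by simp

text \<open>The universal property of \<open>\<ell>\<^sub>1\<close>-sums: the operators on \<open>\<ell>\<^sub>1(X)\<close> correspond to the uniformly
  bounded sequences of operators on \<open>X\<close>.\<close>

definition from_columns :: "(nat \<Rightarrow> 'a::real_normed_vector \<Rightarrow> 'b::real_normed_vector) \<Rightarrow> 'a ell1 \<Rightarrow> 'b" where
  "from_columns A x = (\<Sum>b. A b (coord x b))"

context
  fixes A :: "nat \<Rightarrow> 'a::real_normed_vector \<Rightarrow> 'b::banach" and B :: real
  assumes lin: "\<And>b. bounded_linear (A b)" and bound: "\<And>b u. norm (A b u) \<le> B * norm u"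
begin

lemma summable_columns: "summable (\<lambda>b. A b (coord x b))"
  by (rule summable_comparison_test'[where g = "\<lambda>b. B * norm (coord x b)"]) (auto intro: summable_mult bound)

lemma from_columns_single: "from_columns A (single b u) = A b u"
  unfolding from_columns_def coord_single
  by (subst suminf_finite[of "{b}"]) (auto simp: linear_simps[OF lin])

lemma bounded_linear_from_columns: "bounded_linear (from_columns A)"
proof (rule bounded_linear_intro[of _ B])
  show "from_columns A (x + y) = from_columns A x + from_columns A y" for x y
    by (simp add: from_columns_def linear_simps[OF lin] suminf_add summable_columns)
  show "from_columns A (r *\<^sub>R x) = r *\<^sub>R from_columns A x" for r x
    by (simp add: from_columns_def linear_simps[OF lin] suminf_scaleR_right summable_columns)
  show "norm (from_columns A x) \<le> norm x * B" for x
  proof -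
    have s: "summable (\<lambda>b. norm (A b (coord x b)))"
      by (rule summable_comparison_test'[where g = "\<lambda>b. B * norm (coord x b)"]) (auto intro: summable_mult bound)
    have "norm (from_columns A x) \<le> (\<Sum>b. norm (A b (coord x b)))"
      unfolding from_columns_def by (rule summable_norm[OF s])
    also have "\<dots> \<le> (\<Sum>b. B * norm (coord x b))"
      by (intro suminf_le s bound summable_mult) simp
    also have "\<dots> = norm x * B"
      by (simp add: norm_ell1_def suminf_mult)
    finally show ?thesis .
  qed
qed

lemma norm_from_columns_le: "norm (from_columns A x) \<le> B * norm x"
  by (rule norm_le_of_columns[OF bounded_linear_from_columns]) (simp add: from_columns_single bound)

end

section \<open>Bounded operators over the scalar field\<close>

text \<open>\<^const>\<open>bounded_linear\<close> means linear over \<open>\<real>\<close>; the operators of the theorem have to commute with the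
  scalars in \<open>\<real>\<close> or \<open>\<complex>\<close> as well.\<close>

definition kop :: "('k \<Rightarrow> 'a::real_normed_vector \<Rightarrow> 'a) \<Rightarrow> ('k \<Rightarrow> 'b::real_normed_vector \<Rightarrow> 'b) \<Rightarrow>
    ('a \<Rightarrow> 'b) \<Rightarrow> bool" where
  "kop s s' T \<longleftrightarrow> bounded_linear T \<and> (\<forall>c x. T (s c x) = s' c (T x))"

lemma kop_lin: "kop s s' T \<Longrightarrow> bounded_linear T"
  by (simp add: kop_def)

lemma kop_scale: "kop s s' T \<Longrightarrow> T (s c x) = s' c (T x)"
  by (simp add: kop_def)

lemma kop_comp: "kop s' s'' S \<Longrightarrow> kop s s' T \<Longrightarrow> kop s s'' (\<lambda>x. S (T x))"
  by (simp add: kop_def bounded_linear_compose)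

lemma kop_id: "kop s s (\<lambda>x. x)"
  by (simp add: kop_def bounded_linear_ident)

lemma kopI:
  assumes "banach_scaling s" "banach_scaling s'" "\<And>x y. T (x + y) = T x + T y"
    "\<And>c x. T (s c x) = s' c (T x)" "\<And>x. norm (T x) \<le> B * norm x"
  shows "kop s s' T"
  unfolding kop_def
proof (intro conjI allI assms bounded_linear_intro[of _ B])
  show "T (r *\<^sub>R x) = r *\<^sub>R T x" for r x
    using assms(4)[of "of_real r" x] by (simp add: banach_scaling_simps[OF assms(1)] banach_scaling_simps[OF assms(2)])
  show "norm (T x) \<le> norm x * B" for x
    using assms(5)[of x] by (simp add: mult.commute)
qed

lemma kop_zero: "banach_scaling s' \<Longrightarrow> kop s s' (\<lambda>x. 0)"
  by (simp add: kop_def banach_scaling_simps bounded_linear_zero)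

lemma kop_add: "banach_scaling s' \<Longrightarrow> kop s s' S \<Longrightarrow> kop s s' T \<Longrightarrow> kop s s' (\<lambda>x. S x + T x)"
  by (simp add: kop_def bounded_linear_add banach_scaling_simps)

lemma kop_diff: "banach_scaling s' \<Longrightarrow> kop s s' S \<Longrightarrow> kop s s' T \<Longrightarrow> kop s s' (\<lambda>x. S x - T x)"
  by (simp add: kop_def bounded_linear_sub banach_scaling_simps)

lemma scaling_scaleR_commute:
  assumes "banach_scaling s" shows "s c (r *\<^sub>R y) = r *\<^sub>R s c y"
  using banach_scaling_simps(3)[OF assms, of c "of_real r" y]
    banach_scaling_simps(3)[OF assms, of "of_real r" c y]
  by (simp add: banach_scaling_simps(5)[OF assms] mult.commute)

lemma bounded_linear_scaling: "banach_scaling s \<Longrightarrow> bounded_linear (s c)"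
  by (rule bounded_linear_intro[of _ "norm c"])
    (simp_all add: banach_scaling_simps(1,6) scaling_scaleR_commute)

lemma kop_scaleR:
  assumes "banach_scaling s'" "kop s s' T"
  shows "kop s s' (\<lambda>x. r *\<^sub>R T x)"
proof -
  have "r *\<^sub>R s' c y = s' c (r *\<^sub>R y)" for c y
    by (simp add: scaling_scaleR_commute[OF assms(1)])
  then show ?thesis
    using assms(2) by (simp add: kop_def bounded_linear_const_scaleR)
qed

text \<open>The case distinction is needed because \<open>s\<close> is arbitrary here; when the norm is homogeneous
  for \<open>s\<close>, the first case always applies.\<close>

lift_definition lscale :: "('k \<Rightarrow> 'a::real_normed_vector \<Rightarrow> 'a) \<Rightarrow> 'k \<Rightarrow> 'a ell1 \<Rightarrow> 'a ell1"
  is "\<lambda>s c x. if summable (\<lambda>n. norm (s c (x n))) then (\<lambda>n. s c (x n)) else (\<lambda>_. 0)"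
  by auto

lemma coord_lscale:
  assumes "banach_scaling s" shows "coord (lscale s c x) n = s c (coord x n)"
proof -
  have "summable (\<lambda>n. norm (s c (coord x n)))"
    using assms by (simp add: banach_scaling_simps summable_mult)
  then show ?thesis by (simp add: lscale.rep_eq)
qed

lemma banach_scaling_lscale:
  assumes s: "banach_scaling s" shows "banach_scaling (lscale s)"
proof -
  note b = banach_scaling_simps[OF s]
  show ?thesis
    unfolding banach_scaling_def
  proof (intro conjI allI)
    show "vector_space (lscale s)"
      by standard (auto intro!: ell1_eqI simp: coord_lscale[OF s] b)
    show "lscale s (of_real r) x = r *\<^sub>R x" for r x
      by (rule ell1_eqI) (simp add: coord_lscale[OF s] b)
    show "norm (lscale s c x) = norm c * norm x" for c x
      by (simp add: norm_ell1_def coord_lscale[OF s] b suminf_mult)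
  qed
qed

lemma lscale_single: "banach_scaling s \<Longrightarrow> lscale s c (single b u) = single b (s c u)"
  by (rule ell1_eqI) (simp add: coord_lscale coord_single banach_scaling_simps)

lemma kop_single: "banach_scaling s \<Longrightarrow> kop s (lscale s) (single b)"
  by (simp add: kop_def bounded_linear_single lscale_single)

lemma kop_coord: "banach_scaling s \<Longrightarrow> kop (lscale s) s (\<lambda>x. coord x b)"
  by (simp add: kop_def bounded_linear_coord coord_lscale)

lemma kop_from_columns:
  fixes s :: "'k::real_or_complex \<Rightarrow> 'a::banach \<Rightarrow> 'a" and s' :: "'k \<Rightarrow> 'b::banach \<Rightarrow> 'b"
  assumes s: "banach_scaling s" "banach_scaling s'" and A: "\<And>b. kop s s' (A b)"
    and bound: "\<And>b u. norm (A b u) \<le> B * norm u"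
  shows "kop (lscale s) s' (from_columns A)"
proof -
  have lin: "bounded_linear (A b)" for b using A by (rule kop_lin)
  note fc = bounded_linear_from_columns[of A B, OF lin bound] from_columns_single[of A B, OF lin bound]
  show ?thesis
    unfolding kop_def
  proof (intro conjI allI fc)
    fix c x
    note 1 = bounded_linear_scaling
    have l: "bounded_linear (\<lambda>x. from_columns A (lscale s c x))"
      by (rule bounded_linear_compose[OF fc(1) bounded_linear_scaling[OF banach_scaling_lscale[OF s(1)]]])
    have r: "bounded_linear (\<lambda>x. s' c (from_columns A x))"
      by (rule bounded_linear_compose[OF bounded_linear_scaling[OF s(2)] fc(1)])
    show "from_columns A (lscale s c x) = s' c (from_columns A x)"
      by (rule ell1_ext[OF l r]) (simp add: lscale_single[OF s(1)] fc(2) kop_scale[OF A])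
  qed
qed

text \<open>Unlike columns, rows of uniformly bounded norm need not define an operator into \<open>\<ell>\<^sub>1(X)\<close>; the sums
  over the rows have to be bounded.\<close>

lemma kop_from_rows:
  fixes s :: "'k::real_or_complex \<Rightarrow> 'a::banach \<Rightarrow> 'a" and s' :: "'k \<Rightarrow> 'b::banach \<Rightarrow> 'b"
  assumes s: "banach_scaling s" "banach_scaling s'" and h: "\<And>a. kop s s' (h a)"
    and bound: "\<And>N y. (\<Sum>a<N. norm (h a y)) \<le> K * norm y"
  shows "kop s (lscale s') (\<lambda>y. Abs_ell1 (\<lambda>a. h a y))" "norm (Abs_ell1 (\<lambda>a. h a y)) \<le> K * norm y"
    "coord (Abs_ell1 (\<lambda>a. h a y)) a = h a y"
proof -
  define R where "R y = Abs_ell1 (\<lambda>a. h a y)" for y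
  have c: "coord (R y) a = h a y" for a y
    unfolding R_def by (simp add: Abs_ell1_bounded_sums(1)[OF bound])
  have le: "norm (R y) \<le> K * norm y" for y
    unfolding R_def by (rule Abs_ell1_bounded_sums(2)[OF bound])
  have "kop s (lscale s') R"
    by (rule kopI[OF s(1) banach_scaling_lscale[OF s(2)] _ _ le]; rule ell1_eqI)
      (simp_all add: c coord_lscale[OF s(2)] kop_scale[OF h] linear_simps(1)[OF kop_lin[OF h]])
  then show "kop s (lscale s') (\<lambda>y. Abs_ell1 (\<lambda>a. h a y))" "norm (Abs_ell1 (\<lambda>a. h a y)) \<le> K * norm y"
    "coord (Abs_ell1 (\<lambda>a. h a y)) a = h a y"
    using c le by (simp_all flip: R_def)
qed

text \<open>A Neumann series argument, with the inverse obtained from Banach's fixed point theorem: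
  \<open>z\<close> solves \<open>z + E z = y\<close> if and only if it is the fixed point of the contraction \<open>z \<mapsto> y - E z\<close>.\<close>

lemma near_identity_invertible:
  fixes Q :: "'b::banach \<Rightarrow> 'b"
  assumes s: "banach_scaling s" and Q: "kop s s Q" and close: "\<And>x. norm (Q x - x) \<le> norm x / 2"
  shows "\<exists>N. kop s s N \<and> (\<forall>x. N (Q x) = x) \<and> (\<forall>x. Q (N x) = x) \<and> (\<forall>x. norm (N x) \<le> 2 * norm x)"
proof -
  note lin = linear_simps[OF kop_lin[OF Q]]
  have uniq: "\<exists>!z. y - (Q z - z) = z" for y
  proof (rule banach_fix_type[of "1/2"])
    have "dist (y - (Q u - u)) (y - (Q v - v)) \<le> 1 / 2 * dist u v" for u v
    proof -
      have "dist (y - (Q u - u)) (y - (Q v - v)) = norm (Q (v - u) - (v - u))"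
        by (simp add: dist_norm lin algebra_simps)
      also have "\<dots> \<le> norm (v - u) / 2"
        by (rule close)
      finally show ?thesis
        by (simp add: dist_norm norm_minus_commute)
    qed
    then show "\<forall>u v. dist (y - (Q u - u)) (y - (Q v - v)) \<le> 1 / 2 * dist u v"
      by blast
  qed auto
  have inj: "u = v" if "Q u = Q v" for u v
    using close[of "u - v"] that by (simp add: lin norm_minus_commute[of v u])
  have "\<forall>y. \<exists>z. Q z = y"
    using uniq by (metis add.commute add_diff_cancel diff_add_cancel diff_diff_eq2)
  then obtain N where N: "\<And>y. Q (N y) = y" by metis
  have NQ: "N (Q x) = x" for x using inj N by blast
  have bound: "norm (N y) \<le> 2 * norm y" for y
    using close[of "N y"] norm_triangle_ineq2[of "N y" y] unfolding N
    by (simp add: norm_minus_commute)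
  have "kop s s N"
  proof (rule kopI[OF s s _ _ bound])
    show "N (x + y) = N x + N y" for x y
      by (rule inj) (simp add: N lin)
    show "N (s c x) = s c (N x)" for c x
      by (rule inj) (simp add: N kop_scale[OF Q])
  qed
  then show ?thesis using NQ N bound by blast
qed

section \<open>Operators into \<open>\<ell>\<^sub>1\<close>-sums and complemented copies of \<open>\<ell>\<^sub>1\<close>\<close>

lift_definition part :: "nat set \<Rightarrow> 'a::real_normed_vector ell1 \<Rightarrow> 'a ell1"
  is "\<lambda>A x n. if n \<in> A then x n else 0"
  by (erule summable_comparison_test'[where N = 0]) simp

lemma coord_part: "coord (part A x) n = (if n \<in> A then coord x n else 0)"
  by (simp add: part.rep_eq)

lemma norm_part_mono: "A \<subseteq> B \<Longrightarrow> norm (part A x) \<le> norm (part B x)"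
  unfolding norm_ell1_def by (intro suminf_le summable_norm_coord) (auto simp: coord_part)

lemma norm_part_le: "norm (part A x) \<le> norm x"
  unfolding norm_ell1_def by (intro suminf_le summable_norm_coord) (auto simp: coord_part)

lemma norm_part_Un_disjoint:
  assumes "A \<inter> B = {}"
  shows "norm (part (A \<union> B) x) = norm (part A x) + norm (part B x)"
proof -
  have "norm (coord (part (A \<union> B) x) n) = norm (coord (part A x) n) + norm (coord (part B x) n)" for n
    using assms by (auto simp: coord_part)
  then show ?thesis
    unfolding norm_ell1_def by (simp add: suminf_add)
qed

lemma sum_norm_part_le:
  fixes A :: "nat \<Rightarrow> nat set"
  assumes "\<And>k l. k < l \<Longrightarrow> A k \<inter> A l = {}" "\<And>k. A k \<subseteq> B"
  shows "(\<Sum>k<N. norm (part (A k) x)) \<le> norm (part B x)"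
proof -
  have "(\<Sum>k<N. norm (part (A k) x)) = norm (part (\<Union>k<N. A k) x)"
  proof (induction N)
    case 0
    have "part {} x = 0" by (rule ell1_eqI) (simp add: coord_part)
    then show ?case by simp
  next
    case (Suc N)
    have "A N \<inter> (\<Union>k<N. A k) = {}" using assms(1) by blast
    then show ?case
      using norm_part_Un_disjoint[of "A N" "\<Union>k<N. A k" x] Suc by (simp add: lessThan_Suc)
  qed
  also have "\<dots> \<le> norm (part B x)"
    using assms(2) by (intro norm_part_mono) blast
  finally show ?thesis .
qed

lemma kop_part: "banach_scaling s \<Longrightarrow> kop (lscale s) (lscale s) (part A)"
  by (rule kopI[of _ _ _ 1])
    (auto intro!: banach_scaling_lscale ell1_eqI norm_part_le simp: coord_part coord_lscale banach_scaling_simps)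

lemma norm_tail_tendsto_0: "(\<lambda>n. norm (part {n..} x)) \<longlonglongrightarrow> 0"
proof -
  have "norm (part {n..} x) = norm x - (\<Sum>i<n. norm (coord x i))" for n
  proof -
    have "norm (part {n..} x) = (\<Sum>i. norm (coord (part {n..} x) (i + n))) + (\<Sum>i<n. norm (coord (part {n..} x) i))"
      unfolding norm_ell1_def by (rule suminf_split_initial_segment) simp
    also have "\<dots> = (\<Sum>i. norm (coord x (i + n)))"
      by (simp add: coord_part)
    also have "\<dots> = norm x - (\<Sum>i<n. norm (coord x i))"
      unfolding norm_ell1_def by (rule suminf_minus_initial_segment) simp
    finally show ?thesis .
  qed
  moreover have "(\<lambda>n. norm x - (\<Sum>i<n. norm (coord x i))) \<longlonglongrightarrow> norm x - norm x"
    unfolding norm_ell1_def by (intro tendsto_intros summable_LIMSEQ) simp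
  ultimately show ?thesis by simp
qed

lemma banach_scaling_mult: "banach_scaling ((*) :: 'k::real_or_complex \<Rightarrow> 'k \<Rightarrow> 'k)"
  unfolding banach_scaling_def
proof (intro conjI allI)
  show "vector_space ((*) :: 'k \<Rightarrow> 'k \<Rightarrow> 'k)"
    by standard (auto simp: algebra_simps)
qed (simp_all add: norm_mult scaleR_conv_of_real)

text \<open>The gliding hump argument. If the tails of \<open>S\<close> do not tend to \<open>0\<close> in norm, let \<open>\<rho>\<close> be the
  limit of their norms. Unit vectors \<open>x\<^sub>k\<close> can be chosen such that \<open>S x\<^sub>k\<close> has, beyond a fixed index,
  mass close to \<open>\<rho>\<close>, nearly all of it in a block \<open>A\<^sub>k\<close> of coordinates, with successive blocks.
  Mapping the unit vectors of \<open>\<ell>\<^sub>1\<close> to the \<open>x\<^sub>k\<close>, and norming the blocks by functionals, gives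
  operators \<open>\<ell>\<^sub>1 \<rightarrow> X \<rightarrow> \<ell>\<^sub>1\<close> whose composition is a small perturbation of \<open>\<rho>\<close> times the
  identity, so that \<open>X\<close> contains a complemented copy of \<open>\<ell>\<^sub>1\<close>. It is because \<open>\<rho>\<close> is the limit that
  little mass can lie outside the block.\<close>

lemma tails_uniformly_small:
  fixes s :: "'k::real_or_complex \<Rightarrow> 'a::banach \<Rightarrow> 'a" and s' :: "'k \<Rightarrow> 'b::banach \<Rightarrow> 'b"
  assumes s: "banach_scaling s" "banach_scaling s'" and S: "kop s (lscale s') S"
    and no_l1: "\<nexists>R A. kop s (lscale (*)) R \<and> kop (lscale (*)) s A \<and> (\<forall>c :: 'k ell1. R (A c) = c)"
    and e: "e > 0"
  shows "\<exists>n. \<forall>x. norm (part {n..} (S x)) \<le> e * norm x"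
proof (rule ccontr)
  assume contra: "\<nexists>n. \<forall>x. norm (part {n..} (S x)) \<le> e * norm x"
  note sl = banach_scaling_lscale[OF s(2)]
  define T where "T n x = part {n..} (S x)" for n x
  have T: "kop s (lscale s') (T n)" for n
    unfolding T_def by (rule kop_comp[OF kop_part[OF s(2)] S])
  define q where "q n = onorm (T n)" for n
  have q: "norm (T n x) \<le> q n * norm x" for n x
    unfolding q_def using onorm[OF kop_lin[OF T]] by blast
  have q_ge: "q n \<ge> e" for n
  proof (rule ccontr)
    assume "\<not> q n \<ge> e"
    then have "norm (T n x) \<le> e * norm x" for x
      using q[of n x] by (smt (verit) mult_right_mono norm_ge_zero)
    then show False using contra unfolding T_def by blast
  qed
  define \<rho> where "\<rho> = (INF n. q n)"
  have bdd: "bdd_below (range q)" using q_ge by (intro bdd_belowI2)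
  have \<rho>: "\<rho> > 0"
    using e q_ge by (intro less_le_trans[OF e]) (auto simp: \<rho>_def intro: cINF_greatest)
  obtain n0 where n0: "q n0 \<le> (11/10) * \<rho>"
  proof -
    have "(INF n. q n) < (11/10) * \<rho>" using \<rho> unfolding \<rho>_def by simp
    then show ?thesis
      using that bdd by (subst (asm) cINF_less_iff) (auto intro: less_imp_le)
  qed
  have large: "\<exists>x. norm x \<le> 1 \<and> norm (T n x) \<ge> (9/10) * \<rho>" for n
  proof (rule ccontr)
    assume neg: "\<nexists>x. norm x \<le> 1 \<and> norm (T n x) \<ge> (9/10) * \<rho>"
    have "norm (T n x) \<le> (9/10) * \<rho> * norm x" for x
    proof (cases "x = 0")
      case True then show ?thesis by (simp add: linear_simps[OF kop_lin[OF T]])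
    next
      case False
      then have "norm ((1 / norm x) *\<^sub>R x) \<le> 1"
        by simp
      then have "norm (T n ((1 / norm x) *\<^sub>R x)) < (9/10) * \<rho>"
        using neg by (meson not_le)
      then show ?thesis using False by (simp add: linear_simps[OF kop_lin[OF T]] field_simps)
    qed
    then have "q n \<le> (9/10) * \<rho>"
      unfolding q_def using \<rho> by (intro onorm_bound) auto
    moreover have "\<rho> \<le> q n" unfolding \<rho>_def by (rule cINF_lower[OF bdd]) simp
    ultimately show False using \<rho> by linarith
  qed
  have small: "\<exists>m>n. norm (T m x) \<le> (1/10) * \<rho>" for n x
  proof -
    have "\<forall>\<^sub>F m in sequentially. norm (T m x) < (1/10) * \<rho>"
      unfolding T_def by (rule order_tendstoD[OF norm_tail_tendsto_0]) (use \<rho> in simp)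
    then have "\<forall>\<^sub>F m in sequentially. norm (T m x) < (1/10) * \<rho> \<and> m > n"
      by (intro eventually_conj eventually_gt_at_top)
    then obtain m where "norm (T m x) < (1/10) * \<rho>" "m > n"
      using eventually_happens'[OF sequentially_bot] by blast
    then show ?thesis by (auto intro: less_imp_le)
  qed
  define P where "P p \<longleftrightarrow> fst p \<ge> n0 \<and> norm (snd p) \<le> 1 \<and> norm (T (fst p) (snd p)) \<ge> (9/10) * \<rho>"
    for p
  define G where "G p p' \<longleftrightarrow> fst p < fst p' \<and> norm (T (fst p') (snd p)) \<le> (1/10) * \<rho>"
    for p p' :: "nat \<times> 'a"
  have "\<exists>F. \<forall>k. P (F k) \<and> G (F k) (F (Suc k))"
  proof (rule dependent_nat_choice)
    show "\<exists>p. P p"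
      using large[of n0] by (auto simp: P_def)
    fix p k assume p: "P p"
    obtain m where m: "m > fst p" "norm (T m (snd p)) \<le> (1/10) * \<rho>" using small by blast
    obtain x where x: "norm x \<le> 1" "norm (T m x) \<ge> (9/10) * \<rho>" using large by blast
    show "\<exists>p'. P p' \<and> G p p'"
      using p m x by (intro exI[of _ "(m, x)"]) (auto simp: P_def G_def)
  qed
  then obtain F where PG: "\<forall>k. P (F k) \<and> G (F k) (F (Suc k))" ..
  then have F: "P (F k)" "G (F k) (F (Suc k))" for k by simp_all
  define n where "n k = fst (F k)" for k
  define x where "x k = snd (F k)" for k
  have n: "n k < n (Suc k)" "n k \<ge> n0" for k using F by (auto simp: n_def P_def G_def)
  have x: "norm (x k) \<le> 1" "norm (T (n k) (x k)) \<ge> (9/10) * \<rho>" "norm (T (n (Suc k)) (x k)) \<le> (1/10) * \<rho>" for k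
    using F by (auto simp: n_def x_def P_def G_def)
  have "strict_mono n"
    unfolding strict_mono_Suc_iff using n(1) by blast
  then have n_mono: "n k \<le> n l" if "k \<le> l" for k l
    using that by (simp add: strict_mono_less_eq)
  define A where "A k = {n k..<n (Suc k)}" for k
  have disj: "A k \<inter> A l = {}" if "k < l" for k l
    using n_mono[of "Suc k" l] that by (auto simp: A_def)
  have sub: "A k \<subseteq> {n0..}" for k using n(2)[of k] by (auto simp: A_def)
  define b where "b j k = norm (part (A k) (S (x j)))" for j k
  \<comment> \<open>The block itself carries at least \<open>8/10 \<rho>\<close> of a total of at most \<open>11/10 \<rho>\<close>. So the diagonal entries
    below deviate from \<open>\<rho>\<close> by at most \<open>2/10 \<rho>\<close>, and the other entries of a column add up to at most
    \<open>3/10 \<rho>\<close>.\<close>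
  have b_total: "(\<Sum>k<N. b j k) \<le> (11/10) * \<rho>" for j N
  proof -
    have "(\<Sum>k<N. b j k) \<le> norm (T n0 (x j))"
      unfolding b_def T_def by (rule sum_norm_part_le[OF disj sub])
    also have "\<dots> \<le> q n0 * norm (x j)" by (rule q)
    also have "\<dots> \<le> (11/10) * \<rho> * 1" using n0 x(1) \<rho> by (intro mult_mono) auto
    finally show ?thesis by simp
  qed
  have b_diag: "b j j \<ge> (8/10) * \<rho>" for j
  proof -
    have "A j \<union> {n (Suc j)..} = {n j..}" "A j \<inter> {n (Suc j)..} = {}"
      using n(1)[of j] by (auto simp: A_def)
    then have "norm (T (n j) (x j)) = b j j + norm (T (n (Suc j)) (x j))"
      unfolding b_def T_def by (metis norm_part_Un_disjoint)
    then show ?thesis using x(2)[of j] x(3)[of j] by linarith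
  qed
  have b_nonneg: "b j k \<ge> 0" for j k by (simp add: b_def)
  have "\<forall>k. \<exists>h :: 'b ell1 \<Rightarrow> 'k. (\<forall>x y. h (x + y) = h x + h y) \<and> (\<forall>c x. h (lscale s' c x) = c * h x) \<and>
      (\<forall>x. norm (h x) \<le> norm x) \<and> h (part (A k) (S (x k))) = of_real (b k k)"
    using norming_functional[OF sl] unfolding b_def by metis
  then obtain h :: "nat \<Rightarrow> 'b ell1 \<Rightarrow> 'k" where h: "\<And>k x y. h k (x + y) = h k x + h k y"
      "\<And>k c x. h k (lscale s' c x) = c * h k x" "\<And>k x. norm (h k x) \<le> norm x"
      "\<And>k. h k (part (A k) (S (x k))) = of_real (b k k)"
    by metis
  define R where "R y = Abs_ell1 (\<lambda>k. h k (part (A k) (S y)))" for y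
  obtain K where K: "\<And>y. norm (S y) \<le> K * norm y"
    using bounded_linear.bounded[OF kop_lin[OF S]] by (metis mult.commute)
  have R_bound: "(\<Sum>k<N. norm (h k (part (A k) (S y)))) \<le> K * norm y" for y N
  proof -
    have "(\<Sum>k<N. norm (h k (part (A k) (S y)))) \<le> (\<Sum>k<N. norm (part (A k) (S y)))"
      by (intro sum_mono h)
    also have "\<dots> \<le> norm (part {n0..} (S y))" by (rule sum_norm_part_le[OF disj sub])
    also have "\<dots> \<le> K * norm y" using norm_part_le K by (rule order_trans)
    finally show ?thesis .
  qed
  have row: "kop s (*) (\<lambda>y. h k (part (A k) (S y)))" for k
    by (rule kop_comp[OF _ kop_comp[OF kop_part[OF s(2)] S]], rule kopI[OF sl banach_scaling_mult, of _ 1])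
      (simp_all add: h)
  have R: "kop s (lscale (*)) R" and coord_R: "coord (R y) k = h k (part (A k) (S y))" for y k
    unfolding R_def by (rule kop_from_rows[OF s(1) banach_scaling_mult row R_bound])+
  have col: "kop (*) s (\<lambda>c. s c (x j))" for j
    by (rule kopI[OF banach_scaling_mult s(1), where B = "norm (x j)"])
      (simp_all add: banach_scaling_simps[OF s(1)])
  have col_le: "norm (s c (x j)) \<le> 1 * norm c" for c j
    using x(1)[of j] by (simp add: banach_scaling_simps[OF s(1)] mult_left_le)
  define E where "E = from_columns (\<lambda>j c. s c (x j))"
  have E: "kop (lscale (*)) s E"
    unfolding E_def by (rule kop_from_columns[OF banach_scaling_mult s(1) col col_le])
  have E_single: "E (single j c) = s c (x j)" for j c
    unfolding E_def by (rule from_columns_single[OF kop_lin[OF col] col_le])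
  define Q where "Q y = (1 / \<rho>) *\<^sub>R R (E y)" for y
  have Q: "kop (lscale (*)) (lscale (*)) Q"
    unfolding Q_def
    by (rule kop_scaleR[OF banach_scaling_lscale[OF banach_scaling_mult] kop_comp[OF R E]])
  have "norm (Q y - y) \<le> (1/2) * norm y" for y
  proof (rule norm_le_of_columns[where T = "\<lambda>y. Q y - y"])
    show "bounded_linear (\<lambda>y. Q y - y)"
      by (intro bounded_linear_sub bounded_linear_ident kop_lin[OF Q])
    fix j c
    have cQ: "coord (Q (single j c)) k = (1 / \<rho>) *\<^sub>R (c * h k (part (A k) (S (x j))))" for k
      by (simp add: Q_def E_single coord_R kop_scale[OF S] kop_scale[OF kop_part[OF s(2)]] h)
    define t where "t k = (if k = j then \<bar>b j j - \<rho>\<bar> else b j k)" for k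
    have entry: "norm (coord (Q (single j c) - single j c) k) \<le> norm c / \<rho> * t k" for k
    proof (cases "k = j")
      case True
      have "(1 / \<rho>) *\<^sub>R (c * of_real (b j j)) - c = ((b j j - \<rho>) / \<rho>) *\<^sub>R c"
        using \<rho> by (simp add: scaleR_conv_of_real field_simps)
      then show ?thesis
        using True \<rho> by (simp add: cQ coord_single t_def h(4) mult.commute)
    next
      case False
      have "norm (c * h k (part (A k) (S (x j)))) \<le> norm c * b j k"
        unfolding norm_mult b_def by (intro mult_left_mono h) simp
      then show ?thesis
        using False \<rho> by (simp add: cQ coord_single t_def divide_right_mono)
    qed
    have tsum: "(\<Sum>k<N. t k) \<le> \<rho> / 2" for N
    proof -
      define M where "M = max N (Suc j)"
      have "(\<Sum>k<N. t k) \<le> (\<Sum>k<M. t k)"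
        by (intro sum_mono2) (auto simp: M_def t_def b_nonneg)
      also have "\<dots> = \<bar>b j j - \<rho>\<bar> + (\<Sum>k\<in>{..<M}-{j}. b j k)"
        by (subst sum.remove[of _ j]) (auto simp: M_def t_def)
      also have "(\<Sum>k\<in>{..<M}-{j}. b j k) = (\<Sum>k<M. b j k) - b j j"
        by (subst sum.remove[of _ j]) (auto simp: M_def)
      also have "\<bar>b j j - \<rho>\<bar> + ((\<Sum>k<M. b j k) - b j j) \<le> \<rho> / 2"
      proof -
        have "b j j \<le> (\<Sum>k<M. b j k)"
          by (rule member_le_sum) (auto simp: M_def b_nonneg)
        then show ?thesis
          using b_total[of j M] b_diag[of j] by linarith
      qed
      finally show ?thesis .
    qed
    show "norm (Q (single j c) - single j c) \<le> 1 / 2 * norm c"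
    proof (rule norm_ell1_leI)
      fix N
      have "(\<Sum>k<N. norm (coord (Q (single j c) - single j c) k)) \<le> norm c / \<rho> * (\<Sum>k<N. t k)"
        unfolding sum_distrib_left by (intro sum_mono entry)
      also have "\<dots> \<le> norm c / \<rho> * (\<rho> / 2)"
        using \<rho> by (intro mult_left_mono tsum) auto
      finally show "(\<Sum>k<N. norm (coord (Q (single j c) - single j c) k)) \<le> 1 / 2 * norm c"
        using \<rho> by simp
    qed
  qed
  then have "norm (Q y - y) \<le> norm y / 2" for y by simp
  from near_identity_invertible[OF banach_scaling_lscale[OF banach_scaling_mult] Q this]
  obtain N where "kop (lscale (*)) (lscale (*)) N \<and> (\<forall>y. N (Q y) = y) \<and> (\<forall>y. Q (N y) = y) \<and>
      (\<forall>y. norm (N y) \<le> 2 * norm y)" ..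
  then have N: "kop (lscale (*)) (lscale (*)) N" "N (Q y) = y" for y by simp_all
  have NR: "kop s (lscale (*)) (\<lambda>y. N ((1 / \<rho>) *\<^sub>R R y))"
    by (rule kop_comp[OF N(1) kop_scaleR[OF banach_scaling_lscale[OF banach_scaling_mult] R]])
  have "\<forall>c. N ((1 / \<rho>) *\<^sub>R R (E c)) = c"
    using N(2) unfolding Q_def by simp
  with NR E have "\<exists>R A. kop s (lscale (*)) R \<and> kop (lscale (*)) s A \<and> (\<forall>c :: 'k ell1. R (A c) = c)"
    by (intro exI conjI)
  with no_l1 show False by (rule notE)
qed

section \<open>Splitting a space isomorphic to its own sequence space\<close>

text \<open>A supply of complemented copies of \<open>X\<close> in \<open>X\<close>: each pair consists of an embedding \<open>W\<close> and a left
  inverse \<open>Z\<close>. Two features matter. Passing to a copy inside a copy any number of times does not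
  worsen the bound \<open>D\<close>. And if the joint operator \<open>x \<mapsto> (S\<^sub>i x)\<^sub>i\<close> into \<open>\<ell>\<^sub>1\<close>-sums is bounded by \<open>C\<close>, then
  one of the first \<open>n\<close> of the \<open>S\<^sub>i\<close> is small on some copy, where \<open>n\<close> depends only on \<open>C\<close> and \<open>\<delta>\<close>.\<close>

definition splitting_family :: "('k \<Rightarrow> 'a::banach \<Rightarrow> 'a) \<Rightarrow> real \<Rightarrow> (('a \<Rightarrow> 'a) \<times> ('a \<Rightarrow> 'a)) set \<Rightarrow> bool" where
  "splitting_family s D \<G> \<longleftrightarrow>
     ((\<lambda>x. x), (\<lambda>x. x)) \<in> \<G> \<and>
     (\<forall>W Z W' Z'. (W, Z) \<in> \<G> \<longrightarrow> (W', Z') \<in> \<G> \<longrightarrow> ((\<lambda>x. W (W' x)), (\<lambda>x. Z' (Z x))) \<in> \<G>) \<and>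
     (\<forall>W Z. (W, Z) \<in> \<G> \<longrightarrow> kop s s W \<and> kop s s Z \<and> (\<forall>x. Z (W x) = x) \<and>
        (\<forall>x. norm (W x) \<le> D * norm x) \<and> (\<forall>x. norm (Z x) \<le> D * norm x)) \<and>
     (\<forall>C \<delta>. \<delta> > 0 \<longrightarrow> (\<exists>n. \<forall>S :: nat \<Rightarrow> 'a \<Rightarrow> 'a.
        (\<forall>i. bounded_linear (S i)) \<longrightarrow> (\<forall>x. (\<Sum>i<n. norm (S i x)) \<le> C * norm x) \<longrightarrow>
        (\<exists>i<n. \<exists>W Z. (W, Z) \<in> \<G> \<and> (\<forall>x. norm (S i (W x)) \<le> \<delta> * norm x))))"

text \<open>Averaging over all choices of signs: for fixed \<open>i\<close>, flipping all signs except the \<open>i\<close>th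
  pairs up the sign vectors so that the two sums in a pair add up to \<open>\<plusminus>2 x\<^sub>i\<close>.\<close>

lemma exists_signs_sum_norm_ge:
  fixes S :: "nat \<Rightarrow> 'a::real_normed_vector \<Rightarrow> 'b::real_normed_vector"
  assumes S: "\<And>i. bounded_linear (S i)"
  obtains \<epsilon> :: "nat \<Rightarrow> real" where "\<And>k. \<bar>\<epsilon> k\<bar> = 1"
    "(\<Sum>i<n. norm (S i (x i))) \<le> (\<Sum>i<n. norm (S i (\<Sum>k<n. \<epsilon> k *\<^sub>R x k)))"
proof -
  define e :: "nat set \<Rightarrow> nat \<Rightarrow> real" where "e A k = (if k \<in> A then 1 else - 1)" for A k
  define v where "v A = (\<Sum>k<n. e A k *\<^sub>R x k)" for A
  have avg: "2 ^ n * norm (S i (x i)) \<le> (\<Sum>A\<in>Pow {..<n}. norm (S i (v A)))" if i: "i < n" for i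
  proof -
    define f where "f A = (if i \<in> A then insert i ({..<n} - A) else ({..<n} - A) - {i})" for A
    have "f (f A) = A" "f A \<in> Pow {..<n}" if "A \<in> Pow {..<n}" for A
      using that i by (auto simp: f_def)
    then have bij: "bij_betw f (Pow {..<n}) (Pow {..<n})"
      by (intro bij_betw_byWitness[where f' = f]) auto
    have "2 * norm (S i (x i)) \<le> norm (S i (v A)) + norm (S i (v (f A)))" for A
    proof -
      have "e A k + e (f A) k = (if k = i then 2 * e A i else 0)" if "k < n" for k
        using that i by (auto simp: e_def f_def)
      then have "v A + v (f A) = (\<Sum>k<n. (if k = i then 2 * e A i else 0) *\<^sub>R x k)"
        unfolding v_def by (simp flip: sum.distrib scaleR_add_left)
      also have "\<dots> = (\<Sum>k<n. if k = i then (2 * e A i) *\<^sub>R x i else 0)"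
        by (rule sum.cong) auto
      also have "\<dots> = (2 * e A i) *\<^sub>R x i"
        using i by simp
      finally have "S i (v A) + S i (v (f A)) = (2 * e A i) *\<^sub>R S i (x i)"
        by (metis linear_simps(1,5)[OF S])
      moreover have "norm ((2 * e A i) *\<^sub>R S i (x i)) = 2 * norm (S i (x i))"
        by (simp add: e_def)
      ultimately show ?thesis by (metis norm_triangle_ineq)
    qed
    then have "(\<Sum>A\<in>Pow {..<n}. 2 * norm (S i (x i))) \<le> (\<Sum>A\<in>Pow {..<n}. norm (S i (v A)) + norm (S i (v (f A))))"
      by (rule sum_mono)
    also have "\<dots> = 2 * (\<Sum>A\<in>Pow {..<n}. norm (S i (v A)))"
      using sum.reindex_bij_betw[OF bij, of "\<lambda>A. norm (S i (v A))"] by (simp add: sum.distrib)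
    finally show ?thesis by (simp add: card_Pow)
  qed
  have "\<exists>A\<in>Pow {..<n}. (\<Sum>i<n. norm (S i (x i))) \<le> (\<Sum>i<n. norm (S i (v A)))"
  proof (rule ccontr)
    assume "\<not> ?thesis"
    then have "(\<Sum>A\<in>Pow {..<n}. \<Sum>i<n. norm (S i (v A))) < (\<Sum>A\<in>Pow {..<n}. \<Sum>i<n. norm (S i (x i)))"
      by - (rule sum_strict_mono, auto simp: not_le)
    also have "\<dots> = (\<Sum>i<n. 2 ^ n * norm (S i (x i)))"
      by (simp add: card_Pow sum_distrib_left)
    also have "\<dots> \<le> (\<Sum>i<n. \<Sum>A\<in>Pow {..<n}. norm (S i (v A)))"
      by (intro sum_mono avg) simp
    finally show False
      by (simp add: sum.swap[of _ "Pow {..<n}"])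
  qed
  then obtain A where "(\<Sum>i<n. norm (S i (x i))) \<le> (\<Sum>i<n. norm (S i (v A)))" by blast
  then show ?thesis
    using that[of "e A"] by (simp add: e_def v_def)
qed

definition spread :: "(nat \<Rightarrow> nat) \<Rightarrow> (nat \<Rightarrow> 'a::zero) \<Rightarrow> nat \<Rightarrow> 'a" where
  "spread g y m = (if m \<in> range g then y (inv g m) else 0)"

definition interleave :: "nat \<Rightarrow> (nat \<Rightarrow> nat \<Rightarrow> 'a) \<Rightarrow> nat \<Rightarrow> 'a" where
  "interleave n x m = x (m mod n) (m div n)"

lemma spread_image: "strict_mono g \<Longrightarrow> spread g y (g k) = y k"
  by (simp add: spread_def inv_f_f strict_mono_imp_inj_on)

lemma spread_cases: "strict_mono g \<Longrightarrow> (\<exists>k. m = g k \<and> spread g y m = y k) \<or> (m \<notin> range g \<and> spread g y m = 0)"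
  by (auto simp: spread_image) (auto simp: spread_def)

lemma spread_comp_self: "strict_mono g \<Longrightarrow> spread g y \<circ> g = y"
  by (auto simp: spread_image)

lemma spread_spread:
  assumes "strict_mono f" "strict_mono g"
  shows "spread f (spread g y) = spread (f \<circ> g) y"
proof
  fix m
  have fg: "strict_mono (f \<circ> g)" using assms by (rule strict_mono_o)
  show "spread f (spread g y) m = spread (f \<circ> g) y m"
  proof (cases "m \<in> range f")
    case True
    then obtain j where m: "m = f j" by blast
    have range: "f j \<in> range (f \<circ> g) \<longleftrightarrow> j \<in> range g"
      using assms(1) by (auto simp: strict_mono_eq)
    show ?thesis
    proof (cases "j \<in> range g")
      case True
      then obtain k where "j = g k" by blast
      then show ?thesis
        using spread_image[OF fg, of y k] by (simp add: m spread_image[OF assms(1)] spread_image[OF assms(2)])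
    next
      case False
      then show ?thesis
        using range by (simp add: m spread_image[OF assms(1)]) (simp add: spread_def)
    qed
  next
    case False
    then have "m \<notin> range (f \<circ> g)" by auto
    with False show ?thesis by (simp add: spread_def)
  qed
qed

lemma strict_mono_residue_class: "n > 0 \<Longrightarrow> strict_mono (\<lambda>k::nat. n * k + i)"
  by (rule strict_monoI) simp

lemma interleave_eq_sum_spread:
  fixes x :: "nat \<Rightarrow> nat \<Rightarrow> 'a::comm_monoid_add"
  assumes "n > 0"
  shows "interleave n x m = (\<Sum>i<n. spread (\<lambda>k. n * k + i) (x i) m)"
proof -
  have "spread (\<lambda>k. n * k + i) (x i) m = (if i = m mod n then x i (m div n) else 0)" if "i < n" for i
  proof (cases "i = m mod n")
    case True
    then have "m = n * (m div n) + i" by simp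
    then show ?thesis
      using True spread_image[OF strict_mono_residue_class[OF assms, of i], of "x i" "m div n"] by simp
  next
    case False
    then have "m \<notin> range (\<lambda>k. n * k + i)" using that by auto
    then show ?thesis using False by (simp add: spread_def)
  qed
  then show ?thesis
    using assms by (simp add: interleave_def)
qed

text \<open>What \<open>c\<^sub>0(X)\<close> and the spaces \<open>\<ell>\<^sub>p(X)\<close> for \<open>p > 1\<close> have in common: sequences can be moved to
  and cut down to subsequences of the index set, and the norm of a sum of \<open>n\<close> disjointly supported
  vectors of the unit ball is of order \<open>o(n)\<close>. The last property fails for \<open>p = 1\<close>.\<close>

definition sublinear_disjoint_sums ::
  "('k \<Rightarrow> 'a::banach \<Rightarrow> 'a) \<Rightarrow> ('k, nat \<Rightarrow> 'a) nspace \<Rightarrow> bool" where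
  "sublinear_disjoint_sums s E \<longleftrightarrow>
     (\<forall>c y. smult E c y = (\<lambda>m. s c (y m))) \<and>
     (\<forall>y\<in>carrier E. nrm E y \<ge> 0) \<and>
     (\<forall>g. strict_mono g \<longrightarrow> (\<forall>y\<in>carrier E. spread g y \<in> carrier E \<and> nrm E (spread g y) \<le> nrm E y)) \<and>
     (\<forall>g. strict_mono g \<longrightarrow> (\<forall>y\<in>carrier E. y \<circ> g \<in> carrier E \<and> nrm E (y \<circ> g) \<le> nrm E y)) \<and>
     (\<exists>\<phi> :: nat \<Rightarrow> real. (\<forall>n B x. n > 0 \<longrightarrow> (\<forall>i. x i \<in> carrier E \<and> nrm E (x i) \<le> B) \<longrightarrow>
         interleave n x \<in> carrier E \<and> nrm E (interleave n x) \<le> \<phi> n * B) \<and>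
       (\<lambda>n. \<phi> n / real n) \<longlonglongrightarrow> 0)"

lemma sublinear_disjoint_sumsI:
  assumes "\<And>c y. smult E c y = (\<lambda>m. s c (y m))" "\<And>y. y \<in> carrier E \<Longrightarrow> nrm E y \<ge> 0"
    and "\<And>g y. strict_mono g \<Longrightarrow> y \<in> carrier E \<Longrightarrow> spread g y \<in> carrier E \<and> nrm E (spread g y) \<le> nrm E y"
    and "\<And>g y. strict_mono g \<Longrightarrow> y \<in> carrier E \<Longrightarrow> y \<circ> g \<in> carrier E \<and> nrm E (y \<circ> g) \<le> nrm E y"
    and il: "\<And>n x B. n > 0 \<Longrightarrow> (\<And>i. x i \<in> carrier E \<and> nrm E (x i) \<le> B) \<Longrightarrow>
      interleave n x \<in> carrier E \<and> nrm E (interleave n x) \<le> \<phi> n * B"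
    and lim: "(\<lambda>n. \<phi> n / real n) \<longlonglongrightarrow> 0"
  shows "sublinear_disjoint_sums s E"
  unfolding sublinear_disjoint_sums_def
proof (intro conjI)
  show "\<exists>\<phi> :: nat \<Rightarrow> real. (\<forall>n B x. n > 0 \<longrightarrow> (\<forall>i. x i \<in> carrier E \<and> nrm E (x i) \<le> B) \<longrightarrow>
         interleave n x \<in> carrier E \<and> nrm E (interleave n x) \<le> \<phi> n * B) \<and>
       (\<lambda>n. \<phi> n / real n) \<longlonglongrightarrow> 0"
    by (rule exI[of _ \<phi>], rule conjI[OF _ lim], intro allI impI il) simp_all
qed (use assms(1-4) in simp_all)

lemma SUP_norm_le:
  fixes z :: "nat \<Rightarrow> 'a::real_normed_vector"
  assumes "\<And>m. norm (z m) \<le> B" shows "(SUP m. norm (z m)) \<le> B"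
  using assms by (intro cSUP_least) auto

lemma norm_le_SUP:
  fixes z :: "nat \<Rightarrow> 'a::real_normed_vector"
  assumes "bounded (range (\<lambda>m. norm (z m)))" shows "norm (z m) \<le> (SUP m. norm (z m))"
  using assms by (intro cSUP_upper bounded_imp_bdd_above) auto

lemma bounded_range_norm_iff:
  fixes z :: "nat \<Rightarrow> 'a::real_normed_vector"
  shows "bounded (range (\<lambda>m. norm (z m))) \<longleftrightarrow> (\<exists>B. \<forall>m. norm (z m) \<le> B)"
  by (auto simp: bounded_iff)

text \<open>The argument common to \<open>\<ell>\<^sub>\<infinity>(X)\<close> and \<open>c\<^sub>0(X)\<close>, which differ only in the carrier \<open>M\<close>.\<close>

lemma sublinear_disjoint_sums_sup:
  fixes M :: "(nat \<Rightarrow> 'a::banach) set"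
  assumes bdd: "\<And>y. y \<in> M \<Longrightarrow> bounded (range (\<lambda>m. norm (y m)))"
    and M: "\<And>g y. strict_mono g \<Longrightarrow> y \<in> M \<Longrightarrow> spread g y \<in> M"
      "\<And>g y. strict_mono g \<Longrightarrow> y \<in> M \<Longrightarrow> y \<circ> g \<in> M"
      "\<And>n x B. n > 0 \<Longrightarrow> (\<And>i. x i \<in> M) \<Longrightarrow> (\<And>i m. norm (x i m) \<le> B) \<Longrightarrow> interleave n x \<in> M"
    and E: "E = \<lparr>carrier = M, smult = (\<lambda>c x n. s c (x n)), nrm = (\<lambda>x. SUP n. norm (x n))\<rparr>"
  shows "sublinear_disjoint_sums s E"
proof -
  note up = norm_le_SUP[OF bdd]
  have nn: "0 \<le> (SUP n. norm (y n))" if "y \<in> M" for y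
    using up[OF that, of 0] norm_ge_zero order_trans by blast
  have sp: "(SUP n. norm (spread g y n)) \<le> (SUP n. norm (y n))" if "strict_mono g" "y \<in> M" for g y
  proof (rule SUP_norm_le)
    show "norm (spread g y m) \<le> (SUP n. norm (y n))" for m
      using up[OF that(2)] nn[OF that(2)] by (simp add: spread_def)
  qed
  have re: "(SUP n. norm ((y \<circ> g) n)) \<le> (SUP n. norm (y n))" if "y \<in> M" for y and g :: "nat \<Rightarrow> nat"
    by (rule SUP_norm_le) (simp add: up[OF that])
  have il: "interleave n x \<in> M \<and> (SUP m. norm (interleave n x m)) \<le> 1 * B"
    if "n > 0" "\<And>i. x i \<in> M \<and> (SUP m. norm (x i m)) \<le> B" for n B and x :: "nat \<Rightarrow> nat \<Rightarrow> 'a"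
  proof
    have le: "norm (x i m) \<le> B" for i m
      using up[of "x i" m] that(2)[of i] by linarith
    then show "interleave n x \<in> M" using that by (intro M(3)[of n x B]) auto
    show "(SUP m. norm (interleave n x m)) \<le> 1 * B"
      unfolding interleave_def using le by (intro SUP_norm_le) simp
  qed
  show ?thesis
  proof (rule sublinear_disjoint_sumsI[of _ _ "\<lambda>_. 1"])
    show "(\<lambda>n. 1 / real n) \<longlonglongrightarrow> 0" by (rule lim_1_over_n)
    show "interleave n x \<in> carrier E \<and> nrm E (interleave n x) \<le> 1 * B"
      if "n > 0" "\<And>i. x i \<in> carrier E \<and> nrm E (x i) \<le> B" for n x B
      using il[of n x B] that by (simp add: E)
    show "y \<circ> g \<in> carrier E \<and> nrm E (y \<circ> g) \<le> nrm E y" if "strict_mono g" "y \<in> carrier E" for g y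
      using M(2)[of g y] re[of y g] that by (simp add: E)
  qed (use nn M(1) sp in \<open>simp_all add: E\<close>)
qed

lemma sublinear_disjoint_sums_linf:
  "sublinear_disjoint_sums s (lp \<infinity> (whole_space s) :: ('k, nat \<Rightarrow> 'a::banach) nspace)"
proof (rule sublinear_disjoint_sums_sup)
  show "lp \<infinity> (whole_space s) = \<lparr>carrier = {y. bounded (range (\<lambda>m. norm (y m :: 'a)))},
      smult = (\<lambda>c x n. s c (x n)), nrm = (\<lambda>x. SUP n. norm (x n))\<rparr>"
    by (simp add: lp_def whole_space_def)
  show "spread g y \<in> {y. bounded (range (\<lambda>m. norm (y m)))}"
    if y: "y \<in> {y. bounded (range (\<lambda>m. norm (y m)))}" for g and y :: "nat \<Rightarrow> 'a"
  proof -
    obtain B where B: "\<And>m. norm (y m) \<le> B"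
      using y by (auto simp: bounded_range_norm_iff)
    then have "0 \<le> B" using norm_ge_zero order_trans by blast
    then have "norm (spread g y m) \<le> B" for m using B by (simp add: spread_def)
    then show ?thesis by (auto simp: bounded_range_norm_iff)
  qed
  show "interleave n x \<in> {y. bounded (range (\<lambda>m. norm (y m)))}"
    if "\<And>i m. norm (x i m) \<le> B" for n B and x :: "nat \<Rightarrow> nat \<Rightarrow> 'a"
    using that by (auto simp: bounded_range_norm_iff interleave_def)
qed (auto simp: bounded_range_norm_iff)

lemma sublinear_disjoint_sums_c0:
  "sublinear_disjoint_sums s (c0 (whole_space s) :: ('k, nat \<Rightarrow> 'a::banach) nspace)"
proof (rule sublinear_disjoint_sums_sup)
  show "c0 (whole_space s) = \<lparr>carrier = {y. (\<lambda>m. norm (y m :: 'a)) \<longlonglongrightarrow> 0},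
      smult = (\<lambda>c x n. s c (x n)), nrm = (\<lambda>x. SUP n. norm (x n))\<rparr>"
    by (simp add: c0_def whole_space_def)
  fix y :: "nat \<Rightarrow> 'a" assume "y \<in> {y. (\<lambda>m. norm (y m)) \<longlonglongrightarrow> 0}"
  then have y: "(\<lambda>m. norm (y m)) \<longlonglongrightarrow> 0" by simp
  then show "bounded (range (\<lambda>m. norm (y m)))"
    by (rule convergent_imp_bounded)
  fix g :: "nat \<Rightarrow> nat" assume g: "strict_mono g"
  show "y \<circ> g \<in> {y. (\<lambda>m. norm (y m)) \<longlonglongrightarrow> 0}"
    using LIMSEQ_subseq_LIMSEQ[OF y g] by (simp add: comp_def)
  have "\<exists>N. \<forall>m\<ge>N. norm (spread g y m) < r" if r: "r > 0" for r
  proof -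
    obtain N where N: "\<And>k. k \<ge> N \<Longrightarrow> norm (y k) < r"
      using LIMSEQ_D[OF y r] by auto
    have "norm (spread g y m) < r" if "m \<ge> g N" for m
      using spread_cases[OF g, of m y] N that r by (auto simp: strict_mono_less_eq[OF g])
    then show ?thesis by blast
  qed
  then show "spread g y \<in> {y. (\<lambda>m. norm (y m)) \<longlonglongrightarrow> 0}"
    by (auto intro!: LIMSEQ_I)
next
  fix n :: nat and x :: "nat \<Rightarrow> nat \<Rightarrow> 'a"
  assume n: "n > 0" and x: "\<And>i. x i \<in> {y. (\<lambda>m. norm (y m)) \<longlonglongrightarrow> 0}"
  have "\<exists>N. \<forall>m\<ge>N. norm (interleave n x m) < r" if r: "r > 0" for r
  proof -
    have "\<forall>\<^sub>F k in sequentially. \<forall>i\<in>{..<n}. norm (x i k) < r"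
      using x r by (intro eventually_ball_finite) (auto dest: order_tendstoD(2))
    then obtain N where N: "\<And>k i. k \<ge> N \<Longrightarrow> i < n \<Longrightarrow> norm (x i k) < r"
      unfolding eventually_sequentially by auto
    have "norm (interleave n x m) < r" if "m \<ge> n * N" for m
      unfolding interleave_def using n that
      by (intro N) (auto simp: less_eq_div_iff_mult_less_eq mult.commute)
    then show ?thesis by blast
  qed
  then show "interleave n x \<in> {y. (\<lambda>m. norm (y m)) \<longlonglongrightarrow> 0}"
    by (auto intro!: LIMSEQ_I)
qed

text \<open>The \<open>p\<close>th powers of the norms of disjointly supported vectors add up, so \<open>n\<close> unit vectors have a
  sum of norm \<open>n\<close> to the power \<open>1/p\<close>.\<close>

lemma sublinear_disjoint_sums_lp:
  fixes s :: "'k \<Rightarrow> 'a::banach \<Rightarrow> 'a" and p :: real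
  assumes p: "p > 1"
  shows "sublinear_disjoint_sums s (lp (ereal p) (whole_space s))"
proof -
  define P where "P y = (\<lambda>m. norm (y m) powr p)" for y :: "nat \<Rightarrow> 'a"
  define M where "M = {y. summable (P y)}"
  define nr where "nr y = (\<Sum>m. P y m) powr (1 / p)" for y
  have E: "lp (ereal p) (whole_space s) = \<lparr>carrier = M, smult = (\<lambda>c x n. s c (x n)), nrm = nr\<rparr>"
    by (simp add: lp_def whole_space_def P_def M_def nr_def fun_eq_iff)
  have P0: "P y m \<ge> 0" for y m by (simp add: P_def)
  have mono: "nr y \<le> nr z" if "suminf (P y) \<le> suminf (P z)" "y \<in> M" for y z
    unfolding nr_def using p that by (intro powr_mono2 suminf_nonneg) (auto simp: P0 M_def)
  have P_spread: "P (spread g y) m = spread g (P y) m" for g y m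
    by (simp add: P_def spread_def)
  have sp: "P (spread g y) sums c" if g: "strict_mono g" and "P y sums c" for g y c
  proof -
    have "(\<lambda>k. P (spread g y) (g k)) sums c \<longleftrightarrow> P (spread g y) sums c"
      by (rule sums_mono_reindex[OF g]) (simp add: P_def spread_def)
    then show ?thesis using that by (simp add: P_spread spread_image)
  qed
  have spread: "spread g y \<in> M \<and> nr (spread g y) \<le> nr y" if g: "strict_mono g" and "y \<in> M" for g y
  proof -
    have "P (spread g y) sums suminf (P y)"
      using that by (intro sp) (auto simp: M_def intro: summable_sums)
    then show ?thesis by (auto simp: M_def nr_def sums_iff)
  qed
  have restrict: "y \<circ> g \<in> M \<and> nr (y \<circ> g) \<le> nr y" if g: "strict_mono g" and y: "y \<in> M" for g y
  proof -
    define z where "z m = (if m \<in> range g then P y m else 0)" for m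
    have z: "summable z"
      by (rule summable_comparison_test'[of "P y" 0 z, rotated]) (use y in \<open>simp_all add: M_def z_def P0\<close>)
    have "z sums suminf z" using z by (rule summable_sums)
    moreover have "(\<lambda>k. z (g k)) sums c \<longleftrightarrow> z sums c" for c
      by (rule sums_mono_reindex[OF g]) (simp add: z_def)
    ultimately have "P (y \<circ> g) sums suminf z"
      by (simp add: z_def P_def)
    then have "y \<circ> g \<in> M" "suminf (P (y \<circ> g)) = suminf z"
      by (simp_all add: M_def sums_iff)
    moreover have "suminf z \<le> suminf (P y)"
      using y by (intro suminf_le z) (auto simp: z_def P0 M_def)
    ultimately show ?thesis
      using mono[of "y \<circ> g" y] by simp
  qed
  have inter: "interleave n x \<in> M \<and> nr (interleave n x) \<le> real n powr (1 / p) * B"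
    if n: "n > 0" and x: "\<And>i. x i \<in> M \<and> nr (x i) \<le> B" for n B and x :: "nat \<Rightarrow> nat \<Rightarrow> 'a"
  proof -
    have B: "B \<ge> 0" using x[of 0] by (auto simp: nr_def intro: order_trans[OF powr_ge_zero])
    have le: "suminf (P (x i)) \<le> B powr p" for i
    proof -
      have "suminf (P (x i)) = nr (x i) powr p"
        using p x[of i] by (simp add: nr_def powr_powr suminf_nonneg P0 M_def)
      also have "\<dots> \<le> B powr p" using p x[of i] by (intro powr_mono2) (auto simp: nr_def)
      finally show ?thesis .
    qed
    have "P (interleave n x) m = interleave n (\<lambda>i. P (x i)) m" for m
      by (simp add: P_def interleave_def)
    also have "interleave n (\<lambda>i. P (x i)) m = (\<Sum>i<n. P (spread (\<lambda>k. n * k + i) (x i)) m)" for m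
      by (simp add: interleave_eq_sum_spread[OF n] P_spread)
    finally have "P (interleave n x) = (\<lambda>m. \<Sum>i<n. P (spread (\<lambda>k. n * k + i) (x i)) m)" by blast
    moreover have "(\<lambda>m. \<Sum>i<n. P (spread (\<lambda>k. n * k + i) (x i)) m) sums (\<Sum>i<n. suminf (P (x i)))"
      using x by (intro sums_sum sp strict_mono_residue_class n) (auto simp: M_def intro: summable_sums)
    ultimately have sums: "P (interleave n x) sums (\<Sum>i<n. suminf (P (x i)))" by simp
    have "nr (interleave n x) = (\<Sum>i<n. suminf (P (x i))) powr (1 / p)"
      using sums by (simp add: nr_def sums_iff)
    also have "\<dots> \<le> (real n * B powr p) powr (1 / p)"
      using p le x sum_bounded_above[of "{..<n}" "\<lambda>i. suminf (P (x i))" "B powr p"]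
      by (intro powr_mono2 sum_nonneg suminf_nonneg) (auto simp: P0 M_def)
    also have "\<dots> = real n powr (1 / p) * B"
      using p B by (simp add: powr_mult powr_powr)
    finally show ?thesis using sums by (auto simp: M_def sums_iff)
  qed
  have lim: "(\<lambda>n. real n powr (1 / p) / real n) \<longlonglongrightarrow> 0"
  proof -
    have "(\<lambda>n. real n powr (1 / p - 1)) \<longlonglongrightarrow> 0"
      using p by (intro tendsto_neg_powr filterlim_real_sequentially) simp
    then show ?thesis
    proof (rule Lim_transform_eventually)
      show "\<forall>\<^sub>F n in sequentially. real n powr (1 / p - 1) = real n powr (1 / p) / real n"
        using eventually_gt_at_top[of "0::nat"] by eventually_elim (simp add: powr_diff)
    qed
  qed
  show ?thesis
  proof (rule sublinear_disjoint_sumsI[of _ _ "\<lambda>n. real n powr (1 / p)"])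
    show "interleave n x \<in> carrier (lp (ereal p) (whole_space s)) \<and>
        nrm (lp (ereal p) (whole_space s)) (interleave n x) \<le> real n powr (1 / p) * B"
      if "n > 0" "\<And>i. x i \<in> carrier (lp (ereal p) (whole_space s)) \<and> nrm (lp (ereal p) (whole_space s)) (x i) \<le> B"
      for n x B
      using inter[of n x B] that by (simp add: E)
  qed (use spread restrict lim in \<open>simp_all add: E nr_def\<close>)
qed

lemma spread_add:
  fixes y z :: "nat \<Rightarrow> 'a::monoid_add"
  shows "spread g (y + z) = spread g y + spread g z"
  by (simp add: fun_eq_iff spread_def)

lemma interleave_step:
  fixes y :: "nat \<Rightarrow> nat \<Rightarrow> 'a::comm_monoid_add"
  assumes "j < n"
  shows "interleave n (\<lambda>k. if k < Suc j then y k else 0) =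
    interleave n (\<lambda>k. if k < j then y k else 0) + spread (\<lambda>k. n * k + j) (y j)"
proof
  fix m
  have n: "n > 0" using assms by simp
  have zero: "spread (\<lambda>k. n * k + i) 0 m = (0::'a)" for i by (simp add: spread_def)
  have "spread (\<lambda>k. n * k + i) (if i < Suc j then y i else 0) m =
      spread (\<lambda>k. n * k + i) (if i < j then y i else 0) m +
      (if i = j then spread (\<lambda>k. n * k + j) (y j) m else 0)" for i
    by (cases "i < j"; cases "i = j") (simp_all add: zero)
  then show "interleave n (\<lambda>k. if k < Suc j then y k else 0) m =
      (interleave n (\<lambda>k. if k < j then y k else 0) + spread (\<lambda>k. n * k + j) (y j)) m"
    using assms by (simp add: interleave_eq_sum_spread[OF n] sum.distrib)
qed

text \<open>The splitting family consists of the copies of \<open>X\<close> on subsequences of the index set of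
  \<open>E\<close>. For the smallness property cut \<open>\<nat>\<close> into the residue classes modulo \<open>n\<close> and restrict
  \<open>S i\<close> to the \<open>i\<close>th class. If every restriction had norm above \<open>\<delta>\<close>, then a suitable signed sum of
  \<open>n\<close> unit vectors, one from each class, would have norm \<open>o(n)\<close> but an image of mass at least \<open>n \<delta>\<close>.\<close>

lemma splitting_family_of_isomorphic:
  fixes s :: "'k::real_or_complex \<Rightarrow> 'a::banach \<Rightarrow> 'a"
  assumes s: "banach_scaling s" and E: "sublinear_disjoint_sums s E"
    and iso: "isomorphic (whole_space s) E"
  shows "\<exists>D \<G>. D > 0 \<and> splitting_family s D \<G>"
proof -
  note bs = banach_scaling_simps[OF s]
  obtain \<Phi> \<Psi> where op: "operator (whole_space s) E \<Phi>" "operator E (whole_space s) \<Psi>"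
    and inv: "\<And>x. \<Psi> (\<Phi> x) = x" "\<And>y. y \<in> carrier E \<Longrightarrow> \<Phi> (\<Psi> y) = y"
    using iso unfolding isomorphic_def by (auto simp: whole_space_def)
  have E1: "smult E c y = (\<lambda>m. s c (y m))" and E2: "y \<in> carrier E \<Longrightarrow> nrm E y \<ge> 0"
    and E3: "strict_mono g \<Longrightarrow> y \<in> carrier E \<Longrightarrow> spread g y \<in> carrier E \<and> nrm E (spread g y) \<le> nrm E y"
    and E4: "strict_mono g \<Longrightarrow> y \<in> carrier E \<Longrightarrow> y \<circ> g \<in> carrier E \<and> nrm E (y \<circ> g) \<le> nrm E y"
    for c y g
    using E unfolding sublinear_disjoint_sums_def by blast+
  have "\<exists>\<phi> :: nat \<Rightarrow> real. (\<forall>n B x. n > 0 \<longrightarrow> (\<forall>i. x i \<in> carrier E \<and> nrm E (x i) \<le> B) \<longrightarrow>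
         interleave n x \<in> carrier E \<and> nrm E (interleave n x) \<le> \<phi> n * B) \<and>
       (\<lambda>n. \<phi> n / real n) \<longlonglongrightarrow> 0"
    using E unfolding sublinear_disjoint_sums_def by (elim conjE)
  then obtain \<phi> :: "nat \<Rightarrow> real" where \<phi>all: "\<forall>n B x. n > 0 \<longrightarrow> (\<forall>i. x i \<in> carrier E \<and> nrm E (x i) \<le> B) \<longrightarrow>
      interleave n x \<in> carrier E \<and> nrm E (interleave n x) \<le> \<phi> n * B"
    and \<phi>lim: "(\<lambda>n. \<phi> n / real n) \<longlonglongrightarrow> 0"
    by (elim exE conjE)
  have E5: "interleave n x \<in> carrier E \<and> nrm E (interleave n x) \<le> \<phi> n * B"
    if "n > 0" "\<And>i. x i \<in> carrier E" "\<And>i. nrm E (x i) \<le> B" for n B x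
    using \<phi>all that by blast
  have \<Phi>c: "\<Phi> x \<in> carrier E" and \<Phi>a: "\<Phi> (x + x') = \<Phi> x + \<Phi> x'" and \<Phi>s: "\<Phi> (s c x) = (\<lambda>m. s c (\<Phi> x m))"
    for x x' c
    using op(1) by (simp_all add: operator_def whole_space_def E1)
  have \<Psi>a: "\<Psi> (y + y') = \<Psi> y + \<Psi> y'" and \<Psi>s: "\<Psi> (\<lambda>m. s c (y m)) = s c (\<Psi> y)"
    if "y \<in> carrier E" "y' \<in> carrier E" for y y' c
    using op(2) that by (simp_all add: operator_def whole_space_def flip: E1)
  obtain b\<^sub>1 where b1: "b\<^sub>1 > 0" "\<And>x. nrm E (\<Phi> x) \<le> b\<^sub>1 * norm x"
  proof -
    obtain B where "\<And>x. nrm E (\<Phi> x) \<le> B * norm x"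
      using op(1) by (auto simp: operator_def whole_space_def)
    then have "nrm E (\<Phi> x) \<le> (\<bar>B\<bar> + 1) * norm x" for x
      by (smt (verit) mult_right_mono norm_ge_zero)
    then show ?thesis by (intro that[of "\<bar>B\<bar> + 1"]) auto
  qed
  obtain b\<^sub>2 where b2: "b\<^sub>2 > 0" "\<And>y. y \<in> carrier E \<Longrightarrow> norm (\<Psi> y) \<le> b\<^sub>2 * nrm E y"
  proof -
    obtain B where B: "\<forall>y\<in>carrier E. norm (\<Psi> y) \<le> B * nrm E y"
      using op(2) by (auto simp: operator_def whole_space_def)
    have "norm (\<Psi> y) \<le> (\<bar>B\<bar> + 1) * nrm E y" if y: "y \<in> carrier E" for y
    proof -
      have "norm (\<Psi> y) \<le> B * nrm E y" using B y by blast
      also have "\<dots> \<le> (\<bar>B\<bar> + 1) * nrm E y" by (intro mult_right_mono E2 y) simp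
      finally show ?thesis .
    qed
    then show ?thesis by (intro that[of "\<bar>B\<bar> + 1"]) auto
  qed
  have \<Phi>0: "\<Phi> 0 = 0" using \<Phi>a[of 0 0] by simp
  define D where "D = b\<^sub>2 * b\<^sub>1"
  have bound: "norm (\<Psi> y) \<le> D * norm x" if "y \<in> carrier E" "nrm E y \<le> nrm E (\<Phi> x)" for x y
  proof -
    have "norm (\<Psi> y) \<le> b\<^sub>2 * nrm E y" by (rule b2(2)[OF that(1)])
    also have "\<dots> \<le> b\<^sub>2 * (b\<^sub>1 * norm x)"
      using that(2) b1(2)[of x] b2(1) by (intro mult_left_mono) auto
    finally show ?thesis by (simp add: D_def)
  qed
  define W where "W g x = \<Psi> (spread g (\<Phi> x))" for g x
  define Z where "Z g x = \<Psi> (\<Phi> x \<circ> g)" for g x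
  have W: "kop s s (W g)" and W_le: "norm (W g x) \<le> D * norm x" if g: "strict_mono g" for g x
  proof -
    note c = E3[OF g \<Phi>c, THEN conjunct1]
    show le: "norm (W g x) \<le> D * norm x" for x
      unfolding W_def using E3[OF g \<Phi>c] by (intro bound) auto
    show "kop s s (W g)"
    proof (rule kopI[OF s s _ _ le])
      show "W g (x + x') = W g x + W g x'" for x x'
        by (simp add: W_def \<Phi>a spread_add \<Psi>a[OF c c])
      have "spread g (\<lambda>m. s c (y m)) = (\<lambda>m. s c (spread g y m))" for c y
        by (simp add: fun_eq_iff spread_def bs)
      then show "W g (s c x) = s c (W g x)" for c x
        by (simp add: W_def \<Phi>s \<Psi>s[OF E3[OF g \<Phi>c, THEN conjunct1] E3[OF g \<Phi>c, THEN conjunct1]])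
    qed
  qed
  have Z: "kop s s (Z g)" and Z_le: "norm (Z g x) \<le> D * norm x" if g: "strict_mono g" for g x
  proof -
    note c = E4[OF g \<Phi>c, THEN conjunct1]
    show le: "norm (Z g x) \<le> D * norm x" for x
      unfolding Z_def using E4[OF g \<Phi>c] by (intro bound) auto
    show "kop s s (Z g)"
    proof (rule kopI[OF s s _ _ le])
      have "(y + z) \<circ> g = (y \<circ> g) + (z \<circ> g)" for y z :: "nat \<Rightarrow> 'a"
        by (simp add: fun_eq_iff)
      then show "Z g (x + x') = Z g x + Z g x'" for x x'
        by (simp add: Z_def \<Phi>a \<Psi>a[OF c c])
      have "(\<lambda>m. s c (y m)) \<circ> g = (\<lambda>m. s c ((y \<circ> g) m))" for c y
        by (simp add: fun_eq_iff)
      then show "Z g (s c x) = s c (Z g x)" for c x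
        using \<Psi>s[OF E4[OF g \<Phi>c, THEN conjunct1] E4[OF g \<Phi>c, THEN conjunct1]] by (simp add: Z_def \<Phi>s)
    qed
  qed
  have ZW: "Z g (W g x) = x" if "strict_mono g" for g x
    using E3[OF that \<Phi>c] by (simp add: Z_def W_def inv spread_comp_self[OF that])
  have WW: "W f (W g x) = W (f \<circ> g) x" if "strict_mono f" "strict_mono g" for f g x
    using E3[OF that(2) \<Phi>c] by (simp add: W_def inv spread_spread[OF that])
  have ZZ: "Z g (Z f x) = Z (f \<circ> g) x" if "strict_mono f" for f g x
    using E4[OF that \<Phi>c] by (simp add: Z_def inv comp_assoc)
  have small: "\<exists>n. \<forall>S :: nat \<Rightarrow> 'a \<Rightarrow> 'a. (\<forall>i. bounded_linear (S i)) \<longrightarrow>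
      (\<forall>x. (\<Sum>i<n. norm (S i x)) \<le> C * norm x) \<longrightarrow>
      (\<exists>i<n. \<exists>g. strict_mono g \<and> (\<forall>x. norm (S i (W g x)) \<le> \<delta> * norm x))" if \<delta>: "\<delta> > 0" for C \<delta>
  proof -
    define K where "K = \<bar>C\<bar> * D"
    have "(\<lambda>n. K * (\<phi> n / real n)) \<longlonglongrightarrow> K * 0" by (intro tendsto_intros \<phi>lim)
    then have "\<forall>\<^sub>F n in sequentially. K * (\<phi> n / real n) < \<delta>"
      using \<delta> by (auto intro: order_tendstoD)
    then have "\<forall>\<^sub>F n in sequentially. K * (\<phi> n / real n) < \<delta> \<and> n > 0"
      by (intro eventually_conj eventually_gt_at_top)
    then obtain n where n: "K * (\<phi> n / real n) < \<delta>" "n > 0"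
      using eventually_happens'[OF sequentially_bot] by blast
    have "\<exists>i<n. \<exists>g. strict_mono g \<and> (\<forall>x. norm (S i (W g x)) \<le> \<delta> * norm x)"
      if S: "\<And>i. bounded_linear (S i)" and sum: "\<And>x. (\<Sum>i<n. norm (S i x)) \<le> C * norm x"
      for S :: "nat \<Rightarrow> 'a \<Rightarrow> 'a"
    proof (rule ccontr)
      assume neg: "\<not> (\<exists>i<n. \<exists>g. strict_mono g \<and> (\<forall>x. norm (S i (W g x)) \<le> \<delta> * norm x))"
      define g where "g i k = n * k + i" for i k :: nat
      have g: "strict_mono (g i)" for i
        unfolding g_def by (rule strict_mono_residue_class[OF n(2)])
      have "\<exists>x. norm x \<le> 1 \<and> (i < n \<longrightarrow> norm (S i (W (g i) x)) \<ge> \<delta>)" for i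
      proof (cases "i < n")
        case True
        then obtain x where x: "norm (S i (W (g i) x)) > \<delta> * norm x"
          using neg g[of i] by (meson not_le)
        have "x \<noteq> 0"
          using x by (auto simp: linear_simps[OF kop_lin[OF W[OF g]]] linear_simps[OF S])
        then have "norm (S i (W (g i) ((1 / norm x) *\<^sub>R x))) \<ge> \<delta>"
          using x by (simp add: linear_simps[OF kop_lin[OF W[OF g]]] linear_simps[OF S] field_simps)
        moreover have "norm ((1 / norm x) *\<^sub>R x) \<le> 1" by simp
        ultimately show ?thesis by blast
      qed (auto intro: exI[of _ 0])
      then obtain x where x: "\<And>i. norm (x i) \<le> 1" "\<And>i. i < n \<Longrightarrow> norm (S i (W (g i) (x i))) \<ge> \<delta>"
        by metis
      obtain \<epsilon> :: "nat \<Rightarrow> real" where \<epsilon>: "\<And>k. \<bar>\<epsilon> k\<bar> = 1"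
        "(\<Sum>i<n. norm (S i (W (g i) (x i)))) \<le> (\<Sum>i<n. norm (S i (\<Sum>k<n. \<epsilon> k *\<^sub>R W (g k) (x k))))"
        using exists_signs_sum_norm_ge[of S "\<lambda>i. W (g i) (x i)" n, OF S] by blast
      define y where "y k = \<Phi> (\<epsilon> k *\<^sub>R x k)" for k
      have y: "y k \<in> carrier E" for k by (simp add: y_def \<Phi>c)
      have y_le: "nrm E (y k) \<le> b\<^sub>1" for k
      proof -
        have "nrm E (y k) \<le> b\<^sub>1 * norm (\<epsilon> k *\<^sub>R x k)" unfolding y_def by (rule b1(2))
        also have "\<dots> \<le> b\<^sub>1 * 1" using b1(1) x(1)[of k] by (intro mult_left_mono) (simp_all add: \<epsilon>)
        finally show ?thesis by simp
      qed
      have zero: "0 \<in> carrier E" "nrm E 0 \<le> b\<^sub>1"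
        using \<Phi>c[of 0] b1(1) b1(2)[of 0] by (auto simp: \<Phi>0)
      have part: "\<Psi> (interleave n (\<lambda>k. if k < j then y k else 0)) = (\<Sum>k<j. \<Psi> (spread (g k) (y k)))"
        if "j \<le> n" for j
        using that
      proof (induction j)
        case 0
        have eq: "interleave n (\<lambda>k. if k < 0 then y k else 0) = \<Phi> 0"
          by (simp add: \<Phi>0 fun_eq_iff interleave_def)
        show ?case unfolding eq inv by simp
      next
        case (Suc j)
        have il: "interleave n (\<lambda>k. if k < j then y k else 0) \<in> carrier E"
          using E5[of n "\<lambda>k. if k < j then y k else 0" b\<^sub>1] n(2) y y_le zero by simp
        have sp: "spread (g j) (y j) \<in> carrier E" using E3[OF g y] by blast
        have gj: "(\<lambda>k. n * k + j) = g j" by (simp add: g_def fun_eq_iff)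
        have "j < n" using Suc by simp
        then have "\<Psi> (interleave n (\<lambda>k. if k < Suc j then y k else 0)) =
            \<Psi> (interleave n (\<lambda>k. if k < j then y k else 0)) + \<Psi> (spread (g j) (y j))"
          unfolding interleave_step[OF \<open>j < n\<close>] gj by (intro \<Psi>a il sp)
        then show ?case
          using Suc by simp
      qed
      have "interleave n (\<lambda>k. if k < n then y k else 0) = interleave n y"
        using n(2) by (simp add: interleave_def fun_eq_iff)
      then have "\<Psi> (interleave n y) = (\<Sum>k<n. \<epsilon> k *\<^sub>R W (g k) (x k))"
        using part[of n] linear_simps(5)[OF kop_lin[OF W[OF g]]] by (simp add: y_def flip: W_def)
      moreover have "norm (\<Psi> (interleave n y)) \<le> D * \<phi> n"
      proof -
        have il: "interleave n y \<in> carrier E \<and> nrm E (interleave n y) \<le> \<phi> n * b\<^sub>1"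
          using n(2) y y_le by (rule E5)
        then have "norm (\<Psi> (interleave n y)) \<le> b\<^sub>2 * nrm E (interleave n y)"
          by (intro b2) simp
        also have "\<dots> \<le> b\<^sub>2 * (\<phi> n * b\<^sub>1)" using b2(1) il by (intro mult_left_mono) auto
        finally show ?thesis by (simp add: D_def algebra_simps)
      qed
      ultimately have v: "norm (\<Sum>k<n. \<epsilon> k *\<^sub>R W (g k) (x k)) \<le> D * \<phi> n" by simp
      have "real n * \<delta> \<le> (\<Sum>i<n. norm (S i (W (g i) (x i))))"
        using sum_bounded_below[of "{..<n}" \<delta> "\<lambda>i. norm (S i (W (g i) (x i)))"] x(2) by simp
      also have "\<dots> \<le> C * norm (\<Sum>k<n. \<epsilon> k *\<^sub>R W (g k) (x k))"
        using \<epsilon>(2) sum by (rule order_trans)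
      also have "\<dots> \<le> \<bar>C\<bar> * (D * \<phi> n)"
        using v by (intro mult_mono) auto
      also have "\<dots> = real n * (K * (\<phi> n / real n))"
        using n(2) by (simp add: K_def)
      also have "\<dots> < real n * \<delta>"
        by (rule mult_strict_left_mono[OF n(1)]) (use n(2) in simp)
      finally show False by simp
    qed
    then show ?thesis by blast
  qed
  define \<G> where "\<G> = {(W g, Z g) | g. strict_mono g}"
  have "splitting_family s D \<G>"
    unfolding splitting_family_def
  proof (intro conjI)
    have sp: "spread (\<lambda>k. k) y = y" for y :: "nat \<Rightarrow> 'a"
      using spread_image[of "\<lambda>k. k" y] by (intro ext) (simp add: strict_mono_def)
    have "W (\<lambda>k. k) = (\<lambda>x. x)" "Z (\<lambda>k. k) = (\<lambda>x. x)"
      by (intro ext, simp add: W_def sp inv, intro ext, simp add: Z_def inv comp_def)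
    then show "((\<lambda>x. x), (\<lambda>x. x)) \<in> \<G>"
      unfolding \<G>_def by (metis (mono_tags, lifting) mem_Collect_eq strict_mono_def)
    show "\<forall>V Y V' Y'. (V, Y) \<in> \<G> \<longrightarrow> (V', Y') \<in> \<G> \<longrightarrow> ((\<lambda>x. V (V' x)), (\<lambda>x. Y' (Y x))) \<in> \<G>"
    proof (intro allI impI)
      fix V Y V' Y' assume "(V, Y) \<in> \<G>" "(V', Y') \<in> \<G>"
      then obtain f g where "V = W f" "Y = Z f" "V' = W g" "Y' = Z g" and fg: "strict_mono f" "strict_mono g"
        by (auto simp: \<G>_def)
      then have "(\<lambda>x. V (V' x)) = W (f \<circ> g)" "(\<lambda>x. Y' (Y x)) = Z (f \<circ> g)"
        by (simp_all add: WW ZZ)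
      then show "((\<lambda>x. V (V' x)), (\<lambda>x. Y' (Y x))) \<in> \<G>"
        using strict_mono_o[OF fg] by (auto simp: \<G>_def)
    qed
    show "\<forall>V Y. (V, Y) \<in> \<G> \<longrightarrow> kop s s V \<and> kop s s Y \<and> (\<forall>x. Y (V x) = x) \<and>
        (\<forall>x. norm (V x) \<le> D * norm x) \<and> (\<forall>x. norm (Y x) \<le> D * norm x)"
      using W Z W_le Z_le ZW by (auto simp: \<G>_def)
    show "\<forall>C \<delta>. \<delta> > 0 \<longrightarrow> (\<exists>n. \<forall>S :: nat \<Rightarrow> 'a \<Rightarrow> 'a.
        (\<forall>i. bounded_linear (S i)) \<longrightarrow> (\<forall>x. (\<Sum>i<n. norm (S i x)) \<le> C * norm x) \<longrightarrow>
        (\<exists>i<n. \<exists>V Y. (V, Y) \<in> \<G> \<and> (\<forall>x. norm (S i (V x)) \<le> \<delta> * norm x)))"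
    proof (intro allI impI)
      fix C \<delta> :: real assume \<delta>: "\<delta> > 0"
      obtain n where n: "\<forall>S :: nat \<Rightarrow> 'a \<Rightarrow> 'a. (\<forall>i. bounded_linear (S i)) \<longrightarrow>
          (\<forall>x. (\<Sum>i<n. norm (S i x)) \<le> C * norm x) \<longrightarrow>
          (\<exists>i<n. \<exists>g. strict_mono g \<and> (\<forall>x. norm (S i (W g x)) \<le> \<delta> * norm x))"
        using small[OF \<delta>, of C] ..
      show "\<exists>n. \<forall>S :: nat \<Rightarrow> 'a \<Rightarrow> 'a.
        (\<forall>i. bounded_linear (S i)) \<longrightarrow> (\<forall>x. (\<Sum>i<n. norm (S i x)) \<le> C * norm x) \<longrightarrow>
        (\<exists>i<n. \<exists>V Y. (V, Y) \<in> \<G> \<and> (\<forall>x. norm (S i (V x)) \<le> \<delta> * norm x))"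
      proof (rule exI[of _ n], intro allI impI)
        fix S :: "nat \<Rightarrow> 'a \<Rightarrow> 'a"
        assume "\<forall>i. bounded_linear (S i)" "\<forall>x. (\<Sum>i<n. norm (S i x)) \<le> C * norm x"
        then obtain i g where "i < n" "strict_mono g" "\<forall>x. norm (S i (W g x)) \<le> \<delta> * norm x"
          using n by meson
        then show "\<exists>i<n. \<exists>V Y. (V, Y) \<in> \<G> \<and> (\<forall>x. norm (S i (V x)) \<le> \<delta> * norm x)"
          unfolding \<G>_def by (intro exI[of _ i] conjI exI[of _ "W g"] exI[of _ "Z g"]) auto
      qed
    qed
  qed
  moreover have "D > 0" using b1(1) b2(1) by (simp add: D_def)
  ultimately show ?thesis by blast
qed

section \<open>Selecting a nearly diagonal submatrix\<close>

lemma splitting_familyD: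
  assumes "splitting_family s D \<G>"
  shows "((\<lambda>x. x), (\<lambda>x. x)) \<in> \<G>"
    "(W, Z) \<in> \<G> \<Longrightarrow> (W', Z') \<in> \<G> \<Longrightarrow> ((\<lambda>x. W (W' x)), (\<lambda>x. Z' (Z x))) \<in> \<G>"
    "(W, Z) \<in> \<G> \<Longrightarrow> kop s s W" "(W, Z) \<in> \<G> \<Longrightarrow> kop s s Z" "(W, Z) \<in> \<G> \<Longrightarrow> Z (W x) = x"
    "(W, Z) \<in> \<G> \<Longrightarrow> norm (W x) \<le> D * norm x" "(W, Z) \<in> \<G> \<Longrightarrow> norm (Z x) \<le> D * norm x"
  using assms unfolding splitting_family_def by blast+

lemma splitting_family_small:
  fixes s :: "'k \<Rightarrow> 'a::banach \<Rightarrow> 'a"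
  assumes "splitting_family s D \<G>" "\<delta> > 0"
  obtains n where "\<And>S :: nat \<Rightarrow> 'a \<Rightarrow> 'a. (\<And>i. bounded_linear (S i)) \<Longrightarrow>
    (\<And>x. (\<Sum>i<n. norm (S i x)) \<le> C * norm x) \<Longrightarrow>
    \<exists>i<n. \<exists>W Z. (W, Z) \<in> \<G> \<and> (\<forall>x. norm (S i (W x)) \<le> \<delta> * norm x)"
proof -
  have "\<exists>n. \<forall>S :: nat \<Rightarrow> 'a \<Rightarrow> 'a.
      (\<forall>i. bounded_linear (S i)) \<longrightarrow> (\<forall>x. (\<Sum>i<n. norm (S i x)) \<le> C * norm x) \<longrightarrow>
      (\<exists>i<n. \<exists>W Z. (W, Z) \<in> \<G> \<and> (\<forall>x. norm (S i (W x)) \<le> \<delta> * norm x))"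
    using assms unfolding splitting_family_def by blast
  then obtain n where n: "\<forall>S :: nat \<Rightarrow> 'a \<Rightarrow> 'a.
      (\<forall>i. bounded_linear (S i)) \<longrightarrow> (\<forall>x. (\<Sum>i<n. norm (S i x)) \<le> C * norm x) \<longrightarrow>
      (\<exists>i<n. \<exists>W Z. (W, Z) \<in> \<G> \<and> (\<forall>x. norm (S i (W x)) \<le> \<delta> * norm x))" ..
  show ?thesis
  proof (rule that)
    show "\<exists>i<n. \<exists>W Z. (W, Z) \<in> \<G> \<and> (\<forall>x. norm (S i (W x)) \<le> \<delta> * norm x)"
      if "\<And>i. bounded_linear (S i)" "\<And>x. (\<Sum>i<n. norm (S i x)) \<le> C * norm x"
      for S :: "nat \<Rightarrow> 'a \<Rightarrow> 'a"
      using n that by simp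
  qed
qed

text \<open>One step of the selection. Columns of an \<open>\<ell>\<^sub>1\<close>-matrix have bounded mass, so among sufficiently
  many candidate rows each later column has a row whose entry becomes small on a subcopy of \<open>X\<close>;
  by the pigeonhole principle infinitely many columns agree on that row.\<close>

lemma select_row:
  fixes s :: "'k \<Rightarrow> 'a::banach \<Rightarrow> 'a" and t :: "nat \<Rightarrow> nat \<Rightarrow> 'a \<Rightarrow> 'a"
  assumes G: "splitting_family s D \<G>" and t: "\<And>i j. bounded_linear (t i j)"
    and K: "K \<ge> 0" and col: "\<And>j N x. (\<Sum>i<N. norm (t i j x)) \<le> K * norm x"
    and \<delta>: "\<delta> > 0" and I: "infinite I" and w: "\<And>j. w j \<in> \<G>"
  obtains i J V Y where "i \<in> I" "infinite J" "J \<subseteq> I \<inter> {i<..}" "\<And>j. (V j, Y j) \<in> \<G>"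
    "\<And>j x. j \<in> J \<Longrightarrow> norm (t i j (fst (w j) (V j x))) \<le> \<delta> * norm x"
proof -
  obtain n where n: "\<And>S :: nat \<Rightarrow> 'a \<Rightarrow> 'a. (\<And>i. bounded_linear (S i)) \<Longrightarrow>
      (\<And>x. (\<Sum>i<n. norm (S i x)) \<le> K * D * norm x) \<Longrightarrow>
      \<exists>i<n. \<exists>W Z. (W, Z) \<in> \<G> \<and> (\<forall>x. norm (S i (W x)) \<le> \<delta> * norm x)"
    using splitting_family_small[OF G \<delta>, where C = "K * D"] by blast
  define c where "c = enumerate I"
  have c: "strict_mono c" "c l \<in> I" for l
    using I by (auto simp: c_def strict_mono_enumerate enumerate_in_set)
  define I' where "I' = I \<inter> {c n<..}"
  have "I \<subseteq> I' \<union> {..c n}" by (auto simp: I'_def)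
  then have I': "infinite I'"
    using I finite_subset by blast
  have "\<exists>l V Y. l < n \<and> (V, Y) \<in> \<G> \<and> (\<forall>x. norm (t (c l) j (fst (w j) (V x))) \<le> \<delta> * norm x)" for j
  proof -
    have wj: "kop s s (fst (w j))" "norm (fst (w j) x) \<le> D * norm x" for x
      using splitting_familyD[OF G] w[of j] by (metis prod.collapse)+
    have "\<exists>i<n. \<exists>W Z. (W, Z) \<in> \<G> \<and> (\<forall>x. norm (t (c i) j (fst (w j) (W x))) \<le> \<delta> * norm x)"
    proof (rule n)
      show "bounded_linear (\<lambda>x. t (c i) j (fst (w j) x))" for i
        by (rule bounded_linear_compose[OF t kop_lin[OF wj(1)]])
      fix x
      have "(\<Sum>i<n. norm (t (c i) j (fst (w j) x))) = (\<Sum>i\<in>c ` {..<n}. norm (t i j (fst (w j) x)))"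
        using strict_mono_imp_inj_on[OF c(1)] by (subst sum.reindex) (auto intro: inj_on_subset)
      also have "\<dots> \<le> (\<Sum>i<c n. norm (t i j (fst (w j) x)))"
        using c(1) by (intro sum_mono2) (auto simp: strict_mono_less)
      also have "\<dots> \<le> K * norm (fst (w j) x)" by (rule col)
      also have "\<dots> \<le> K * (D * norm x)" by (intro mult_left_mono wj K)
      finally show "(\<Sum>i<n. norm (t (c i) j (fst (w j) x))) \<le> K * D * norm x" by simp
    qed
    then show ?thesis by blast
  qed
  then obtain l V Y where l: "\<And>j. l j < n" and V: "\<And>j. (V j, Y j) \<in> \<G>"
    and small: "\<And>j x. norm (t (c (l j)) j (fst (w j) (V j x))) \<le> \<delta> * norm x"
    by metis
  have "finite (l ` I')" using l by - (rule finite_subset[of _ "{..<n}"], auto)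
  then obtain j0 where j0: "infinite {j \<in> I'. l j = l j0}"
    using pigeonhole_infinite[OF I'] by blast
  show ?thesis
  proof (rule that[of "c (l j0)" "{j \<in> I'. l j = l j0}" V Y])
    have "c (l j0) < c n" using c(1) l by (simp add: strict_mono_less)
    then show "{j \<in> I'. l j = l j0} \<subseteq> I \<inter> {c (l j0)<..}" by (auto simp: I'_def)
    show "norm (t (c (l j0)) j (fst (w j) (V j x))) \<le> \<delta> * norm x" if "j \<in> {j \<in> I'. l j = l j0}" for j x
      using small[of j x] that by simp
  qed (use c j0 V in auto)
qed

text \<open>Iterating the step. The state consists of the set of surviving indices and, for each column,
  the subcopy of \<open>X\<close> reached so far; each column is shrunk finitely often before it is chosen, and
  since the family is closed under composition all subcopies obey the same bounds.\<close>

lemma select_nearly_diagonal: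
  fixes s :: "'k \<Rightarrow> 'a::banach \<Rightarrow> 'a" and t :: "nat \<Rightarrow> nat \<Rightarrow> 'a \<Rightarrow> 'a"
  assumes G: "splitting_family s D \<G>" and D: "D > 0" and t: "\<And>i j. bounded_linear (t i j)"
    and bounded: "\<exists>K\<ge>0. \<forall>j N x. (\<Sum>i<N. norm (t i j x)) \<le> K * norm x"
    and tail: "\<And>j. \<exists>m. \<forall>N x. (\<Sum>i=m..<N. norm (t i j x)) \<le> e * norm x"
    and e: "e > 0"
  obtains \<sigma> W Z where "strict_mono \<sigma>" "\<And>b. (W b, Z b) \<in> \<G>"
    "\<And>a b x. a < b \<Longrightarrow> norm (t (\<sigma> a) (\<sigma> b) (W b x)) \<le> e * (1/2) ^ a * norm x"
    "\<And>b N x. (\<Sum>a=Suc b..<N. norm (t (\<sigma> a) (\<sigma> b) x)) \<le> e * norm x"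
proof -
  obtain K where K: "K \<ge> 0" "\<And>j N x. (\<Sum>i<N. norm (t i j x)) \<le> K * norm x"
    using bounded by blast
  define P where "P p \<longleftrightarrow> infinite (fst p) \<and> (\<forall>j. snd p j \<in> \<G>)"
    for p :: "nat set \<times> (nat \<Rightarrow> ('a \<Rightarrow> 'a) \<times> ('a \<Rightarrow> 'a))"
  define R where "R n p p' i \<longleftrightarrow> i \<in> fst p \<and> fst p' \<subseteq> fst p \<inter> {i<..} \<and>
      (\<forall>j. \<exists>V Y. (V, Y) \<in> \<G> \<and> snd p' j = ((\<lambda>x. fst (snd p j) (V x)), (\<lambda>x. Y (snd (snd p j) x)))) \<and>
      (\<forall>j\<in>fst p'. \<forall>x. norm (t i j (fst (snd p' j) x)) \<le> e / D * (1/2) ^ n * norm x) \<and>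
      (\<exists>m. fst p' \<subseteq> {m..} \<and> (\<forall>N x. (\<Sum>i'=m..<N. norm (t i' i x)) \<le> e * norm x))"
    for n i and p p' :: "nat set \<times> (nat \<Rightarrow> ('a \<Rightarrow> 'a) \<times> ('a \<Rightarrow> 'a))"
  have "\<exists>F. \<forall>n. P (F n) \<and> (\<exists>i. R n (F n) (F (Suc n)) i)"
  proof (rule dependent_nat_choice)
    show "\<exists>p. P p"
      using splitting_familyD(1)[OF G] by (intro exI[of _ "(UNIV, \<lambda>j. ((\<lambda>x. x), (\<lambda>x. x)))"]) (simp add: P_def)
    fix p n assume p: "P p"
    define \<delta> where "\<delta> = e / D * (1/2) ^ n"
    have \<delta>: "\<delta> > 0" using e D by (simp add: \<delta>_def)
    from p have I: "infinite (fst p)" and w: "\<And>j. snd p j \<in> \<G>" by (auto simp: P_def)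
    obtain i J V Y where i: "i \<in> fst p" and J: "infinite J" "J \<subseteq> fst p \<inter> {i<..}"
      and V: "\<And>j. (V j, Y j) \<in> \<G>"
      and small: "\<And>j x. j \<in> J \<Longrightarrow> norm (t i j (fst (snd p j) (V j x))) \<le> \<delta> * norm x"
      using select_row[where t = t and w = "snd p", OF G t K \<delta> I w] by metis
    obtain m where m: "\<forall>N x. (\<Sum>i'=m..<N. norm (t i' i x)) \<le> e * norm x"
      using tail[of i] ..
    define p' where "p' = (J \<inter> {m..}, \<lambda>j. ((\<lambda>x. fst (snd p j) (V j x)), (\<lambda>x. Y j (snd (snd p j) x))))"
    have "J \<subseteq> (J \<inter> {m..}) \<union> {..<m}" by auto
    then have "infinite (J \<inter> {m..})"
      using J(1) finite_subset by blast
    moreover have "((\<lambda>x. fst (snd p j) (V j x)), (\<lambda>x. Y j (snd (snd p j) x))) \<in> \<G>" for j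
      by (rule splitting_familyD(2)[OF G _ V]) (simp add: w)
    ultimately have "P p'" by (simp add: P_def p'_def)
    moreover have "R n p p' i"
      unfolding R_def
    proof (intro conjI)
      show "\<forall>j. \<exists>V Y. (V, Y) \<in> \<G> \<and> snd p' j = ((\<lambda>x. fst (snd p j) (V x)), (\<lambda>x. Y (snd (snd p j) x)))"
      proof
        fix j
        show "\<exists>V Y. (V, Y) \<in> \<G> \<and> snd p' j = ((\<lambda>x. fst (snd p j) (V x)), (\<lambda>x. Y (snd (snd p j) x)))"
          using V[of j] by (intro exI[of _ "V j"] exI[of _ "Y j"]) (simp add: p'_def)
      qed
      show "\<exists>m. fst p' \<subseteq> {m..} \<and> (\<forall>N x. (\<Sum>i'=m..<N. norm (t i' i x)) \<le> e * norm x)"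
        using m by (intro exI[of _ m]) (simp add: p'_def)
    qed (use i J small in \<open>auto simp: p'_def \<delta>_def\<close>)
    ultimately show "\<exists>p'. P p' \<and> (\<exists>i. R n p p' i)" by blast
  qed
  then obtain F where F: "\<forall>n. P (F n) \<and> (\<exists>i. R n (F n) (F (Suc n)) i)" ..
  then have "\<forall>n. \<exists>i. R n (F n) (F (Suc n)) i" by simp
  then obtain \<sigma> where R: "\<And>n. R n (F n) (F (Suc n)) (\<sigma> n)" by metis
  define I where "I n = fst (F n)" for n
  define w where "w n = snd (F n)" for n
  have \<sigma>_in: "\<sigma> n \<in> I n" and I_step: "I (Suc n) \<subseteq> I n \<inter> {\<sigma> n<..}"
    and w_step: "\<exists>V Y. (V, Y) \<in> \<G> \<and> w (Suc n) j = ((\<lambda>x. fst (w n j) (V x)), (\<lambda>x. Y (snd (w n j) x)))"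
    and small: "j \<in> I (Suc n) \<Longrightarrow> norm (t (\<sigma> n) j (fst (w (Suc n) j) x)) \<le> e / D * (1/2) ^ n * norm x"
    and mass: "\<exists>m. I (Suc n) \<subseteq> {m..} \<and> (\<forall>N x. (\<Sum>i'=m..<N. norm (t i' (\<sigma> n) x)) \<le> e * norm x)"
    for n j x
    using R[of n] unfolding R_def I_def w_def by blast+
  have w_in: "w n j \<in> \<G>" for n j using F by (simp add: P_def w_def)
  have I_anti: "I n \<subseteq> I k" if "k \<le> n" for k n
    by (rule lift_Suc_antimono_le[of I, OF _ that]) (use I_step in blast)
  have \<sigma>: "strict_mono \<sigma>"
    unfolding strict_mono_Suc_iff
  proof
    show "\<sigma> n < \<sigma> (Suc n)" for n using \<sigma>_in[of "Suc n"] I_step[of n] by auto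
  qed
  have w_chain: "\<exists>V Y. (V, Y) \<in> \<G> \<and> w (k + d) j = ((\<lambda>x. fst (w k j) (V x)), (\<lambda>x. Y (snd (w k j) x)))"
    for k d j
  proof (induction d)
    case 0
    show ?case using splitting_familyD(1)[OF G] by (intro exI[of _ "\<lambda>x. x"]) simp
  next
    case (Suc d)
    obtain V Y where V: "(V, Y) \<in> \<G>" "w (k + d) j = ((\<lambda>x. fst (w k j) (V x)), (\<lambda>x. Y (snd (w k j) x)))"
      using Suc by blast
    obtain V' Y' where V': "(V', Y') \<in> \<G>"
      "w (Suc (k + d)) j = ((\<lambda>x. fst (w (k + d) j) (V' x)), (\<lambda>x. Y' (snd (w (k + d) j) x)))"
      using w_step by blast
    show ?case
      using V V' splitting_familyD(2)[OF G V(1) V'(1)]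
      by (intro exI[of _ "\<lambda>x. V (V' x)"] exI[of _ "\<lambda>x. Y' (Y x)"]) simp
  qed
  show ?thesis
  proof (rule that[of \<sigma> "\<lambda>b. fst (w b (\<sigma> b))" "\<lambda>b. snd (w b (\<sigma> b))"])
    show "strict_mono \<sigma>" by (rule \<sigma>)
    show "(fst (w b (\<sigma> b)), snd (w b (\<sigma> b))) \<in> \<G>" for b using w_in by simp
    show "norm (t (\<sigma> a) (\<sigma> b) (fst (w b (\<sigma> b)) x)) \<le> e * (1/2) ^ a * norm x" if ab: "a < b" for a b x
    proof -
      have mem: "\<sigma> b \<in> I (Suc a)" using \<sigma>_in[of b] I_anti[of "Suc a" b] ab by auto
      obtain V Y where V: "(V, Y) \<in> \<G>" "fst (w b (\<sigma> b)) x = fst (w (Suc a) (\<sigma> b)) (V x)"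
        using w_chain[of "Suc a" "b - Suc a" "\<sigma> b"] ab by auto
      have "norm (t (\<sigma> a) (\<sigma> b) (fst (w b (\<sigma> b)) x)) \<le> e / D * (1/2) ^ a * norm (V x)"
        unfolding V(2) by (rule small[OF mem])
      also have "\<dots> \<le> e / D * (1/2) ^ a * (D * norm x)"
        using e D by (intro mult_left_mono splitting_familyD(6)[OF G V(1)]) simp
      finally show ?thesis using D by simp
    qed
    show "(\<Sum>a=Suc b..<N. norm (t (\<sigma> a) (\<sigma> b) x)) \<le> e * norm x" for b N x
    proof -
      obtain m where m: "I (Suc b) \<subseteq> {m..}" "\<And>N x. (\<Sum>i'=m..<N. norm (t i' (\<sigma> b) x)) \<le> e * norm x"
        using mass by blast
      have "\<sigma> a \<ge> m" if "a \<ge> Suc b" for a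
        using \<sigma>_in[of a] I_anti[OF that] m(1) by auto
      then have sub: "\<sigma> ` {Suc b..<N} \<subseteq> {m..<\<sigma> N}"
        by (auto simp: strict_mono_less[OF \<sigma>])
      have "(\<Sum>a=Suc b..<N. norm (t (\<sigma> a) (\<sigma> b) x)) = (\<Sum>i\<in>\<sigma> ` {Suc b..<N}. norm (t i (\<sigma> b) x))"
        using strict_mono_imp_inj_on[OF \<sigma>] by (subst sum.reindex) (auto intro: inj_on_subset)
      also have "\<dots> \<le> (\<Sum>i=m..<\<sigma> N. norm (t i (\<sigma> b) x))"
        by (intro sum_mono2 sub) auto
      also have "\<dots> \<le> e * norm x" by (rule m(2))
      finally show ?thesis .
    qed
  qed
qed

section \<open>Factorising the identity of \<open>\<ell>\<^sub>1(X)\<close>\<close>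

text \<open>Factorisation of the identity through \<open>T\<close> with constant \<open>C\<close>, with the norms of the two
  factors distributed in a fixed way so that infinitely many factorisations can be combined.\<close>

definition factors_identity :: "('k \<Rightarrow> 'a::real_normed_vector \<Rightarrow> 'a) \<Rightarrow> ('a \<Rightarrow> 'a) \<Rightarrow> real \<Rightarrow> bool" where
  "factors_identity s T C \<longleftrightarrow> (\<exists>U V. kop s s U \<and> kop s s V \<and> (\<forall>x. U (T (V x)) = x) \<and>
     (\<forall>x. norm (V x) \<le> norm x) \<and> (\<forall>x. norm (U x) \<le> C * norm x))"

lemma sum_norm_coord_le_part:
  assumes "inj_on \<sigma> A" "finite A" "\<sigma> ` A \<subseteq> B"
  shows "(\<Sum>a\<in>A. norm (coord y (\<sigma> a))) \<le> norm (part B y)"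
proof -
  have "(\<Sum>a\<in>A. norm (coord y (\<sigma> a))) = (\<Sum>n\<in>\<sigma> ` A. norm (coord (part B y) n))"
    using assms by (subst sum.reindex) (auto simp: coord_part image_subset_iff)
  also have "\<dots> \<le> norm (part B y)"
    using assms(2) by (intro sum_norm_coord_le) simp
  finally show ?thesis .
qed

lemma kop_coord_entry:
  assumes s: "banach_scaling s" and T: "kop (lscale s) (lscale s) T"
  shows "kop s s (\<lambda>u. coord (T (single j u)) i)"
  by (rule kop_comp[OF kop_coord[OF s] kop_comp[OF T kop_single[OF s]]])

text \<open>Compress \<open>T\<close> to the rows and columns in \<open>J\<close>, multiply it by the factors of the diagonal entries to
  obtain a matrix \<open>t\<close> with identities on the diagonal, and select from \<open>t\<close> a submatrix that is nearly
  diagonal. The operators \<open>in\<^sub>D\<close> and \<open>out\<close> perform all these compressions at once, so that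
  \<open>out \<circ> T \<circ> in\<^sub>D\<close> is close to the identity.\<close>

lemma factors_identity_ell1_of_diagonal:
  fixes s :: "'k::real_or_complex \<Rightarrow> 'a::banach \<Rightarrow> 'a"
  assumes s: "banach_scaling s" and G: "splitting_family s D \<G>" and D: "D > 0"
    and no_l1: "\<nexists>R A. kop s (lscale (*)) R \<and> kop (lscale (*)) s A \<and> (\<forall>c :: 'k ell1. R (A c) = c)"
    and T: "kop (lscale s) (lscale s) T" and J: "infinite J" and C: "C \<ge> 0"
    and diag: "\<And>j. j \<in> J \<Longrightarrow> factors_identity s (\<lambda>u. coord (T (single j u)) j) C"
  shows "factors_identity (lscale s) T (2 * D\<^sup>2 * C)"
proof -
  note sl = banach_scaling_lscale[OF s]
  define \<tau> where "\<tau> = enumerate J"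
  have \<tau>: "strict_mono \<tau>" "\<tau> a \<in> J" "a \<le> \<tau> a" for a
    using J strict_mono_imp_increasing[of \<tau>]
    by (auto simp: \<tau>_def strict_mono_enumerate enumerate_in_set)
  have "\<forall>a. \<exists>U V. kop s s U \<and> kop s s V \<and> (\<forall>u. U (coord (T (single (\<tau> a) (V u))) (\<tau> a)) = u) \<and>
      (\<forall>u. norm (V u) \<le> norm u) \<and> (\<forall>u. norm (U u) \<le> C * norm u)"
    using diag[OF \<tau>(2)] unfolding factors_identity_def by blast
  then obtain U V where U: "\<And>a. kop s s (U a)" and V: "\<And>a. kop s s (V a)"
    and UTV: "\<And>a u. U a (coord (T (single (\<tau> a) (V a u))) (\<tau> a)) = u"
    and V_le: "\<And>a u. norm (V a u) \<le> norm u" and U_le: "\<And>a u. norm (U a u) \<le> C * norm u"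
    by metis
  define S where "S b u = T (single (\<tau> b) (V b u))" for b u
  have S: "kop s (lscale s) (S b)" for b
    unfolding S_def by (rule kop_comp[OF T kop_comp[OF kop_single[OF s] V]])
  define t where "t a b u = U a (coord (S b u) (\<tau> a))" for a b u
  have t: "bounded_linear (t a b)" for a b
    unfolding t_def by (rule kop_lin[OF kop_comp[OF U kop_comp[OF kop_coord[OF s] S]]])
  have t_diag: "t a a u = u" for a u by (simp add: t_def S_def UTV)
  have t_sum: "(\<Sum>a\<in>A. norm (t a b u)) \<le> C * norm (part B (S b u))"
    if "finite A" "\<tau> ` A \<subseteq> B" for A B b u
  proof -
    have "(\<Sum>a\<in>A. norm (t a b u)) \<le> (\<Sum>a\<in>A. C * norm (coord (S b u) (\<tau> a)))"
      unfolding t_def by (intro sum_mono U_le)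
    also have "\<dots> = C * (\<Sum>a\<in>A. norm (coord (S b u) (\<tau> a)))" by (simp add: sum_distrib_left)
    also have "\<dots> \<le> C * norm (part B (S b u))"
      using strict_mono_imp_inj_on[OF \<tau>(1)] that
      by (intro mult_left_mono[OF _ C] sum_norm_coord_le_part) (auto intro: inj_on_subset)
    finally show ?thesis .
  qed
  obtain K where K: "K \<ge> 0" "\<And>y. norm (T y) \<le> K * norm y"
    using bounded_linear.nonneg_bounded[OF kop_lin[OF T]] by (metis mult.commute)
  have bounded: "\<exists>K\<ge>0. \<forall>b N u. (\<Sum>a<N. norm (t a b u)) \<le> K * norm u"
  proof (intro exI[of _ "C * K"] conjI allI)
    fix b N u
    have "(\<Sum>a<N. norm (t a b u)) \<le> C * norm (part UNIV (S b u))" by (rule t_sum) auto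
    also have "\<dots> \<le> C * (K * norm u)"
    proof (intro mult_left_mono[OF _ C])
      have "norm (S b u) \<le> K * norm (V b u)" unfolding S_def using K(2) by (metis norm_single)
      also have "\<dots> \<le> K * norm u" by (intro mult_left_mono V_le K)
      finally show "norm (part UNIV (S b u)) \<le> K * norm u" by (rule order_trans[OF norm_part_le])
    qed
    finally show "(\<Sum>a<N. norm (t a b u)) \<le> C * K * norm u" by simp
  qed (use C K in simp)
  \<comment> \<open>An off-diagonal column of the compressed matrix then has mass at most \<open>D (2 e + e D) = 1/2\<close>.\<close>
  define e where "e = 1 / (2 * D * (2 + D))"
  have e: "e > 0" using D by (simp add: e_def)
  have tail: "\<exists>m. \<forall>N u. (\<Sum>a=m..<N. norm (t a b u)) \<le> e * norm u" for b
  proof -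
    have "e / (C + 1) > 0" using e C by simp
    then obtain m where m: "\<And>u. norm (part {m..} (S b u)) \<le> e / (C + 1) * norm u"
      using tails_uniformly_small[OF s s S no_l1] by blast
    have "(\<Sum>a=m..<N. norm (t a b u)) \<le> e * norm u" for N u
    proof -
      have "\<tau> ` {m..<N} \<subseteq> {m..}" using \<tau>(3) by (auto intro: order_trans)
      then have "(\<Sum>a=m..<N. norm (t a b u)) \<le> C * norm (part {m..} (S b u))"
        by (intro t_sum) auto
      also have "\<dots> \<le> C * (e / (C + 1) * norm u)" by (intro mult_left_mono m C)
      also have "\<dots> = (C / (C + 1)) * (e * norm u)" by simp
      also have "\<dots> \<le> 1 * (e * norm u)" using C e by (intro mult_right_mono) auto
      finally show ?thesis by simp
    qed
    then show ?thesis by blast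
  qed
  obtain \<sigma> W Z where \<sigma>: "strict_mono \<sigma>" and WZ: "\<And>b. (W b, Z b) \<in> \<G>"
    and upper: "\<And>a b x. a < b \<Longrightarrow> norm (t (\<sigma> a) (\<sigma> b) (W b x)) \<le> e * (1/2) ^ a * norm x"
    and lower: "\<And>b N x. (\<Sum>a=Suc b..<N. norm (t (\<sigma> a) (\<sigma> b) x)) \<le> e * norm x"
    using select_nearly_diagonal[where t = t, OF G D t bounded tail e] by metis
  note W = splitting_familyD(3,6)[OF G WZ] and Z = splitting_familyD(4,7)[OF G WZ]
  define \<rho> where "\<rho> a = \<tau> (\<sigma> a)" for a
  have inj: "inj_on \<rho> A" for A
    using strict_mono_imp_inj_on[OF strict_mono_o[OF \<tau>(1) \<sigma>]] unfolding \<rho>_def comp_def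
    by (rule inj_on_subset) (rule subset_UNIV)
  define in\<^sub>D where "in\<^sub>D = from_columns (\<lambda>b u. single (\<rho> b) (V (\<sigma> b) (W b u)))"
  have in_col: "kop s (lscale s) (\<lambda>u. single (\<rho> b) (V (\<sigma> b) (W b u)))" for b
    by (rule kop_comp[OF kop_single[OF s] kop_comp[OF V W(1)]])
  have in_le: "norm (single (\<rho> b) (V (\<sigma> b) (W b u))) \<le> D * norm u" for b u
    using V_le[of "\<sigma> b" "W b u"] W(2)[of b u] by simp
  have in_kop: "kop (lscale s) (lscale s) in\<^sub>D"
    unfolding in\<^sub>D_def by (rule kop_from_columns[OF s sl in_col in_le])
  have in_norm: "norm (in\<^sub>D x) \<le> D * norm x" for x
    unfolding in\<^sub>D_def by (rule norm_from_columns_le[OF kop_lin[OF in_col] in_le])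
  have in_single: "in\<^sub>D (single b u) = single (\<rho> b) (V (\<sigma> b) (W b u))" for b u
    unfolding in\<^sub>D_def by (rule from_columns_single[OF kop_lin[OF in_col] in_le])
  define row where "row a y = Z a (U (\<sigma> a) (coord y (\<rho> a)))" for a y
  have row: "kop (lscale s) s (row a)" for a
    unfolding row_def by (rule kop_comp[OF Z(1) kop_comp[OF U kop_coord[OF s]]])
  have row_le: "(\<Sum>a<N. norm (row a y)) \<le> D * C * norm y" for N y
  proof -
    have "norm (row a y) \<le> D * (C * norm (coord y (\<rho> a)))" for a
      unfolding row_def using Z(2) mult_left_mono[OF U_le, of D] D by (meson less_imp_le order_trans)
    then have "(\<Sum>a<N. norm (row a y)) \<le> (\<Sum>a<N. D * C * norm (coord y (\<rho> a)))"
      by (intro sum_mono) (simp add: mult.assoc)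
    also have "\<dots> = D * C * (\<Sum>a<N. norm (coord y (\<rho> a)))"
      by (simp add: sum_distrib_left)
    also have "\<dots> \<le> D * C * norm (part UNIV y)"
      using D C by (intro mult_left_mono sum_norm_coord_le_part inj) auto
    also have "\<dots> \<le> D * C * norm y"
      using D C by (intro mult_left_mono norm_part_le) auto
    finally show ?thesis .
  qed
  define out where "out y = Abs_ell1 (\<lambda>a. row a y)" for y
  have out: "kop (lscale s) (lscale s) out" and out_norm: "norm (out y) \<le> D * C * norm y"
    and coord_out: "coord (out y) a = row a y" for y a
    unfolding out_def using kop_from_rows[OF sl s row row_le] by blast+
  define Q where "Q x = out (T (in\<^sub>D x))" for x
  have Q: "kop (lscale s) (lscale s) Q"
    unfolding Q_def by (rule kop_comp[OF out kop_comp[OF T in_kop]])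
  have cQ: "coord (Q (single b u)) a = Z a (t (\<sigma> a) (\<sigma> b) (W b u))" for a b u
    by (simp add: Q_def coord_out row_def in_single t_def S_def \<rho>_def)
  have "norm (Q x - x) \<le> (1/2) * norm x" for x
  proof (rule norm_le_of_columns[where T = "\<lambda>x. Q x - x"])
    show "bounded_linear (\<lambda>x. Q x - x)"
      by (intro bounded_linear_sub bounded_linear_ident kop_lin[OF Q])
    fix b u
    define r where "r a = norm (coord (Q (single b u) - single b u) a)" for a
    have r: "r a \<le> D * norm (t (\<sigma> a) (\<sigma> b) (W b u))" if "a \<noteq> b" for a
      using that Z(2) by (simp add: r_def cQ coord_single)
    have r_diag: "r b = 0"
      by (simp add: r_def cQ coord_single t_diag splitting_familyD(5)[OF G WZ])
    have up: "(\<Sum>a<b. r a) \<le> D * (2 * e * norm u)"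
    proof -
      have "(\<Sum>a<b. r a) \<le> (\<Sum>a<b. D * (e * (1/2) ^ a * norm u))"
        using D by (intro sum_mono order_trans[OF r] mult_left_mono upper) auto
      also have "\<dots> = D * (e * norm u) * (\<Sum>a<b. (1/2) ^ a)"
        by (simp add: sum_distrib_left algebra_simps)
      also have "\<dots> \<le> D * (e * norm u) * 2"
        using D e by (intro mult_left_mono) (simp_all add: sum_gp_strict)
      finally show ?thesis by (simp add: algebra_simps)
    qed
    have low: "(\<Sum>a=Suc b..<N. r a) \<le> D * (e * (D * norm u))" for N
    proof -
      have "(\<Sum>a=Suc b..<N. r a) \<le> (\<Sum>a=Suc b..<N. D * norm (t (\<sigma> a) (\<sigma> b) (W b u)))"
        by (intro sum_mono r) auto
      also have "\<dots> = D * (\<Sum>a=Suc b..<N. norm (t (\<sigma> a) (\<sigma> b) (W b u)))"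
        by (simp add: sum_distrib_left)
      also have "\<dots> \<le> D * (e * norm (W b u))" using D by (intro mult_left_mono lower) auto
      also have "\<dots> \<le> D * (e * (D * norm u))" using D e W(2) by (intro mult_left_mono) auto
      finally show ?thesis .
    qed
    show "norm (Q (single b u) - single b u) \<le> 1 / 2 * norm u"
    proof (rule norm_ell1_leI)
      fix N
      have "(\<Sum>a<N. r a) \<le> (\<Sum>a\<in>{..<b} \<union> ({b} \<union> {Suc b..<N}). r a)"
        by (intro sum_mono2) (auto simp: r_def)
      also have "\<dots> = (\<Sum>a<b. r a) + (r b + (\<Sum>a=Suc b..<N. r a))"
        by (subst sum.union_disjoint; auto)+
      also have "\<dots> \<le> D * (2 * e * norm u) + D * (e * (D * norm u))"
        using up low[of N] r_diag by simp
      also have "\<dots> = (e * (D * (2 + D))) * norm u" by (simp add: algebra_simps)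
      also have "e * (D * (2 + D)) = 1 / 2" using D by (simp add: e_def)
      finally show "(\<Sum>a<N. norm (coord (Q (single b u) - single b u) a)) \<le> 1 / 2 * norm u"
        by (simp add: r_def)
    qed
  qed
  then have "norm (Q x - x) \<le> norm x / 2" for x by simp
  from near_identity_invertible[OF sl Q this]
  obtain N where "kop (lscale s) (lscale s) N \<and> (\<forall>x. N (Q x) = x) \<and> (\<forall>x. Q (N x) = x) \<and>
      (\<forall>x. norm (N x) \<le> 2 * norm x)" ..
  then have N: "kop (lscale s) (lscale s) N" "N (Q x) = x" "norm (N x) \<le> 2 * norm x" for x
    by simp_all
  show ?thesis
    unfolding factors_identity_def
  proof (rule exI[of _ "\<lambda>y. D *\<^sub>R N (out y)"], rule exI[of _ "\<lambda>x. (1 / D) *\<^sub>R in\<^sub>D x"],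
      intro conjI allI)
    show "kop (lscale s) (lscale s) (\<lambda>x. (1 / D) *\<^sub>R in\<^sub>D x)"
      by (rule kop_scaleR[OF sl in_kop])
    show "kop (lscale s) (lscale s) (\<lambda>y. D *\<^sub>R N (out y))"
      by (rule kop_scaleR[OF sl kop_comp[OF N(1) out]])
    show "D *\<^sub>R N (out (T ((1 / D) *\<^sub>R in\<^sub>D x))) = x" for x
      using N(2)[of x] D
      by (simp add: Q_def linear_simps(5)[OF kop_lin[OF T]] linear_simps(5)[OF kop_lin[OF out]]
          linear_simps(5)[OF kop_lin[OF N(1)]])
    show "norm ((1 / D) *\<^sub>R in\<^sub>D x) \<le> norm x" for x
      using in_norm[of x] D by (simp add: field_simps)
    show "norm (D *\<^sub>R N (out y)) \<le> 2 * D\<^sup>2 * C * norm y" for y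
    proof -
      have "norm (D *\<^sub>R N (out y)) \<le> D * (2 * (D * C * norm y))"
        using D N(3)[of "out y"] out_norm[of y] by (simp add: mult_left_mono)
      then show ?thesis by (simp add: power2_eq_square algebra_simps)
    qed
  qed
qed

text \<open>One of the two alternatives for the diagonal entries occurs infinitely often.\<close>

lemma factors_identity_ell1:
  fixes s :: "'k::real_or_complex \<Rightarrow> 'a::banach \<Rightarrow> 'a"
  assumes s: "banach_scaling s" and G: "splitting_family s D \<G>" and D: "D > 0"
    and no_l1: "\<nexists>R A. kop s (lscale (*)) R \<and> kop (lscale (*)) s A \<and> (\<forall>c :: 'k ell1. R (A c) = c)"
    and C: "C \<ge> 0"
    and pfp: "\<And>T. kop s s T \<Longrightarrow> factors_identity s T C \<or> factors_identity s (\<lambda>x. x - T x) C"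
    and T: "kop (lscale s) (lscale s) T"
  shows "factors_identity (lscale s) T (2 * D\<^sup>2 * C) \<or>
    factors_identity (lscale s) (\<lambda>x. x - T x) (2 * D\<^sup>2 * C)"
proof (cases "infinite {j. factors_identity s (\<lambda>u. coord (T (single j u)) j) C}")
  case True
  then show ?thesis
    using factors_identity_ell1_of_diagonal[OF s G D no_l1 T True C] by simp
next
  case False
  then have inf: "infinite (- {j. factors_identity s (\<lambda>u. coord (T (single j u)) j) C})"
    using finite_compl by blast
  have "kop (lscale s) (lscale s) (\<lambda>x. x - T x)"
    by (rule kop_diff[OF banach_scaling_lscale[OF s] kop_id T])
  moreover have "factors_identity s (\<lambda>u. coord (single j u - T (single j u)) j) C"
    if "j \<in> - {j. factors_identity s (\<lambda>u. coord (T (single j u)) j) C}" for j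
    using pfp[OF kop_coord_entry[OF s T], of j j] that by (simp add: coord_single)
  ultimately show ?thesis
    using factors_identity_ell1_of_diagonal[OF s G D no_l1 _ inf C] by blast
qed

section \<open>The decomposition method\<close>

text \<open>The isomorphism \<open>\<ell>\<^sub>1(Y) \<cong> Y\<close> for \<open>Y = \<ell>\<^sub>1(X)\<close> is kept implicit: a pairing function divides
  the index set of \<open>Y\<close> into infinitely many levels, each carrying a copy of \<open>Y\<close>. An operator on
  \<open>Y\<close> is then determined by what it does on the levels.\<close>

definition level :: "nat \<Rightarrow> 'a::banach ell1 \<Rightarrow> 'a ell1" where
  "level n = from_columns (\<lambda>b. single (prod_encode (n, b)))"

definition from_levels :: "(nat \<Rightarrow> 'a::banach ell1 \<Rightarrow> 'a ell1) \<Rightarrow> 'a ell1 \<Rightarrow> 'a ell1" where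
  "from_levels M = from_columns (\<lambda>c u. case prod_decode c of (n, b) \<Rightarrow> M n (single b u))"

context
  fixes s :: "'k::real_or_complex \<Rightarrow> 'a::banach \<Rightarrow> 'a"
  assumes s: "banach_scaling s"
begin

lemma level_single: "level n (single b u) = single (prod_encode (n, b)) u" for u :: 'a
  unfolding level_def by (rule from_columns_single[of _ 1]) (simp_all add: bounded_linear_single)

lemma kop_level: "kop (lscale s) (lscale s) (level n)"
  unfolding level_def
  by (rule kop_from_columns[OF s banach_scaling_lscale[OF s], of _ 1]) (simp_all add: kop_single[OF s])

lemma norm_level_le: "norm (level n y) \<le> 1 * norm y" for y :: "'a ell1"
  unfolding level_def by (rule norm_from_columns_le) (simp_all add: bounded_linear_single)

lemma ext_on_levels:
  fixes S T :: "'a ell1 \<Rightarrow> 'a ell1"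
  assumes "kop (lscale s) (lscale s) S" "kop (lscale s) (lscale s) T" "\<And>n y. S (level n y) = T (level n y)"
  shows "S y = T y"
proof (rule ell1_ext[OF kop_lin[OF assms(1)] kop_lin[OF assms(2)]])
  fix c u
  obtain n b where "c = prod_encode (n, b)" by (metis prod_decode_inverse surj_pair)
  then show "S (single c u) = T (single c u)"
    using assms(3)[of n "single b u"] by (simp add: level_single)
qed

lemma from_levels:
  assumes M: "\<And>n. kop (lscale s) (lscale s) (M n)" and bound: "\<And>n y. norm (M n y) \<le> K * norm y"
  shows "kop (lscale s) (lscale s) (from_levels M)" "from_levels M (level n y) = M n y"
proof -
  have c: "kop s (lscale s) (\<lambda>u. case prod_decode c of (n, b) \<Rightarrow> M n (single b u))" for c
    by (cases "prod_decode c") (simp add: kop_comp[OF M kop_single[OF s]])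
  have b: "norm (case prod_decode c of (n, b) \<Rightarrow> M n (single b u)) \<le> K * norm u" for c u
    using bound by (cases "prod_decode c") (metis case_prod_conv norm_single)
  show k: "kop (lscale s) (lscale s) (from_levels M)"
    unfolding from_levels_def by (rule kop_from_columns[OF s banach_scaling_lscale[OF s] c b])
  have single: "from_levels M (single (prod_encode (n, b)) u) = M n (single b u)" for b u
    unfolding from_levels_def by (subst from_columns_single[OF kop_lin[OF c] b]) simp
  show "from_levels M (level n y) = M n y"
    by (rule ell1_ext[OF kop_lin[OF kop_comp[OF k kop_level]] kop_lin[OF M]]) (simp add: level_single single)
qed

text \<open>Pelczynski's method. Writing \<open>Y\<^sub>P\<close> and \<open>Y\<^sub>Q\<close> for the ranges of \<open>P\<close> and \<open>I - P\<close>, and \<open>W\<close> for a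
  complement of the copy of \<open>Y\<close> in \<open>Y\<^sub>P\<close> that \<open>P V\<close> provides,
  \<open>Y\<^sub>P \<cong> Y \<oplus> W \<cong> Y \<oplus> Y \<oplus> W \<cong> Y \<oplus> Y\<^sub>P \<cong> \<ell>\<^sub>1(Y\<^sub>P) \<oplus> \<ell>\<^sub>1(Y\<^sub>Q) \<oplus> Y\<^sub>P \<cong> \<ell>\<^sub>1(Y\<^sub>P) \<oplus> \<ell>\<^sub>1(Y\<^sub>Q) \<cong> Y\<close>.
  The maps \<open>G\<close> and \<open>H\<close> below compose these isomorphisms, expressed by the shifts \<open>R\<close> and \<open>L\<close> between
  levels, the embedding \<open>E\<close> and the projection \<open>F\<close> for level \<open>0\<close>, and the operator \<open>Pi\<close> that acts as
  \<open>P\<close> on each level.\<close>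

lemma decomposition:
  fixes P U V :: "'a ell1 \<Rightarrow> 'a ell1"
  assumes P: "kop (lscale s) (lscale s) P" "\<And>y. P (P y) = P y"
    and U: "kop (lscale s) (lscale s) U" and V: "kop (lscale s) (lscale s) V"
    and UPV: "\<And>y. U (P (V y)) = y"
  shows "\<exists>G H. kop (lscale s) (lscale s) G \<and> kop (lscale s) (lscale s) H \<and>
    (\<forall>y. P (H y) = H y) \<and> (\<forall>y. G (H y) = y) \<and> (\<forall>x. P x = x \<longrightarrow> H (G x) = x)"
proof -
  note sl = banach_scaling_lscale[OF s]
  let ?op = "kop (lscale s) (lscale s)"
  define E :: "'a ell1 \<Rightarrow> 'a ell1" where "E = level 0"
  define R :: "'a ell1 \<Rightarrow> 'a ell1" where "R = from_levels (\<lambda>n. level (Suc n))"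
  define L :: "'a ell1 \<Rightarrow> 'a ell1" where "L = from_levels (\<lambda>n y. if n = 0 then 0 else level (n - 1) y)"
  define F :: "'a ell1 \<Rightarrow> 'a ell1" where "F = from_levels (\<lambda>n y. if n = 0 then y else 0)"
  define Pi where "Pi = from_levels (\<lambda>n y. level n (P y))"
  obtain K where K: "\<And>y. norm (P y) \<le> K * norm y"
    using bounded_linear.bounded[OF kop_lin[OF P(1)]] by (metis mult.commute)
  have E: "?op E" by (simp add: E_def kop_level)
  have R: "?op R" "R (level n y) = level (Suc n) y" for n y
    unfolding R_def by (rule from_levels[of _ 1]; simp add: kop_level norm_level_le[simplified])+
  have L: "?op L" "L (level 0 y) = 0" "L (level (Suc n) y) = level n y" for n y
  proof -
    have M: "?op (\<lambda>y. if n = 0 then 0 else level (n - 1) y)"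
      "norm (if n = 0 then 0 else level (n - 1) y) \<le> 1 * norm y" for n and y :: "'a ell1"
      using norm_level_le by (cases n; simp add: kop_level kop_zero[OF sl])+
    show "?op L" "L (level 0 y) = 0" "L (level (Suc n) y) = level n y"
      unfolding L_def using from_levels[of "\<lambda>n y. if n = 0 then 0 else level (n - 1) y", OF M]
      by simp_all
  qed
  have F: "?op F" "F (level 0 y) = y" "F (level (Suc n) y) = 0" for n y
  proof -
    have M: "?op (\<lambda>y. if n = 0 then y else 0)" "norm (if n = 0 then y else 0) \<le> 1 * norm y"
      for n :: nat and y :: "'a ell1"
      by (cases n; simp add: kop_id kop_zero[OF sl])+
    show "?op F" "F (level 0 y) = y" "F (level (Suc n) y) = 0"
      unfolding F_def using from_levels[of "\<lambda>n y. if n = 0 then y else 0", OF M] by simp_all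
  qed
  have Pi: "?op Pi" "Pi (level n y) = level n (P y)" for n y
  proof -
    have M: "?op (\<lambda>y. level n (P y))" "norm (level n (P y)) \<le> K * norm y" for n y
      using norm_level_le[of n "P y"] K[of y] by (simp_all add: kop_comp[OF kop_level P(1)])
    show "?op Pi" "Pi (level n y) = level n (P y)"
      unfolding Pi_def by (rule from_levels[of "\<lambda>n y. level n (P y)", OF M])+
  qed
  note lin = linear_simps(1,2)[OF kop_lin[OF R(1)]] linear_simps(1,2)[OF kop_lin[OF L(1)]]
    linear_simps(1,2)[OF kop_lin[OF F(1)]] linear_simps(1,2)[OF kop_lin[OF Pi(1)]]
    linear_simps(1,2)[OF kop_lin[OF E]] linear_simps(1,2)[OF kop_lin[OF P(1)]]
    linear_simps(1,2)[OF kop_lin[OF U]] linear_simps(1,2)[OF kop_lin[OF V]]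
  have z: "T 0 = 0" if "?op T" for T using linear_simps(3)[OF kop_lin[OF that]] .
  have LR: "L (R y) = y" for y
    by (rule ext_on_levels[OF kop_comp[OF L(1) R(1)] kop_id]) (simp add: L R)
  have FR: "F (R y) = 0" for y
    by (rule ext_on_levels[OF kop_comp[OF F(1) R(1)] kop_zero[OF sl]]) (simp add: F R)
  have FE: "F (E y) = y" and LE: "L (E y) = 0" and PiE: "Pi (E y) = E (P y)" for y
    by (simp_all add: E_def F L Pi)
  have split: "E (F y) + R (L y) = y" for y
  proof (rule ext_on_levels[OF kop_add[OF sl kop_comp[OF E F(1)] kop_comp[OF R(1) L(1)]] kop_id])
    show "E (F (level n y)) + R (L (level n y)) = level n y" for n y
      by (cases n) (simp_all add: F L R z[OF E] z[OF R(1)], simp add: E_def)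
  qed
  have PiR: "Pi (R y) = R (Pi y)" for y
    by (rule ext_on_levels[OF kop_comp[OF Pi(1) R(1)] kop_comp[OF R(1) Pi(1)]]) (simp add: Pi R)
  have LPi: "L (Pi y) = Pi (L y)" for y
  proof (rule ext_on_levels[OF kop_comp[OF L(1) Pi(1)] kop_comp[OF Pi(1) L(1)]])
    show "L (Pi (level n y)) = Pi (L (level n y))" for n y
      by (cases n) (simp_all add: Pi L z[OF Pi(1)])
  qed
  have FPi: "F (Pi y) = P (F y)" for y
  proof (rule ext_on_levels[OF kop_comp[OF F(1) Pi(1)] kop_comp[OF P(1) F(1)]])
    show "F (Pi (level n y)) = P (F (level n y))" for n y
      by (cases n) (simp_all add: Pi F z[OF P(1)])
  qed
  have PiPi: "Pi (Pi y) = Pi y" for y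
    by (rule ext_on_levels[OF kop_comp[OF Pi(1) Pi(1)] Pi(1)]) (simp add: Pi P)
  define A where "A y = P (V y)" for y
  have A: "?op A" unfolding A_def by (rule kop_comp[OF P(1) V])
  have UA: "U (A y) = y" and PA: "P (A y) = A y" for y by (simp_all add: A_def UPV P)
  have linA: "A (x + y) = A x + A y" "A (x - y) = A x - A y" for x y
    by (rule linear_simps[OF kop_lin[OF A]])+
  define G where "G p = E (A (F (U p)) + (p - A (U p))) + (R (Pi (L (U p))) + (L (U p) - Pi (L (U p))))" for p
  define wt where "wt y = L (Pi y) + (y - Pi y)" for y
  define H where "H y = A (E (U (P (F y))) + R (wt y)) + (P (F y) - A (U (P (F y))))" for y
  have "?op G"
    unfolding G_def
    by (intro kop_add[OF sl] kop_diff[OF sl] kop_comp[OF E] kop_comp[OF A] kop_comp[OF F(1)] U kop_id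
        kop_comp[OF R(1)] kop_comp[OF Pi(1)] kop_comp[OF L(1)])
  moreover have "?op H"
    unfolding H_def wt_def
    by (intro kop_add[OF sl] kop_diff[OF sl] kop_comp[OF E] kop_comp[OF A] kop_comp[OF P(1)] kop_comp[OF U]
        F(1) kop_id kop_comp[OF R(1)] kop_comp[OF L(1)] Pi(1))
  moreover have "P (H y) = H y" for y
    by (simp add: H_def lin PA P)
  moreover have "G (H y) = y" for y
  proof -
    have UH: "U (H y) = E (U (P (F y))) + R (wt y)"
      by (simp add: H_def lin UA)
    have "F (U (H y)) = U (P (F y))" "L (U (H y)) = wt y"
      by (simp_all add: UH lin FE FR LE LR)
    moreover have "A (U (P (F y))) + (H y - A (U (H y))) = P (F y)"
      unfolding UH by (simp add: H_def)
    moreover have "Pi (wt y) = L (Pi y)"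
      by (simp add: wt_def lin LPi PiPi)
    ultimately have "G (H y) = E (P (F y)) + (R (L (Pi y)) + (wt y - L (Pi y)))"
      by (simp add: G_def)
    also have "\<dots> = (E (F (Pi y)) + R (L (Pi y))) + (y - Pi y)"
      by (simp add: wt_def FPi)
    finally show ?thesis by (simp add: split)
  qed
  moreover have "H (G p) = p" if p: "P p = p" for p
  proof -
    define a where "a = A (F (U p)) + (p - A (U p))"
    define v where "v = L (U p)"
    have G: "G p = E a + (R (Pi v) + (v - Pi v))" by (simp add: G_def a_def v_def)
    have a: "P a = a" "U a = F (U p)" by (simp_all add: a_def lin PA UA p)
    have "P (F (G p)) = a"
      by (simp add: G lin FE FR FPi P a)
    moreover have "Pi (G p) = E a + R (Pi v)"
      by (simp add: G lin PiE PiR PiPi a)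
    then have "wt (G p) = v"
      by (simp add: wt_def lin LE LR) (simp add: G)
    ultimately have "H (G p) = A (E (F (U p)) + R v) + (a - A (F (U p)))"
      by (simp add: H_def a)
    then show ?thesis by (simp add: v_def split a_def)
  qed
  ultimately show ?thesis by blast
qed

end

section \<open>From Banach space types to spaces with explicit carriers\<close>

text \<open>An isometric isomorphism \<open>r\<close> of a Banach space type onto a space with an explicit carrier.\<close>

definition represents :: "('k::real_or_complex, 'c::ab_group_add) nspace \<Rightarrow>
    ('k \<Rightarrow> 'b::banach \<Rightarrow> 'b) \<Rightarrow> ('b \<Rightarrow> 'c) \<Rightarrow> bool" where
  "represents N s r \<longleftrightarrow> banach_scaling s \<and> bij_betw r UNIV (carrier N) \<and>
     (\<forall>x y. r (x + y) = r x + r y) \<and> (\<forall>c x. r (s c x) = smult N c (r x)) \<and>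
     (\<forall>x. nrm N (r x) = norm x)"

lemma representsD:
  assumes "represents N s r"
  shows "banach_scaling s" "r x \<in> carrier N" "r (x + y) = r x + r y" "r (x - y) = r x - r y"
    "r (s c x) = smult N c (r x)" "nrm N (r x) = norm x" "inv r (r x) = x"
    "z \<in> carrier N \<Longrightarrow> r (inv r z) = z"
proof -
  have r: "r (x + y) = r x + r y" for x y using assms by (simp add: represents_def)
  show "r (x - y) = r x - r y" using r[of "x - y" y] by simp
qed (use assms in \<open>auto simp: represents_def bij_betw_def inv_f_f f_inv_into_f\<close>)

lemma represents_whole_space: "banach_scaling s \<Longrightarrow> represents (whole_space s) s (\<lambda>x. x)"
  by (simp add: represents_def whole_space_def bij_betw_def)

lemma represents_lp_1:
  assumes s: "banach_scaling s" shows "represents (lp 1 (whole_space s)) (lscale s) coord"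
proof -
  have "range coord = {x :: nat \<Rightarrow> 'b. summable (\<lambda>n. norm (x n))}"
    using type_definition.Rep_range[OF type_definition_ell1] .
  moreover have "inj (coord :: 'b ell1 \<Rightarrow> _)" by (simp add: inj_def coord_inject)
  ultimately show ?thesis
    unfolding represents_def lp_def whole_space_def
    using banach_scaling_lscale[OF s]
    by (auto simp: bij_betw_def fun_eq_iff coord_lscale[OF s] norm_ell1_def suminf_nonneg)
qed

context
  fixes N :: "('k::real_or_complex, 'c::ab_group_add) nspace" and s :: "'k \<Rightarrow> 'b::banach \<Rightarrow> 'b" and r
    and N' :: "('k, 'd::ab_group_add) nspace" and s' :: "'k \<Rightarrow> 'e::banach \<Rightarrow> 'e" and r'
  assumes r: "represents N s r" and r': "represents N' s' r'"
begin

lemma kop_of_operator: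
  assumes T: "operator N N' T"
  shows "kop s s' (\<lambda>x. inv r' (T (r x)))" "r' (inv r' (T (r x))) = T (r x)"
proof -
  have c: "T (r x) \<in> carrier N'" for x
    using T representsD(2)[OF r] by (simp add: operator_def)
  note r_inv = representsD(8)[OF r' c]
  show "r' (inv r' (T (r x))) = T (r x)" by (rule r_inv)
  have inj: "x = y" if "r' x = r' y" for x y
    using that representsD(7)[OF r'] by metis
  obtain B where B: "\<forall>z\<in>carrier N. nrm N' (T z) \<le> B * nrm N z"
    using T unfolding operator_def by blast
  have le: "norm (inv r' (T (r x))) \<le> B * norm x" for x
    using B representsD(2,6)[OF r] representsD(6)[OF r'] r_inv by metis
  show "kop s s' (\<lambda>x. inv r' (T (r x)))"
  proof (rule kopI[OF representsD(1)[OF r] representsD(1)[OF r'] _ _ le])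
    show "inv r' (T (r (x + y))) = inv r' (T (r x)) + inv r' (T (r y))" for x y
      using T representsD(2)[OF r]
      by (intro inj) (simp add: representsD(3)[OF r'] r_inv, simp add: operator_def representsD(3)[OF r])
    show "inv r' (T (r (s k x))) = s' k (inv r' (T (r x)))" for k x
      using T representsD(2)[OF r]
      by (intro inj) (simp add: representsD(5)[OF r'] r_inv, simp add: operator_def representsD(5)[OF r])
  qed
qed

lemma operator_of_kop:
  assumes T: "kop s s' T" and A: "A \<subseteq> carrier N" "\<And>z. z \<in> A \<Longrightarrow> r' (T (inv r z)) \<in> A'"
  shows "operator (subspace_of N A) (subspace_of N' A') (\<lambda>z. r' (T (inv r z)))"
proof -
  obtain B where B: "\<And>x. norm (T x) \<le> B * norm x"
    using bounded_linear.bounded[OF kop_lin[OF T]] by (metis mult.commute)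
  have r_inv: "r (inv r z) = z" if "z \<in> A" for z using representsD(8)[OF r] A(1) that by blast
  have "inv r (z + w) = inv r z + inv r w" if "z \<in> A" "w \<in> A" for z w
    using representsD(3,7)[OF r] r_inv that by metis
  moreover have "inv r (smult N c z) = s c (inv r z)" if "z \<in> A" for c z
    using representsD(5,7)[OF r] r_inv that by metis
  moreover have bound: "nrm N' (r' (T (inv r z))) \<le> B * nrm N z" if "z \<in> A" for z
    using B[of "inv r z"] representsD(6)[OF r, of "inv r z"] r_inv[OF that]
    by (simp add: representsD(6)[OF r'])
  moreover have "\<exists>B. \<forall>z\<in>A. nrm N' (r' (T (inv r z))) \<le> B * nrm N z"
    using bound by blast
  ultimately show ?thesis
    using A(2) unfolding operator_def subspace_of_def
    by (simp add: linear_simps(1)[OF kop_lin[OF T]] kop_scale[OF T] representsD(3,5)[OF r'])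
qed

lemma operator_of_kop_whole:
  assumes "kop s s' T" shows "operator N N' (\<lambda>z. r' (T (inv r z)))"
  using operator_of_kop[OF assms order_refl, where A' = "carrier N'"] representsD(2)[OF r']
  by (simp add: subspace_of_def)

lemma opnorm_properties:
  assumes T: "operator N N' T"
  shows "opnorm N N' T \<ge> 0" "x \<in> carrier N \<Longrightarrow> nrm N' (T x) \<le> opnorm N N' T * nrm N x"
    "(\<And>x. x \<in> carrier N \<Longrightarrow> nrm N' (T x) \<le> B * nrm N x) \<Longrightarrow> B \<ge> 0 \<Longrightarrow> opnorm N N' T \<le> B"
proof -
  have nn: "nrm N x \<ge> 0" if "x \<in> carrier N" for x
    using representsD(6,8)[OF r] that by (metis norm_ge_zero)
  have ratio: "nrm N' (T x) / nrm N x \<le> B"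
    if "x \<in> carrier N" "nrm N' (T x) \<le> B * nrm N x" "B \<ge> 0" for x B
    using nn[OF that(1)] that by (cases "nrm N x = 0") (simp_all add: divide_le_eq)
  obtain B where B: "\<forall>x\<in>carrier N. nrm N' (T x) \<le> B * nrm N x"
    using T unfolding operator_def by blast
  have B': "nrm N' (T x) \<le> \<bar>B\<bar> * nrm N x" if "x \<in> carrier N" for x
    using B that mult_right_mono[OF abs_ge_self nn[OF that], of B] by (meson order_trans)
  have bdd: "bdd_above ((\<lambda>x. nrm N' (T x) / nrm N x) ` carrier N)"
    using ratio[OF _ B'] by (intro bdd_aboveI2[of _ _ "\<bar>B\<bar>"]) auto
  have up: "nrm N' (T x) / nrm N x \<le> opnorm N N' T" if "x \<in> carrier N" for x
    unfolding opnorm_def by (rule cSUP_upper[OF that bdd])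
  have "nrm N (r 0) = 0" by (simp add: representsD(6)[OF r])
  then show "opnorm N N' T \<ge> 0" using up[OF representsD(2)[OF r, of 0]] by simp
  show "nrm N' (T x) \<le> opnorm N N' T * nrm N x" if x: "x \<in> carrier N"
  proof (cases "nrm N x = 0")
    case True then show ?thesis using B' x by fastforce
  next
    case False
    then show ?thesis using up[OF x] nn[OF x] by (simp add: divide_le_eq)
  qed
  show "opnorm N N' T \<le> B" if "\<And>x. x \<in> carrier N \<Longrightarrow> nrm N' (T x) \<le> B * nrm N x" "B \<ge> 0" for B
    unfolding opnorm_def using representsD(2)[OF r] ratio that by (intro cSUP_least) auto
qed

end

text \<open>Only the product of the two norms is controlled in \<^const>\<open>factors_through\<close>; rescaling the
  factors moves the whole constant to one of them.\<close>

lemma factors_identity_iff: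
  fixes N :: "('k::real_or_complex, 'c::ab_group_add) nspace"
  assumes r: "represents N s r" and T': "kop s s T'" and T: "\<And>x. r (T' x) = T (r x)" and C: "C \<ge> 0"
  shows "factors_through N N (\<lambda>x. x) N N T C \<longleftrightarrow> factors_identity s T' C"
proof
  note s = representsD(1)[OF r]
  assume "factors_through N N (\<lambda>x. x) N N T C"
  then obtain V U where op: "operator N N V" "operator N N U"
    and UTV: "\<And>z. z \<in> carrier N \<Longrightarrow> U (T (V z)) = z" and le: "opnorm N N U * opnorm N N V \<le> C"
    unfolding factors_through_def by blast
  define v where "v = opnorm N N V"
  define V' where "V' x = inv r (V (r x))" for x
  define U' where "U' x = inv r (U (r x))" for x
  have V': "kop s s V'" "r (V' x) = V (r x)" and U': "kop s s U'" "r (U' x) = U (r x)" for x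
    unfolding V'_def U'_def by (rule kop_of_operator[OF r r op(1)] kop_of_operator[OF r r op(2)])+
  have inv: "U' (T' (V' x)) = x" for x
    using UTV[OF representsD(2)[OF r, of x]] representsD(7)[OF r] by (metis T U'(2) V'(2))
  have bound: "norm (S' x) \<le> opnorm N N S * norm x" if "operator N N S" "\<And>x. r (S' x) = S (r x)" for S S' x
    using opnorm_properties(2)[OF r r that(1) representsD(2)[OF r, of x]]
    by (simp add: representsD(6)[OF r] flip: that(2))
  have v: "v \<ge> 0" unfolding v_def by (rule opnorm_properties(1)[OF r r op(1)])
  show "factors_identity s T' C"
  proof (cases "v = 0")
    case True
    \<comment> \<open>Only the zero space admits \<open>V = 0\<close>, so that nothing has to be rescaled.\<close>
    have V0: "V' x = 0" for x using bound[OF op(1) V'(2), of x] True by (simp add: v_def)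
    have z: "x = U' (T' 0)" for x
      using inv[of x] by (simp add: V0)
    have "U' x = 0" for x
      using z[of "U' x"] z[of 0] by simp
    then have "norm (V' x) \<le> norm x" "norm (U' y) \<le> C * norm y" for x y
      using C by (simp_all add: V0)
    then show ?thesis
      using U'(1) V'(1) inv unfolding factors_identity_def by blast
  next
    case False
    with v have v: "v > 0" by simp
    have "norm (v *\<^sub>R U' y) \<le> C * norm y" for y
    proof -
      have "norm (v *\<^sub>R U' y) \<le> v * (opnorm N N U * norm y)"
        using v bound[OF op(2) U'(2), of y] by simp
      also have "\<dots> \<le> C * norm y"
        using mult_right_mono[OF le, of "norm y"] by (simp add: v_def algebra_simps)
      finally show ?thesis .
    qed
    moreover have "norm ((1 / v) *\<^sub>R V' x) \<le> norm x" for x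
      using bound[OF op(1) V'(2), of x] v by (simp add: v_def[symmetric] field_simps)
    moreover have "v *\<^sub>R U' (T' ((1 / v) *\<^sub>R V' x)) = x" for x
      using v by (simp add: linear_simps(5)[OF kop_lin[OF T']] linear_simps(5)[OF kop_lin[OF U'(1)]] inv)
    ultimately show ?thesis
      unfolding factors_identity_def
      using kop_scaleR[OF s U'(1), of v] kop_scaleR[OF s V'(1), of "1 / v"] by blast
  qed
next
  note s = representsD(1)[OF r]
  assume "factors_identity s T' C"
  then obtain U V where U: "kop s s U" and V: "kop s s V" and UTV: "\<And>x. U (T' (V x)) = x"
    and le: "\<And>x. norm (V x) \<le> norm x" "\<And>x. norm (U x) \<le> C * norm x"
    unfolding factors_identity_def by blast
  define V' where "V' z = r (V (inv r z))" for z
  define U' where "U' z = r (U (inv r z))" for z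
  have op: "operator N N V'" "operator N N U'"
    unfolding V'_def U'_def by (rule operator_of_kop_whole[OF r r] U V)+
  have norm: "norm (inv r z) = nrm N z" if "z \<in> carrier N" for z
    using representsD(6,8)[OF r] that by metis
  have "nrm N (V' z) \<le> 1 * nrm N z" "nrm N (U' z) \<le> C * nrm N z" if "z \<in> carrier N" for z
    using le[of "inv r z"] norm[OF that] by (simp_all add: U'_def V'_def representsD(6)[OF r])
  then have "opnorm N N U' \<le> C" "opnorm N N V' \<le> 1"
    using C by (intro opnorm_properties(3)[OF r r] op; simp)+
  then have "opnorm N N U' * opnorm N N V' \<le> C * 1"
    using C opnorm_properties(1)[OF r r op(1)] by (intro mult_mono) auto
  moreover have "U' (T (V' z)) = z" if "z \<in> carrier N" for z
    by (simp add: U'_def V'_def representsD(7)[OF r] UTV representsD(8)[OF r that] flip: T)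
  ultimately show "factors_through N N (\<lambda>x. x) N N T C"
    unfolding factors_through_def using op by auto
qed

lemma pfp_iff:
  fixes N :: "('k::real_or_complex, 'c::ab_group_add) nspace"
  assumes r: "represents N s r" and C: "C \<ge> 0"
  shows "pfp C N \<longleftrightarrow> (\<forall>T. kop s s T \<longrightarrow> factors_identity s T C \<or> factors_identity s (\<lambda>x. x - T x) C)"
proof -
  have iff: "(factors_through N N (\<lambda>x. x) N N T C \<or> factors_through N N (\<lambda>x. x) N N (\<lambda>x. x - T x) C) \<longleftrightarrow>
      (factors_identity s T' C \<or> factors_identity s (\<lambda>x. x - T' x) C)"
    if T': "kop s s T'" and T: "\<And>x. r (T' x) = T (r x)" for T T'
    using factors_identity_iff[where T = T, OF r T' T C]
      factors_identity_iff[where T = "\<lambda>x. x - T x", OF r kop_diff[OF representsD(1)[OF r] kop_id T'] _ C]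
    by (simp add: representsD(4)[OF r] T)
  show ?thesis
    unfolding pfp_def
  proof (intro iffI allI impI)
    fix T assume "\<forall>T. operator N N T \<longrightarrow> factors_through N N (\<lambda>x. x) N N T C \<or>
        factors_through N N (\<lambda>x. x) N N (\<lambda>x. x - T x) C" and T: "kop s s T"
    then show "factors_identity s T C \<or> factors_identity s (\<lambda>x. x - T x) C"
      using operator_of_kop_whole[OF r r T] iff[OF T, of "\<lambda>z. r (T (inv r z))"] by (simp add: representsD(7)[OF r])
  next
    fix T assume *: "\<forall>T. kop s s T \<longrightarrow> factors_identity s T C \<or> factors_identity s (\<lambda>x. x - T x) C"
      and T: "operator N N T"
    show "factors_through N N (\<lambda>x. x) N N T C \<or> factors_through N N (\<lambda>x. x) N N (\<lambda>x. x - T x) C"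
      using kop_of_operator[OF r r T] * iff[OF kop_of_operator(1)[OF r r T], of T] by simp
  qed
qed

text \<open>If \<open>R A\<close> is the identity of \<open>\<ell>\<^sub>1\<close>, then \<open>A R\<close> is a projection of \<open>X\<close> onto a copy of \<open>\<ell>\<^sub>1\<close>.\<close>

lemma contains_complemented_l1I:
  fixes s :: "'k::real_or_complex \<Rightarrow> 'a::banach \<Rightarrow> 'a"
  assumes s: "banach_scaling s" and R: "kop s (lscale (*)) R" and A: "kop (lscale (*)) s A"
    and RA: "\<And>c :: 'k ell1. R (A c) = c"
  shows "contains_complemented_l1 (whole_space s)"
proof -
  define X where "X = whole_space s"
  note rX = represents_whole_space[OF s, folded X_def]
  note rl = represents_lp_1[OF banach_scaling_mult, folded scalar_space_def]
  define P where "P x = A (R x)" for x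
  have inv_id: "inv (\<lambda>x::'a. x) = (\<lambda>x. x)" using inv_id by (simp add: id_def)
  have "operator X X P"
    using operator_of_kop_whole[OF rX rX kop_comp[OF A R]] by (simp add: P_def[abs_def] inv_id)
  then have "projection X P" by (simp add: projection_def P_def RA)
  moreover have "isomorphic (subspace_of X (P ` carrier X)) (lp 1 (scalar_space :: ('k, 'k) nspace))"
    unfolding isomorphic_def
  proof (intro exI conjI ballI)
    have c: "carrier X = UNIV" by (simp add: X_def whole_space_def)
    show "operator (subspace_of X (P ` carrier X)) (lp 1 scalar_space) (\<lambda>x. coord (R x))"
      using operator_of_kop[OF rX rl R _ representsD(2)[OF rl], of "P ` carrier X"]
      by (simp add: c subspace_of_def inv_id)
    have A_in: "A y \<in> P ` carrier X" for y
      by (rule image_eqI[of _ _ "A y"]) (simp_all add: P_def RA c)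
    show "operator (lp 1 scalar_space) (subspace_of X (P ` carrier X)) (\<lambda>z. A (inv coord z))"
      using operator_of_kop[OF rl rX A, of "carrier (lp 1 scalar_space)" "P ` carrier X"] A_in
      by (simp add: subspace_of_def)
    show "A (inv coord (coord (R x))) = x" if "x \<in> carrier (subspace_of X (P ` carrier X))" for x
      using that by (auto simp: subspace_of_def P_def RA representsD(7)[OF rl])
    show "coord (R (A (inv coord z))) = z" if "z \<in> carrier (lp 1 scalar_space)" for z
      by (simp add: RA representsD(8)[OF rl that])
  qed
  ultimately show ?thesis
    unfolding contains_complemented_l1_def X_def by blast
qed

lemma isomorphic_range_of_projection:
  fixes s :: "'k::real_or_complex \<Rightarrow> 'a::banach \<Rightarrow> 'a"
  defines "Y \<equiv> lp 1 (whole_space s)"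
  assumes s: "banach_scaling s" and P: "kop (lscale s) (lscale s) P" "\<And>y. P (P y) = P y"
    and fact: "factors_identity (lscale s) P C" and Q: "\<And>y. coord (P y) = Q (coord y)"
  shows "isomorphic (subspace_of Y (Q ` carrier Y)) Y"
proof -
  note r = represents_lp_1[OF s, folded Y_def]
  obtain U V where U: "kop (lscale s) (lscale s) U" and V: "kop (lscale s) (lscale s) V"
    and UPV: "\<And>y. U (P (V y)) = y"
    using fact unfolding factors_identity_def by blast
  from decomposition[OF s P U V UPV]
  obtain G H where GH: "kop (lscale s) (lscale s) G \<and> kop (lscale s) (lscale s) H \<and>
      (\<forall>y. P (H y) = H y) \<and> (\<forall>y. G (H y) = y) \<and> (\<forall>x. P x = x \<longrightarrow> H (G x) = x)"
    by (elim exE)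
  then have G: "kop (lscale s) (lscale s) G" and H: "kop (lscale s) (lscale s) H" by simp_all
  have sub: "Q ` carrier Y \<subseteq> carrier Y"
    using representsD(2,8)[OF r] by (metis Q image_subsetI)
  have H_in: "coord (H y) \<in> Q ` carrier Y" for y
    using GH Q[of "H y"] representsD(2)[OF r] by (metis image_eqI)
  show ?thesis
    unfolding isomorphic_def
  proof (intro exI conjI ballI)
    show "operator (subspace_of Y (Q ` carrier Y)) Y (\<lambda>z. coord (G (inv coord z)))"
      using operator_of_kop[OF r r G sub, of "carrier Y"] representsD(2)[OF r] by (simp add: subspace_of_def)
    show "operator Y (subspace_of Y (Q ` carrier Y)) (\<lambda>z. coord (H (inv coord z)))"
      using operator_of_kop[OF r r H order_refl, of "Q ` carrier Y"] H_in by (simp add: subspace_of_def)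
    show "coord (H (inv coord (coord (G (inv coord z))))) = z"
      if z: "z \<in> carrier (subspace_of Y (Q ` carrier Y))" for z
    proof -
      obtain w where w: "w \<in> carrier Y" "z = Q w"
        using z by (auto simp: subspace_of_def)
      then have "z = coord (P (inv coord w))"
        by (simp add: Q representsD(8)[OF r])
      then show ?thesis using GH P(2) by (simp add: representsD(7)[OF r])
    qed
    show "coord (G (inv coord (coord (H (inv coord z))))) = z" if "z \<in> carrier Y" for z
      using GH by (simp add: representsD(7)[OF r] representsD(8)[OF r that])
  qed
qed

section \<open>The uniform primary factorisation property of \<open>\<ell>\<^sub>1(X)\<close>\<close>

theorem theorem1p3:
  fixes scl :: "'k::real_or_complex \<Rightarrow> 'a::banach \<Rightarrow> 'a"
    and X :: "('k, 'a) nspace"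
  assumes banach: "banach_scaling scl" "X = whole_space scl"
    and iso: "isomorphic X (c0 X) \<or> (\<exists>p::ereal. 1 < p \<and> p \<le> \<infinity> \<and> isomorphic X (lp p X))"
    and no_l1: "\<not> contains_complemented_l1 X"
    and upfp: "upfp X"
  shows "upfp (lp 1 X) \<and> primary (lp 1 X)"
proof -
  note s = banach(1) and X = banach(2)
  note rX = represents_whole_space[OF s, folded X] and rY = represents_lp_1[OF s, folded X]
  have "\<exists>E. sublinear_disjoint_sums scl E \<and> isomorphic X E"
    using iso
  proof (elim disjE exE conjE)
    assume "isomorphic X (c0 X)"
    then show ?thesis using sublinear_disjoint_sums_c0 unfolding X by blast
  next
    fix p :: ereal assume p: "1 < p" "isomorphic X (lp p X)"
    show ?thesis
    proof (cases p)
      case (real q)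
      then show ?thesis using p sublinear_disjoint_sums_lp[of q scl] unfolding X by auto
    next
      case PInf
      then show ?thesis using p sublinear_disjoint_sums_linf unfolding X by blast
    qed (use p in simp)
  qed
  then obtain D \<G> where D: "D > 0" and G: "splitting_family scl D \<G>"
    using splitting_family_of_isomorphic[OF s] unfolding X by blast
  obtain C where C: "C \<ge> 1" and pfp: "pfp C X"
    using upfp unfolding upfp_def by blast
  have pfpX: "factors_identity scl T C \<or> factors_identity scl (\<lambda>x. x - T x) C" if "kop scl scl T" for T
    using pfp pfp_iff[OF rX, of C] C that by simp
  have no_l1': "\<nexists>R A. kop scl (lscale (*)) R \<and> kop (lscale (*)) scl A \<and> (\<forall>c :: 'k ell1. R (A c) = c)"
    using no_l1 contains_complemented_l1I[OF s] unfolding X by blast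
  define C' where "C' = max 1 (2 * D\<^sup>2 * C)"
  have mono: "factors_identity s T C'" if "factors_identity s T (2 * D\<^sup>2 * C)"
    for s :: "'k \<Rightarrow> 'a ell1 \<Rightarrow> 'a ell1" and T
  proof -
    have "2 * D\<^sup>2 * C * norm x \<le> C' * norm x" for x :: "'a ell1"
      unfolding C'_def by (intro mult_right_mono) auto
    then show ?thesis using that unfolding factors_identity_def by (meson order_trans)
  qed
  have pfpY: "factors_identity (lscale scl) T C' \<or> factors_identity (lscale scl) (\<lambda>x. x - T x) C'"
    if "kop (lscale scl) (lscale scl) T" for T
    using factors_identity_ell1[OF s G D no_l1' _ pfpX that] C mono by auto
  have "pfp C' (lp 1 X)"
    using pfp_iff[OF rY, of C'] pfpY by (simp add: C'_def)
  then have "upfp (lp 1 X)"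
    unfolding upfp_def by (intro exI[of _ C']) (simp add: C'_def)
  moreover have "primary (lp 1 X)"
    unfolding primary_def
  proof (intro allI impI)
    fix P assume "projection (lp 1 X) P"
    then have P: "operator (lp 1 X) (lp 1 X) P" "\<And>x. x \<in> carrier (lp 1 X) \<Longrightarrow> P (P x) = P x"
      by (simp_all add: projection_def)
    define P' where "P' y = inv coord (P (coord y))" for y
    have P': "kop (lscale scl) (lscale scl) P'" "coord (P' y) = P (coord y)" for y
      unfolding P'_def by (rule kop_of_operator[OF rY rY P(1)])+
    have PP: "P' (P' y) = P' y" for y
      using P(2)[OF representsD(2)[OF rY, of y]] by (metis P'(2) coord_inject)
    have Q': "kop (lscale scl) (lscale scl) (\<lambda>y. y - P' y)"
      by (rule kop_diff[OF banach_scaling_lscale[OF s] kop_id P'(1)])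
    have QQ: "(y - P' y) - P' (y - P' y) = y - P' y" for y
      by (simp add: linear_simps(2)[OF kop_lin[OF P'(1)]] PP)
    have cQ: "coord (y - P' y) = coord y - P (coord y)" for y
      by (simp add: fun_eq_iff flip: P'(2))
    show "isomorphic (subspace_of (lp 1 X) (P ` carrier (lp 1 X))) (lp 1 X) \<or>
        isomorphic (subspace_of (lp 1 X) ((\<lambda>x. x - P x) ` carrier (lp 1 X))) (lp 1 X)"
      using pfpY[OF P'(1)] isomorphic_range_of_projection[OF s P'(1) PP _ P'(2)]
        isomorphic_range_of_projection[OF s Q' QQ _ cQ]
      unfolding X by blast
  qed
  ultimately show ?thesis ..
qed

end
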